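(* Let $G$ be a semisimple connected Lie group of non-compact type with finite center, with maximal compact subgroup $K$ and minimal parabolic subgroup $P$. Let $\mathcal{F}_{G/K}$ be the set of maximal flats of the symmetric space $G/K$ and let $$(\mathcal{F}_{G/K}\times G/P)_{\mathrm{opp}}:=\{(F,x)\in \mathcal{F}_{G/K}\times G/P \mid x \text{ is opposite to every point in } \partial F\}.$$ Then there exists a $G$-equivariant continuous map $$\Phi:(\mathcal{F}_{G/K}\times G/P)_{\mathrm{opp}}\longrightarrow G/K$$ such that, furthermore, $\Phi(F,x)\in F$ for every $(F,x)\in(\mathcal{F}_{G/K}\times G/P)_{\mathrm{opp}}$.
   Context: $A<P$ is a maximal split torus. The choices are compatible in the standard way: there is a Cartan decomposition $\mathfrak{g}=\mathfrak{k}\oplus\mathfrak{p}$ with $\mathfrak{k}=\mathrm{Lie}(K)$, a maximal abelian subspace $\mathfrak{a}\subset\mathfrak{p}$ with $A=\exp(\mathfrak{a})$, and a choice of positive restricted roots such that $P=MAN$, where $M=Z_K(A)$ is the centralizer of $A$ in $K$ and $N$ is the unipotent radical of $P$ (the sum of positive root spaces exponentiated). Let $T=N_K(A)$ be the normalizer of $A$ in $K$ and $W=T/M$ the Weyl group. Let $w_0\in T$ be a representative of the longest element of $W$ (longest with respect to this choice of positive roots). The canonical maximal flat is $F_A:=\{aK\mid a\in A\}\subset G/K$. There is only one $G$-orbit of maximal flats, so $\mathcal{F}_{G/K}=\{gF_A\mid g\in G\}$; it is topologized as the homogeneous space $G/\mathrm{Stab}_G(F_A)$, where $\mathrm{Stab}_G(F_A)=TA$.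 The boundary of $F_A$ is $\partial F_A=\{wP\mid w\in W\}\subset G/P$ (well defined since $M<P$), and $\partial(gF_A)=g(\partial F_A)$ for $g\in G$. A pair of points of $G/P$ is called opposite if it lies in the $G$-orbit (diagonal action) of the pair $(P,w_0P)$; this relation is symmetric. $G$ acts on $\mathcal{F}_{G/K}\times G/P$ diagonally, preserving $(\mathcal{F}_{G/K}\times G/P)_{\mathrm{opp}}$, which carries the subspace topology; $G$ acts on $G/K$ by left multiplication. *)

theory Defs
  imports "HOL-Analysis.Analysis" "HOL-Algebra.Coset"
begin

section \<open>Quotient topologies\<close>

definition quotient_topology :: "'a topology \<Rightarrow> ('a \<Rightarrow> 'b) \<Rightarrow> 'b topology" where
  "quotient_topology X q =
     topology (\<lambda>U. U \<subseteq> q ` topspace X \<and> openin X {x \<in> topspace X. q x \<in> U})"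

lemma openin_quotient_topology:
  "openin (quotient_topology X q) U \<longleftrightarrow>
     U \<subseteq> q ` topspace X \<and> openin X {x \<in> topspace X. q x \<in> U}"
proof -
  have "istopology (\<lambda>U. U \<subseteq> q ` topspace X \<and> openin X {x \<in> topspace X. q x \<in> U})"
    unfolding istopology_def
  proof (intro conjI allI impI)
    fix S T
    assume S: "S \<subseteq> q ` topspace X \<and> openin X {x \<in> topspace X. q x \<in> S}"
      and T: "T \<subseteq> q ` topspace X \<and> openin X {x \<in> topspace X. q x \<in> T}"
    show "S \<inter> T \<subseteq> q ` topspace X" using S by blast
    have "{x \<in> topspace X. q x \<in> S \<inter> T} =
        {x \<in> topspace X. q x \<in> S} \<inter> {x \<in> topspace X. q x \<in> T}"
      by blast
    then show "openin X {x \<in> topspace X. q x \<in> S \<inter> T}"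
      using S T by (simp add: openin_Int)
  next
    fix \<U>
    assume U: "\<forall>S\<in>\<U>. S \<subseteq> q ` topspace X \<and> openin X {x \<in> topspace X. q x \<in> S}"
    show "\<Union> \<U> \<subseteq> q ` topspace X" using U by blast
    have "{x \<in> topspace X. q x \<in> \<Union> \<U>} = (\<Union>S\<in>\<U>. {x \<in> topspace X. q x \<in> S})"
      by blast
    then show "openin X {x \<in> topspace X. q x \<in> \<Union> \<U>}"
      using U by auto
  qed
  then show ?thesis
    by (simp add: quotient_topology_def)
qed

lemma topspace_quotient_topology: "topspace (quotient_topology X q) = q ` topspace X"
proof
  show "topspace (quotient_topology X q) \<subseteq> q ` topspace X"
    by (meson openin_quotient_topology openin_topspace)
  have "{x \<in> topspace X. q x \<in> q ` topspace X} = topspace X"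
    by blast
  then have "openin (quotient_topology X q) (q ` topspace X)"
    by (simp add: openin_quotient_topology)
  then show "q ` topspace X \<subseteq> topspace (quotient_topology X q)"
    by (rule openin_subset)
qed

lemma quotient_map_quotient_topology: "quotient_map X (quotient_topology X q) q"
  unfolding quotient_map_def
  by (auto simp: topspace_quotient_topology openin_quotient_topology)

section \<open>Smooth maps and Lie groups\<close>

text \<open>Only meant for open \<open>S\<close>; there \<open>Ck_on k S f\<close> says that \<open>f\<close> is of class \<open>C\<^sup>k\<close> on \<open>S\<close>.\<close>

primrec Ck_on :: "nat \<Rightarrow> 'a::euclidean_space set \<Rightarrow> ('a \<Rightarrow> 'b::euclidean_space) \<Rightarrow> bool" where
  "Ck_on 0 S f \<longleftrightarrow> continuous_on S f"
| "Ck_on (Suc k) S f \<longleftrightarrow>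
     f differentiable_on S \<and> (\<forall>v. Ck_on k S (\<lambda>x. frechet_derivative f (at x) v))"

definition smooth_on :: "'a::euclidean_space set \<Rightarrow> ('a \<Rightarrow> 'b::euclidean_space) \<Rightarrow> bool" where
  "smooth_on S f \<longleftrightarrow> (\<forall>k. Ck_on k S f)"

text \<open>A chart is a pair of its domain and its coordinate map; values of the coordinate map
  outside the domain are irrelevant.\<close>

type_synonym ('g, 'e) chart = "'g set \<times> ('g \<Rightarrow> 'e)"

definition chart_inv :: "('g, 'e) chart \<Rightarrow> 'e \<Rightarrow> 'g" where
  "chart_inv c = inv_into (fst c) (snd c)"

definition smooth_atlas :: "'g topology \<Rightarrow> ('g, 'e::euclidean_space) chart set \<Rightarrow> bool" where
  "smooth_atlas X \<A> \<longleftrightarrow>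
     (\<forall>c\<in>\<A>. openin X (fst c) \<and> open (snd c ` fst c) \<and>
        homeomorphic_map (subtopology X (fst c)) (top_of_set (snd c ` fst c)) (snd c)) \<and>
     topspace X = (\<Union>c\<in>\<A>. fst c) \<and>
     (\<forall>c\<in>\<A>. \<forall>d\<in>\<A>. smooth_on (snd c ` (fst c \<inter> fst d)) (\<lambda>v. snd d (chart_inv c v)))"

record ('g, 'e) lie_struct = "'g monoid" +
  topo :: "'g topology"
  atlas :: "('g, 'e) chart set"

locale lie_group = group G
  for G :: "('g, 'e::euclidean_space, 'm) lie_struct_scheme" (structure) +
  assumes topspace_topo: "topspace (topo G) = carrier G"
    and hausdorff: "Hausdorff_space (topo G)"
    and second_countable: "second_countable (topo G)"
    and smooth_atlas: "smooth_atlas (topo G) (atlas G)"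
    and continuous_mult:
      "continuous_map (prod_topology (topo G) (topo G)) (topo G) (\<lambda>(x, y). x \<otimes> y)"
    and smooth_mult:
      "\<lbrakk>c \<in> atlas G; d \<in> atlas G; b \<in> atlas G\<rbrakk> \<Longrightarrow>
         smooth_on
           {(v, w). v \<in> snd c ` fst c \<and> w \<in> snd d ` fst d \<and> chart_inv c v \<otimes> chart_inv d w \<in> fst b}
           (\<lambda>(v, w). snd b (chart_inv c v \<otimes> chart_inv d w))"
    and continuous_inv: "continuous_map (topo G) (topo G) (\<lambda>x. inv x)"
    and smooth_inv:
      "\<lbrakk>c \<in> atlas G; b \<in> atlas G\<rbrakk> \<Longrightarrow>
         smooth_on {v \<in> snd c ` fst c. inv (chart_inv c v) \<in> fst b}
           (\<lambda>v. snd b (inv (chart_inv c v)))"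

section \<open>The Lie algebra and the exponential map\<close>

text \<open>The Lie algebra is the tangent space at the identity, identified with \<open>'e\<close> by means of an
  arbitrary chart at the identity. A different chart yields an isomorphic Lie algebra, with the
  same exponential map up to that isomorphism.\<close>

definition id_chart :: "('g, 'e, 'm) lie_struct_scheme \<Rightarrow> ('g, 'e) chart" where
  "id_chart G = (SOME c. c \<in> atlas G \<and> \<one>\<^bsub>G\<^esub> \<in> fst c)"

definition id_coord :: "('g, 'e, 'm) lie_struct_scheme \<Rightarrow> 'e" where
  "id_coord G = snd (id_chart G) \<one>\<^bsub>G\<^esub>"

text \<open>\<open>Ad g\<close> is the differential of conjugation by \<open>g\<close> at the identity, and the bracket
  \<open>[X, Y] = ad X Y\<close> is given by the differential \<open>ad\<close> of \<open>Ad\<close> at the identity.\<close>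

definition Ad :: "('g, 'e::euclidean_space, 'm) lie_struct_scheme \<Rightarrow> 'g \<Rightarrow> 'e \<Rightarrow> 'e" where
  "Ad G g X =
     frechet_derivative
       (\<lambda>v. snd (id_chart G) (g \<otimes>\<^bsub>G\<^esub> chart_inv (id_chart G) v \<otimes>\<^bsub>G\<^esub> inv\<^bsub>G\<^esub> g))
       (at (id_coord G)) X"

definition bracket :: "('g, 'e::euclidean_space, 'm) lie_struct_scheme \<Rightarrow> 'e \<Rightarrow> 'e \<Rightarrow> 'e" where
  "bracket G X Y =
     frechet_derivative (\<lambda>v. Ad G (chart_inv (id_chart G) v) Y) (at (id_coord G)) X"

definition one_parameter_subgroup ::
    "('g, 'e::euclidean_space, 'm) lie_struct_scheme \<Rightarrow> 'e \<Rightarrow> (real \<Rightarrow> 'g) \<Rightarrow> bool" where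
  "one_parameter_subgroup G X \<gamma> \<longleftrightarrow>
     continuous_map euclideanreal (topo G) \<gamma> \<and>
     (\<forall>s t. \<gamma> (s + t) = \<gamma> s \<otimes>\<^bsub>G\<^esub> \<gamma> t) \<and>
     ((\<lambda>t. snd (id_chart G) (\<gamma> t)) has_vector_derivative X) (at 0)"

definition lie_exp :: "('g, 'e::euclidean_space, 'm) lie_struct_scheme \<Rightarrow> 'e \<Rightarrow> 'g" where
  "lie_exp G X = (THE \<gamma>. one_parameter_subgroup G X \<gamma>) 1"

text \<open>The Lie algebra of a closed subgroup \<open>H\<close>.\<close>

definition lie_subalgebra :: "('g, 'e::euclidean_space, 'm) lie_struct_scheme \<Rightarrow> 'g set \<Rightarrow> 'e set" where
  "lie_subalgebra G H = {X. \<forall>t. lie_exp G (t *\<^sub>R X) \<in> H}"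

definition linear_trace :: "('e::euclidean_space \<Rightarrow> 'e) \<Rightarrow> real" where
  "linear_trace f = (\<Sum>b\<in>Basis. f b \<bullet> b)"

definition killing :: "('g, 'e::euclidean_space, 'm) lie_struct_scheme \<Rightarrow> 'e \<Rightarrow> 'e \<Rightarrow> real" where
  "killing G X Y = linear_trace (\<lambda>Z. bracket G X (bracket G Y Z))"

definition lie_ideal :: "('g, 'e::euclidean_space, 'm) lie_struct_scheme \<Rightarrow> 'e set \<Rightarrow> bool" where
  "lie_ideal G I \<longleftrightarrow> subspace I \<and> (\<forall>X. \<forall>Y\<in>I. bracket G X Y \<in> I)"

definition derived_algebra :: "('g, 'e::euclidean_space, 'm) lie_struct_scheme \<Rightarrow> 'e set \<Rightarrow> 'e set" where
  "derived_algebra G V = span {bracket G X Y | X Y. X \<in> V \<and> Y \<in> V}"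

definition solvable_subalgebra :: "('g, 'e::euclidean_space, 'm) lie_struct_scheme \<Rightarrow> 'e set \<Rightarrow> bool" where
  "solvable_subalgebra G V \<longleftrightarrow> (\<exists>n. (derived_algebra G ^^ n) V = {0})"

definition semisimple :: "('g, 'e::euclidean_space, 'm) lie_struct_scheme \<Rightarrow> bool" where
  "semisimple G \<longleftrightarrow> (\<forall>I. lie_ideal G I \<and> solvable_subalgebra G I \<longrightarrow> I = {0})"

text \<open>For semisimple \<open>G\<close>: there are no compact factors, that is, no nonzero ideal is a compact
  Lie algebra. The Killing form of an ideal is the restriction of the ambient Killing form, and
  a semisimple Lie algebra is compact iff its Killing form is negative definite.\<close>

definition noncompact_type :: "('g, 'e::euclidean_space, 'm) lie_struct_scheme \<Rightarrow> bool" where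
  "noncompact_type G \<longleftrightarrow>
     (\<forall>I. lie_ideal G I \<and> (\<forall>X\<in>I. X \<noteq> 0 \<longrightarrow> killing G X X < 0) \<longrightarrow> I = {0})"

section \<open>Cartan decomposition and restricted roots\<close>

definition group_center :: "('g, 'm) monoid_scheme \<Rightarrow> 'g set" where
  "group_center G = {z \<in> carrier G. \<forall>g\<in>carrier G. z \<otimes>\<^bsub>G\<^esub> g = g \<otimes>\<^bsub>G\<^esub> z}"

definition maximal_compact_subgroup ::
    "('g, 'e::euclidean_space, 'm) lie_struct_scheme \<Rightarrow> 'g set \<Rightarrow> bool" where
  "maximal_compact_subgroup G K \<longleftrightarrow>
     subgroup K G \<and> compactin (topo G) K \<and>
     (\<forall>L. subgroup L G \<and> compactin (topo G) L \<and> K \<subseteq> L \<longrightarrow> L = K)"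

definition cartan_involution ::
    "('g, 'e::euclidean_space, 'm) lie_struct_scheme \<Rightarrow> ('e \<Rightarrow> 'e) \<Rightarrow> bool" where
  "cartan_involution G \<theta> \<longleftrightarrow>
     linear \<theta> \<and> (\<forall>X. \<theta> (\<theta> X) = X) \<and>
     (\<forall>X Y. \<theta> (bracket G X Y) = bracket G (\<theta> X) (\<theta> Y)) \<and>
     (\<forall>X. X \<noteq> 0 \<longrightarrow> - killing G X (\<theta> X) > 0)"

definition cartan_decomposition ::
    "('g, 'e::euclidean_space, 'm) lie_struct_scheme \<Rightarrow> 'e set \<Rightarrow> 'e set \<Rightarrow> bool" where
  "cartan_decomposition G \<kk> \<pp> \<longleftrightarrow>
     (\<exists>\<theta>. cartan_involution G \<theta> \<and> \<kk> = {X. \<theta> X = X} \<and> \<pp> = {X. \<theta> X = - X})"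

definition abelian_subspace ::
    "('g, 'e::euclidean_space, 'm) lie_struct_scheme \<Rightarrow> 'e set \<Rightarrow> bool" where
  "abelian_subspace G \<aa> \<longleftrightarrow> subspace \<aa> \<and> (\<forall>X\<in>\<aa>. \<forall>Y\<in>\<aa>. bracket G X Y = 0)"

definition maximal_abelian_subspace ::
    "('g, 'e::euclidean_space, 'm) lie_struct_scheme \<Rightarrow> 'e set \<Rightarrow> 'e set \<Rightarrow> bool" where
  "maximal_abelian_subspace G \<pp> \<aa> \<longleftrightarrow>
     abelian_subspace G \<aa> \<and> \<aa> \<subseteq> \<pp> \<and>
     (\<forall>\<bb>. abelian_subspace G \<bb> \<and> \<aa> \<subseteq> \<bb> \<and> \<bb> \<subseteq> \<pp> \<longrightarrow> \<bb> = \<aa>)"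

definition root_space ::
    "('g, 'e::euclidean_space, 'm) lie_struct_scheme \<Rightarrow> 'e set \<Rightarrow> ('e \<Rightarrow> real) \<Rightarrow> 'e set" where
  "root_space G \<aa> \<alpha> = {X. \<forall>H\<in>\<aa>. bracket G H X = \<alpha> H *\<^sub>R X}"

text \<open>Linear functionals on \<open>\<aa>\<close> are represented by functions restricted to \<open>\<aa>\<close>, so that equality
  of functions is equality of functionals.\<close>

definition restricted_roots ::
    "('g, 'e::euclidean_space, 'm) lie_struct_scheme \<Rightarrow> 'e set \<Rightarrow> ('e \<Rightarrow> real) set" where
  "restricted_roots G \<aa> =
     {\<alpha>. (\<exists>f. linear f \<and> \<alpha> = restrict f \<aa>) \<and> (\<exists>H\<in>\<aa>. \<alpha> H \<noteq> 0) \<and> root_space G \<aa> \<alpha> \<noteq> {0}}"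

text \<open>A choice of positive roots: those positive on the Weyl chamber of a regular element.\<close>

definition positive_system ::
    "('g, 'e::euclidean_space, 'm) lie_struct_scheme \<Rightarrow> 'e set \<Rightarrow> ('e \<Rightarrow> real) set \<Rightarrow> bool" where
  "positive_system G \<aa> Pos \<longleftrightarrow>
     (\<exists>H\<in>\<aa>. (\<forall>\<alpha>\<in>restricted_roots G \<aa>. \<alpha> H \<noteq> 0) \<and>
            Pos = {\<alpha> \<in> restricted_roots G \<aa>. \<alpha> H > 0})"

definition simple_roots :: "'e set \<Rightarrow> ('e \<Rightarrow> real) set \<Rightarrow> ('e \<Rightarrow> real) set" where
  "simple_roots \<aa> Pos =
     {\<alpha> \<in> Pos. \<not> (\<exists>\<beta>\<in>Pos. \<exists>\<gamma>\<in>Pos. \<forall>H\<in>\<aa>. \<alpha> H = \<beta> H + \<gamma> H)}"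

section \<open>The groups \<open>A\<close>, \<open>N\<close>, \<open>M\<close>, \<open>P\<close> and the Weyl group\<close>

definition split_torus ::
    "('g, 'e::euclidean_space, 'm) lie_struct_scheme \<Rightarrow> 'e set \<Rightarrow> 'g set" where
  "split_torus G \<aa> = lie_exp G ` \<aa>"

definition unipotent_radical ::
    "('g, 'e::euclidean_space, 'm) lie_struct_scheme \<Rightarrow> 'e set \<Rightarrow> ('e \<Rightarrow> real) set \<Rightarrow> 'g set" where
  "unipotent_radical G \<aa> Pos = lie_exp G ` span (\<Union>\<alpha>\<in>Pos. root_space G \<aa> \<alpha>)"

definition centralizer_in :: "('g, 'm) monoid_scheme \<Rightarrow> 'g set \<Rightarrow> 'g set \<Rightarrow> 'g set" where
  "centralizer_in G K A = {k \<in> K. \<forall>a\<in>A. k \<otimes>\<^bsub>G\<^esub> a = a \<otimes>\<^bsub>G\<^esub> k}"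

definition normalizer_in :: "('g, 'm) monoid_scheme \<Rightarrow> 'g set \<Rightarrow> 'g set \<Rightarrow> 'g set" where
  "normalizer_in G K A = {k \<in> K. (\<lambda>a. k \<otimes>\<^bsub>G\<^esub> a \<otimes>\<^bsub>G\<^esub> inv\<^bsub>G\<^esub> k) ` A = A}"

definition minimal_parabolic ::
    "('g, 'e::euclidean_space, 'm) lie_struct_scheme \<Rightarrow> 'g set \<Rightarrow> 'e set \<Rightarrow> ('e \<Rightarrow> real) set \<Rightarrow> 'g set"
  where
  "minimal_parabolic G K \<aa> Pos =
     centralizer_in G K (split_torus G \<aa>) <#>\<^bsub>G\<^esub> split_torus G \<aa>
       <#>\<^bsub>G\<^esub> unipotent_radical G \<aa> Pos"

definition weyl_group ::
    "('g, 'e::euclidean_space, 'm) lie_struct_scheme \<Rightarrow> 'g set \<Rightarrow> 'e set \<Rightarrow> 'g set monoid" where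
  "weyl_group G K \<aa> =
     (G\<lparr>carrier := normalizer_in G K (split_torus G \<aa>)\<rparr>) Mod centralizer_in G K (split_torus G \<aa>)"

text \<open>The elements of the Weyl group acting on \<open>\<aa>\<close> as the reflection (orthogonal with respect to
  the Killing form) in the kernel of a simple root.\<close>

definition simple_reflections ::
    "('g, 'e::euclidean_space, 'm) lie_struct_scheme \<Rightarrow> 'g set \<Rightarrow> 'e set \<Rightarrow> ('e \<Rightarrow> real) set
      \<Rightarrow> 'g set set" where
  "simple_reflections G K \<aa> Pos =
     {centralizer_in G K (split_torus G \<aa>) #>\<^bsub>G\<^esub> s | s.
        s \<in> normalizer_in G K (split_torus G \<aa>) \<and>
        (\<exists>\<alpha>\<in>simple_roots \<aa> Pos.
           (\<forall>H\<in>\<aa>. \<alpha> H = 0 \<longrightarrow> Ad G s H = H) \<and>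
           (\<forall>H\<in>\<aa>. (\<forall>H'\<in>\<aa>. \<alpha> H' = 0 \<longrightarrow> killing G H H' = 0) \<longrightarrow> Ad G s H = - H))}"

definition weyl_length ::
    "('g, 'e::euclidean_space, 'm) lie_struct_scheme \<Rightarrow> 'g set \<Rightarrow> 'e set \<Rightarrow> ('e \<Rightarrow> real) set
      \<Rightarrow> 'g set \<Rightarrow> nat" where
  "weyl_length G K \<aa> Pos w =
     (LEAST n. \<exists>ss. length ss = n \<and> set ss \<subseteq> simple_reflections G K \<aa> Pos \<and>
        foldr (\<otimes>\<^bsub>weyl_group G K \<aa>\<^esub>) ss \<one>\<^bsub>weyl_group G K \<aa>\<^esub> = w)"

definition represents_longest ::
    "('g, 'e::euclidean_space, 'm) lie_struct_scheme \<Rightarrow> 'g set \<Rightarrow> 'e set \<Rightarrow> ('e \<Rightarrow> real) set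
      \<Rightarrow> 'g \<Rightarrow> bool" where
  "represents_longest G K \<aa> Pos w0 \<longleftrightarrow>
     w0 \<in> normalizer_in G K (split_torus G \<aa>) \<and>
     (\<forall>w\<in>carrier (weyl_group G K \<aa>).
        weyl_length G K \<aa> Pos w
          \<le> weyl_length G K \<aa> Pos (centralizer_in G K (split_torus G \<aa>) #>\<^bsub>G\<^esub> w0))"

section \<open>Homogeneous spaces, flats and opposition\<close>

text \<open>The set of left cosets \<open>G/H\<close> is the topological space of the quotient topology below;
  \<open>g \<in> G\<close> acts on it by \<open>C \<mapsto> g <# C\<close>.\<close>

definition homogeneous_space ::
    "('g, 'e::euclidean_space, 'm) lie_struct_scheme \<Rightarrow> 'g set \<Rightarrow> 'g set topology" where
  "homogeneous_space G H = quotient_topology (topo G) (\<lambda>g. g <#\<^bsub>G\<^esub> H)"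

definition translate_flat ::
    "('g, 'm) monoid_scheme \<Rightarrow> 'g \<Rightarrow> 'g set set \<Rightarrow> 'g set set" where
  "translate_flat G g F = (\<lambda>C. g <#\<^bsub>G\<^esub> C) ` F"

definition canonical_flat ::
    "('g, 'e::euclidean_space, 'm) lie_struct_scheme \<Rightarrow> 'g set \<Rightarrow> 'e set \<Rightarrow> 'g set set" where
  "canonical_flat G K \<aa> = (\<lambda>a. a <#\<^bsub>G\<^esub> K) ` split_torus G \<aa>"

text \<open>The maximal flats form the single \<open>G\<close>-orbit of the canonical flat. The quotient topology of
  the orbit map is the topology of the homogeneous space of \<open>G\<close> modulo the stabilizer of
  the canonical flat.\<close>

definition flat_space ::
    "('g, 'e::euclidean_space, 'm) lie_struct_scheme \<Rightarrow> 'g set \<Rightarrow> 'e set \<Rightarrow> 'g set set topology" where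
  "flat_space G K \<aa> =
     quotient_topology (topo G) (\<lambda>g. translate_flat G g (canonical_flat G K \<aa>))"

definition maximal_flats ::
    "('g, 'e::euclidean_space, 'm) lie_struct_scheme \<Rightarrow> 'g set \<Rightarrow> 'e set \<Rightarrow> 'g set set set" where
  "maximal_flats G K \<aa> = {translate_flat G g (canonical_flat G K \<aa>) | g. g \<in> carrier G}"

text \<open>The boundary of \<open>F = g F\<^sub>A\<close> is \<open>{g t P | t \<in> N\<^sub>K(A)}\<close>; this does not depend on the choice
  of \<open>g\<close>, because the stabilizer of \<open>F\<^sub>A\<close> is \<open>N\<^sub>K(A) A\<close>.\<close>

definition flat_boundary ::
    "('g, 'e::euclidean_space, 'm) lie_struct_scheme \<Rightarrow> 'g set \<Rightarrow> 'e set \<Rightarrow> ('e \<Rightarrow> real) set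
      \<Rightarrow> 'g set set \<Rightarrow> 'g set set" where
  "flat_boundary G K \<aa> Pos F =
     {g <#\<^bsub>G\<^esub> (t <#\<^bsub>G\<^esub> minimal_parabolic G K \<aa> Pos) | g t.
        g \<in> carrier G \<and> F = translate_flat G g (canonical_flat G K \<aa>) \<and>
        t \<in> normalizer_in G K (split_torus G \<aa>)}"

definition opposite ::
    "('g, 'm) monoid_scheme \<Rightarrow> 'g set \<Rightarrow> 'g \<Rightarrow> 'g set \<Rightarrow> 'g set \<Rightarrow> bool" where
  "opposite G P w0 x y \<longleftrightarrow>
     (\<exists>g\<in>carrier G. x = g <#\<^bsub>G\<^esub> P \<and> y = g <#\<^bsub>G\<^esub> (w0 <#\<^bsub>G\<^esub> P))"

definition opposite_pairs ::
    "('g, 'e::euclidean_space, 'm) lie_struct_scheme \<Rightarrow> 'g set \<Rightarrow> 'e set \<Rightarrow> ('e \<Rightarrow> real) set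
      \<Rightarrow> 'g \<Rightarrow> ('g set set \<times> 'g set) set" where
  "opposite_pairs G K \<aa> Pos w0 =
     {(F, x). F \<in> maximal_flats G K \<aa> \<and>
        x \<in> topspace (homogeneous_space G (minimal_parabolic G K \<aa> Pos)) \<and>
        (\<forall>y\<in>flat_boundary G K \<aa> Pos F. opposite G (minimal_parabolic G K \<aa> Pos) w0 x y)}"

end

theory Submission
  imports Defs
begin

text \<open>
  Write \<open>P = M A N\<close>. By equivariance a map \<open>\<Phi>\<close> amounts to a continuous map \<open>f\<close> from the set of
  points \<open>g P\<close> opposite to all \<open>t P\<close>, \<open>t \<in> T = N\<^sub>K(A)\<close>, to \<open>\<aa>\<close> on which \<open>A\<close> acts by translations
  and \<open>T\<close> by \<open>Ad\<close>; then \<open>\<Phi>(g F\<^sub>A, h P) = g exp(f(g\<^sup>-\<^sup>1 h)) K\<close>.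

  For a positive root \<open>\<beta>\<close> such that no \<open>\<beta> + \<alpha>\<close> with \<open>\<alpha>\<close> positive is a root, and \<open>\<gamma>\<close> in its Weyl
  orbit, let \<open>c(g)\<close> be the norm of the component of \<open>Ad g\<close> from the root space of \<open>\<beta>\<close> to that of
  \<open>\<gamma>\<close>. Since \<open>N\<close> fixes the root space of \<open>\<beta>\<close>, right translation by \<open>p \<in> P\<close> multiplies \<open>c\<close> by a
  character of \<open>p\<close> that depends on \<open>\<beta>\<close> only, left translation by \<open>exp H\<close> multiplies it by
  \<open>exp(\<gamma>(H))\<close>, and \<open>c(g) > 0\<close> if \<open>g P\<close> is opposite to all \<open>t P\<close>. The Weyl orbit of \<open>\<beta>\<close> has sum \<open>0\<close>,
  so \<open>\<Sum> ln (c(g)) \<gamma>\<close>, summed over all pairs \<open>(\<gamma>, \<beta>)\<close>, depends only on \<open>g P\<close>. Left translation by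
  \<open>exp H\<close> adds \<open>S H = \<Sum> \<gamma>(H) \<gamma>\<close> to it, and \<open>S\<close> is invertible and commutes with \<open>T\<close>, because
  dominance and the reflections in \<open>T\<close> show that the vectors \<open>\<gamma>\<close> span \<open>\<aa>\<close>. Hence
  \<open>f = S\<^sup>-\<^sup>1 (\<Sum> ln c \<gamma>)\<close> works.
\<close>

section \<open>Ordinary differential equations\<close>

text \<open>Root spaces can have dimension above one and \<open>M\<close> moves vectors inside them,
  so a single matrix entry of \<open>Ad g\<close> is not invariant. The norm of a whole component
  is, because \<open>T\<close>, and with it \<open>M\<close>, acts by isometries of the inner
  product -B(X, \<theta> Y).

  Positivity of c comes from opposition alone. If \<open>g P\<close> is opposite to
  \<open>t P\<close>, then inv(t) g lies in the double coset P inv(w0) P. There the component from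
  the space of \<beta> to that of inv(w0) \<beta> does not vanish, because a unipotent element has
  the same diagonal coefficients as the identity. Letting t run through \<open>T\<close> reaches
  every \<gamma> in the orbit.

  The formula for \<Phi> involves representatives g and h. That they do not matter rests on the
  stabilizer of the canonical flat, which is found from the uniqueness of the polar decomposition
  exp(X) k. Continuity descends to pairs of a flat and a point because orbit maps are open.

  All of this needs \<open>Ad\<close> and the exponential map, which are built here from the charts;
  differential equations enter as the source of one-parameter subgroups.\<close>

lemma ode_unique:
  fixes F :: "'a::euclidean_space \<Rightarrow> 'a"
  assumes lip: "L-lipschitz_on S F"
    and x: "\<And>t. t \<in> {a<..<b} \<Longrightarrow> (x has_vector_derivative F (x t)) (at t)"
    and y: "\<And>t. t \<in> {a<..<b} \<Longrightarrow> (y has_vector_derivative F (y t)) (at t)"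
    and xS: "\<And>t. t \<in> {a<..<b} \<Longrightarrow> x t \<in> S"
    and yS: "\<And>t. t \<in> {a<..<b} \<Longrightarrow> y t \<in> S"
    and \<tau>: "\<tau> \<in> {a<..<b}" "x \<tau> = y \<tau>"
    and t: "t \<in> {a<..<b}"
  shows "x t = y t"
proof -
  define d where "d = (\<lambda>s. x s - y s)"
  define D where "D = (\<lambda>s. F (x s) - F (y s))"
  have L0: "0 \<le> L"
    using lip by (rule lipschitz_on_nonneg)
  have d: "(d has_vector_derivative D s) (at s)" if "s \<in> {a<..<b}" for s
    unfolding d_def D_def using x[OF that] y[OF that] by (rule has_vector_derivative_diff)
  have dd: "((\<lambda>s. d s \<bullet> d s) has_real_derivative 2 * (d s \<bullet> D s)) (at s)" if "s \<in> {a<..<b}" for s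
  proof -
    have "((\<lambda>s. d s \<bullet> d s) has_derivative (\<lambda>h. d s \<bullet> (h *\<^sub>R D s) + (h *\<^sub>R D s) \<bullet> d s)) (at s)"
      using d[OF that] unfolding has_vector_derivative_def by (intro has_derivative_inner)
    then show ?thesis
      unfolding has_field_derivative_def
      by (rule has_derivative_eq_rhs) (auto simp: inner_commute algebra_simps)
  qed
  have Dle: "\<bar>d s \<bullet> D s\<bar> \<le> L * (d s \<bullet> d s)" if "s \<in> {a<..<b}" for s
  proof -
    have "norm (D s) \<le> L * norm (d s)"
      using lipschitz_onD[OF lip xS[OF that] yS[OF that]] by (simp add: D_def d_def dist_norm)
    then have "norm (d s) * norm (D s) \<le> norm (d s) * (L * norm (d s))"
      by (intro mult_left_mono) auto
    then show ?thesis
      using Cauchy_Schwarz_ineq2[of "d s" "D s"]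
      by (auto simp: dot_square_norm power2_eq_square algebra_simps intro: order_trans)
  qed
  have sub: "s \<in> {a<..<b}" if "min t \<tau> \<le> s" "s \<le> max t \<tau>" for s
    using that t \<tau>(1) by auto
  \<comment> \<open>An integrating factor, with c = -2L to the right of \<tau> and c = 2L to the
    left: by \<open>Dle\<close> the squared distance weighted in this way can only decrease away
    from \<tau>, where it vanishes.\<close>
  have u: "((\<lambda>s. exp (c * s) * (d s \<bullet> d s)) has_real_derivative
       exp (c * s) * (c * (d s \<bullet> d s) + 2 * (d s \<bullet> D s))) (at s)" if "s \<in> {a<..<b}" for s c
    by (rule derivative_eq_intros dd[OF that] refl | simp add: algebra_simps)+
  have "d t \<bullet> d t \<le> 0"
  proof (cases "\<tau> \<le> t")
    case True
    have "exp (- 2 * L * t) * (d t \<bullet> d t) \<le> exp (- 2 * L * \<tau>) * (d \<tau> \<bullet> d \<tau>)"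
    proof (rule DERIV_nonpos_imp_nonincreasing[OF True])
      fix s assume s: "\<tau> \<le> s" "s \<le> t"
      then have s': "s \<in> {a<..<b}" using sub[of s] True by auto
      have "exp (- 2 * L * s) * (- 2 * L * (d s \<bullet> d s) + 2 * (d s \<bullet> D s)) \<le> 0"
        using Dle[OF s'] by (intro mult_nonneg_nonpos) (auto simp: abs_le_iff)
      then show "\<exists>y. DERIV (\<lambda>s. exp (- 2 * L * s) * (d s \<bullet> d s)) s :> y \<and> y \<le> 0"
        using u[OF s', of "- 2 * L"] by blast
    qed
    also have "\<dots> = 0" using \<tau> by (simp add: d_def)
    finally show ?thesis by (simp add: mult_le_0_iff)
  next
    case False
    then have le: "t \<le> \<tau>" by simp
    have "exp (2 * L * t) * (d t \<bullet> d t) \<le> exp (2 * L * \<tau>) * (d \<tau> \<bullet> d \<tau>)"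
    proof (rule DERIV_nonneg_imp_nondecreasing[OF le])
      fix s assume s: "t \<le> s" "s \<le> \<tau>"
      then have s': "s \<in> {a<..<b}" using sub[of s] le by auto
      have "0 \<le> exp (2 * L * s) * (2 * L * (d s \<bullet> d s) + 2 * (d s \<bullet> D s))"
        using Dle[OF s'] by (intro mult_nonneg_nonneg) (auto simp: abs_le_iff)
      then show "\<exists>y. DERIV (\<lambda>s. exp (2 * L * s) * (d s \<bullet> d s)) s :> y \<and> 0 \<le> y"
        using u[OF s', of "2 * L"] by blast
    qed
    also have "\<dots> = 0" using \<tau> by (simp add: d_def)
    finally show ?thesis by (simp add: mult_le_0_iff)
  qed
  then show ?thesis
    by (metis d_def inner_eq_zero_iff inner_ge_zero order_antisym right_minus_eq)
qed

text \<open>Picard iteration, as a contraction of the space of bounded continuous functions on the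
  whole line. For this, \<open>F\<close> is precomposed with the closest point projection
  \<open>p\<close> onto the ball and time is clamped to [-\<delta>, \<delta>]. The fixed point stays
  in the open ball, where \<open>p\<close> is the identity.\<close>

lemma ode_local_solution:
  fixes F :: "'a::euclidean_space \<Rightarrow> 'a"
  assumes lip: "L-lipschitz_on (cball e r) F" and r: "r > 0"
  obtains \<delta> x where "\<delta> > 0" "x 0 = e"
    "\<And>t. t \<in> {-\<delta><..<\<delta>} \<Longrightarrow> x t \<in> ball e r"
    "\<And>t. t \<in> {-\<delta><..<\<delta>} \<Longrightarrow> (x has_vector_derivative F (x t)) (at t)"
proof -
  define p where "p = closest_point (cball e r)"
  define C where "C = norm (F e) + L * r + 1"
  \<comment> \<open>The estimates below involve 4\<delta>C and 4\<delta>L. The 6 in the denominators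
    keeps the iterates within radius 2r/3 and makes 2/3 the contraction constant; the summands 1
    prevent division by zero.\<close>
  define \<delta> where "\<delta> = min (r / (6 * C)) (1 / (6 * (L + 1)))"
  have L0: "0 \<le> L"
    using lip by (rule lipschitz_on_nonneg)
  have C0: "C > 0"
    using L0 r by (simp add: C_def add_nonneg_pos)
  have \<delta>0: "\<delta> > 0" using r C0 L0 by (simp add: \<delta>_def)
  have p: "p z \<in> cball e r" for z
    unfolding p_def by (rule closest_point_in_set) (use r in auto)
  have p_id: "p z = z" if "z \<in> cball e r" for z
    unfolding p_def using that by (simp add: closest_point_self)
  have p_lip: "dist (p z) (p w) \<le> dist z w" for z w
    unfolding p_def by (rule closest_point_lipschitz) (use r in auto)
  have Flip: "dist (F (p z)) (F (p w)) \<le> L * dist z w" for z w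
    using lipschitz_onD[OF lip p p, of z w] p_lip[of z w] L0
    by (meson mult_left_mono order_trans)
  have Fcont: "continuous_on UNIV (\<lambda>z. F (p z))"
  proof -
    have "L-lipschitz_on UNIV (\<lambda>z. F (p z))"
      using Flip L0 by (auto simp: lipschitz_on_def)
    then show ?thesis by (rule lipschitz_on_continuous_on)
  qed
  have Fb: "norm (F (p z)) \<le> C" for z
  proof -
    have "dist (F (p z)) (F e) \<le> L * dist (p z) e"
      using lipschitz_onD[OF lip p[of z], of e] r by simp
    also have "\<dots> \<le> L * r"
      using p[of z] L0 by (intro mult_left_mono) (auto simp: dist_commute)
    finally show ?thesis
      using norm_triangle_sub[of "F (p z)" "F e"] by (simp add: C_def dist_norm)
  qed
  \<comment> \<open>The integrals start at -\<delta> because \<open>{0..t}\<close> is empty for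
    negative t; subtracting the integral up to 0 restores the initial value \<open>e\<close>. Two
    integrals of length at most 2\<delta> give the factor 4 in \<open>int_b2\<close>.\<close>
  define I where "I = (\<lambda>g::real \<Rightarrow> 'a. \<lambda>t. e + (integral {-\<delta>..max (-\<delta>) (min \<delta> t)} g - integral {-\<delta>..0} g))"
  have I_cont: "continuous_on UNIV (I g)" if "continuous_on UNIV g" for g
  proof -
    have "continuous_on {-\<delta>..\<delta>} (\<lambda>t. integral {-\<delta>..t} g)"
      by (intro indefinite_integral_continuous_1 integrable_continuous_real continuous_on_subset[OF that]) auto
    then have "continuous_on UNIV (\<lambda>t. integral {-\<delta>..max (-\<delta>) (min \<delta> t)} g)"
      by (rule continuous_on_compose2) (use \<delta>0 in \<open>auto intro!: continuous_intros\<close>)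
    then show ?thesis unfolding I_def by (intro continuous_intros)
  qed
  have int_b: "norm (integral {-\<delta>..\<tau>} g) \<le> 2 * \<delta> * c"
    if "continuous_on UNIV g" "\<And>t. norm (g t) \<le> c" "-\<delta> \<le> \<tau>" "\<tau> \<le> \<delta>" for g :: "real \<Rightarrow> 'a" and c \<tau>
  proof -
    have "norm (integral {-\<delta>..\<tau>} g) \<le> c * (\<tau> - (-\<delta>))"
      by (rule integral_bound) (use that in \<open>auto intro: continuous_on_subset\<close>)
    also have "\<dots> \<le> c * (2 * \<delta>)"
      using that order_trans[OF norm_ge_zero that(2)[of 0]] by (intro mult_left_mono) auto
    finally show ?thesis by (simp add: algebra_simps)
  qed
  have int_b2: "norm (I g t - e) \<le> 4 * \<delta> * c"
    if "continuous_on UNIV g" "\<And>t. norm (g t) \<le> c" for g t c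
  proof -
    have "norm (I g t - e) \<le> norm (integral {-\<delta>..max (-\<delta>) (min \<delta> t)} g) + norm (integral {-\<delta>..0} g)"
      by (simp add: I_def norm_triangle_ineq4)
    also have "\<dots> \<le> 2 * \<delta> * c + 2 * \<delta> * c"
      using \<delta>0 that by (intro add_mono int_b) auto
    finally show ?thesis by simp
  qed
  have I_diff: "I g t - I h t = I (\<lambda>s. g s - h s) t - e"
    if "continuous_on UNIV g" "continuous_on UNIV h" for g h t
  proof -
    have "g integrable_on {-\<delta>..\<tau>}" "h integrable_on {-\<delta>..\<tau>}" for \<tau>
      using that by (auto intro!: integrable_continuous_real intro: continuous_on_subset)
    then show ?thesis unfolding I_def by (simp add: integral_diff)
  qed
  define T where "T = (\<lambda>x::real \<Rightarrow>\<^sub>C 'a. Bcontfun (I (\<lambda>s. F (p (apply_bcontfun x s)))))"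
  have xc: "continuous_on UNIV (\<lambda>s. F (p (apply_bcontfun x s)))" for x :: "real \<Rightarrow>\<^sub>C 'a"
    by (rule continuous_on_compose2[OF Fcont]) auto
  have T: "apply_bcontfun (T x) = I (\<lambda>s. F (p (apply_bcontfun x s)))" for x
    unfolding T_def
  proof (rule Bcontfun_inverse, rule bcontfun_normI)
    show "continuous_on UNIV (I (\<lambda>s. F (p (apply_bcontfun x s))))"
      by (rule I_cont[OF xc])
    show "norm (I (\<lambda>s. F (p (apply_bcontfun x s))) t) \<le> norm e + 4 * \<delta> * C" for t
      using int_b2[OF xc Fb, of x t] norm_triangle_sub[of "I (\<lambda>s. F (p (apply_bcontfun x s))) t" e] by linarith
  qed
  have "dist (T x) (T y) \<le> (2/3) * dist x y" for x y
  proof (rule dist_bound)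
    fix t
    have "dist (apply_bcontfun (T x) t) (apply_bcontfun (T y) t)
        = norm (I (\<lambda>s. F (p (apply_bcontfun x s)) - F (p (apply_bcontfun y s))) t - e)"
      unfolding T dist_norm by (subst I_diff[OF xc xc]) simp
    also have "\<dots> \<le> 4 * \<delta> * (L * dist x y)"
    proof (rule int_b2)
      show "norm (F (p (apply_bcontfun x s)) - F (p (apply_bcontfun y s))) \<le> L * dist x y" for s
        using order_trans[OF Flip mult_left_mono[OF dist_bounded L0]] by (simp add: dist_norm)
    qed (intro continuous_intros xc)
    also have "4 * \<delta> * L \<le> 2/3"
    proof -
      have "\<delta> * L \<le> 1 / (6 * (L + 1)) * L"
        using L0 by (intro mult_right_mono) (auto simp: \<delta>_def)
      also have "\<dots> \<le> 1/6" using L0 by (simp add: field_simps)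
      finally show ?thesis by (simp add: ac_simps)
    qed
    then have "4 * \<delta> * (L * dist x y) \<le> (2/3) * dist x y"
      by (metis mult.assoc mult_right_mono zero_le_dist)
    finally show "dist (apply_bcontfun (T x) t) (apply_bcontfun (T y) t) \<le> (2/3) * dist x y" .
  qed
  then obtain x where Tx: "T x = x"
    using banach_fix_type[of "2/3" T] by auto
  define g where "g = (\<lambda>s. F (p (apply_bcontfun x s)))"
  have x: "apply_bcontfun x t = I g t" for t
    using T[of x] Tx by (simp add: g_def)
  have xr: "apply_bcontfun x t \<in> ball e r" for t
  proof -
    have "norm (I g t - e) \<le> 4 * \<delta> * C"
      unfolding g_def by (rule int_b2[OF xc Fb])
    also have "\<dots> \<le> 4 * (r / (6 * C)) * C"
      using C0 by (intro mult_right_mono mult_left_mono) (auto simp: \<delta>_def)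
    also have "\<dots> < r" using C0 r by simp
    finally show ?thesis by (simp add: x dist_norm norm_minus_commute)
  qed
  have "(apply_bcontfun x has_vector_derivative F (apply_bcontfun x t)) (at t)" if t: "t \<in> {-\<delta><..<\<delta>}" for t
  proof -
    have "((\<lambda>u. integral {-\<delta>..u} g) has_vector_derivative g t) (at t within {-\<delta>..\<delta>})"
      by (rule integral_has_vector_derivative) (use t xc in \<open>auto simp: g_def intro: continuous_on_subset\<close>)
    then have "((\<lambda>u. integral {-\<delta>..u} g) has_vector_derivative g t) (at t)"
      using t by (metis at_within_Icc_at greaterThanLessThan_iff)
    then have "((\<lambda>u. e + (integral {-\<delta>..u} g - integral {-\<delta>..0} g)) has_vector_derivative g t) (at t)"
      by (auto intro!: derivative_eq_intros)
    then have "(apply_bcontfun x has_vector_derivative g t) (at t)"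
    proof (rule has_vector_derivative_transform_within_open)
      show "open {-\<delta><..<\<delta>}" "t \<in> {-\<delta><..<\<delta>}" using t by auto
      show "e + (integral {-\<delta>..u} g - integral {-\<delta>..0} g) = apply_bcontfun x u" if "u \<in> {-\<delta><..<\<delta>}" for u
      proof -
        have "max (-\<delta>) (min \<delta> u) = u" using that by auto
        then show ?thesis by (simp add: x I_def)
      qed
    qed
    moreover have "g t = F (apply_bcontfun x t)"
      using p_id[of "apply_bcontfun x t"] xr[of t] by (simp add: g_def)
    ultimately show ?thesis by simp
  qed
  moreover have "apply_bcontfun x 0 = e"
    using \<delta>0 by (simp add: x I_def)
  ultimately show ?thesis using that \<delta>0 xr by blast
qed

section \<open>Inner products on a Euclidean space\<close>

lemma linear_trace_add: "linear_trace (\<lambda>x. f x + g x) = linear_trace f + linear_trace g"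
  by (simp add: linear_trace_def inner_add_left sum.distrib)

lemma linear_trace_minus: "linear_trace (\<lambda>x. f x - g x) = linear_trace f - linear_trace g"
  by (simp add: linear_trace_def inner_diff_left sum_subtractf)

lemma linear_trace_scaleR: "linear_trace (\<lambda>x. c *\<^sub>R f x) = c * linear_trace f"
  by (simp add: linear_trace_def sum_distrib_left)

lemma linear_trace_commute:
  fixes f g :: "'a::euclidean_space \<Rightarrow> 'a"
  assumes "linear f" "linear g"
  shows "linear_trace (\<lambda>x. f (g x)) = linear_trace (\<lambda>x. g (f x))"
proof -
  have expand: "linear_trace (\<lambda>x. f (g x)) = (\<Sum>b\<in>Basis. \<Sum>c\<in>Basis. (g b \<bullet> c) * (f c \<bullet> b))"
    if "linear f" for f g :: "'a \<Rightarrow> 'a"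
  proof -
    have "f (g b) \<bullet> b = (\<Sum>c\<in>Basis. (g b \<bullet> c) * (f c \<bullet> b))" for b
    proof -
      have "f (g b) = f (\<Sum>c\<in>Basis. (g b \<bullet> c) *\<^sub>R c)"
        by (simp add: euclidean_representation)
      also have "\<dots> = (\<Sum>c\<in>Basis. (g b \<bullet> c) *\<^sub>R f c)"
        using that by (simp add: linear_sum linear_scale)
      finally show ?thesis by (simp add: inner_sum_left)
    qed
    then show ?thesis by (simp add: linear_trace_def)
  qed
  have "linear_trace (\<lambda>x. f (g x)) = (\<Sum>c\<in>Basis. \<Sum>b\<in>Basis. (g b \<bullet> c) * (f c \<bullet> b))"
    unfolding expand[OF assms(1)] by (rule sum.swap)
  also have "\<dots> = linear_trace (\<lambda>x. g (f x))"
    unfolding expand[OF assms(2)] by (simp add: mult.commute)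
  finally show ?thesis .
qed

text \<open>The Killing form and a Cartan involution define an inner product unrelated to the one of
  the Euclidean type, so Riesz representation and the spectral theorem are derived for an arbitrary
  one.\<close>

locale inner_product =
  fixes B :: "'a::euclidean_space \<Rightarrow> 'a \<Rightarrow> real"
  assumes bilin: "bilinear B"
    and sym: "B x y = B y x"
    and pos: "x \<noteq> 0 \<Longrightarrow> B x x > 0"
begin

lemma lin_left: "linear (\<lambda>x. B x y)" and lin_right: "linear (\<lambda>y. B x y)"
  using bilin by (auto simp: bilinear_def)

lemmas add_left = linear_add[OF lin_left] and add_right = linear_add[OF lin_right]
  and scale_left = linear_scale[OF lin_left, simplified] and scale_right = linear_scale[OF lin_right, simplified]
  and diff_left = linear_diff[OF lin_left] and diff_right = linear_diff[OF lin_right]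
  and neg_left = linear_neg[OF lin_left] and neg_right = linear_neg[OF lin_right]
  and zero_left = linear_0[OF lin_left] and zero_right = linear_0[OF lin_right]
  and sum_left = linear_sum[OF lin_left] and sum_right = linear_sum[OF lin_right]

lemma nonneg: "B x x \<ge> 0"
  using pos[of x] by (cases "x = 0") (auto simp: zero_left)

lemma eq_0_iff: "B x x = 0 \<longleftrightarrow> x = 0"
  using pos[of x] by (cases "x = 0") (auto simp: zero_left)

lemma bounded_bilin: "bounded_bilinear B"
  using bilin bilinear_conv_bounded_bilinear by blast

lemma continuous_on_form [continuous_intros]:
  "continuous_on S f \<Longrightarrow> continuous_on S g \<Longrightarrow> continuous_on S (\<lambda>x. B (f x) (g x))"
  by (rule bounded_bilinear.continuous_on[OF bounded_bilin])

text \<open>\<open>T\<close> expresses \<open>B x\<close> through the standard inner product.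
  Definiteness makes it injective, hence surjective in finite dimension.\<close>

lemma representation:
  assumes "linear f"
  obtains x where "\<And>y. f y = B x y"
proof -
  define T where "T = (\<lambda>x. \<Sum>b\<in>Basis. B x b *\<^sub>R b)"
  have T: "T x \<bullet> y = B x y" for x y
  proof -
    have "B x y = B x (\<Sum>b\<in>Basis. (y \<bullet> b) *\<^sub>R b)" by (simp add: euclidean_representation)
    also have "\<dots> = (\<Sum>b\<in>Basis. B x b * (y \<bullet> b))" by (simp add: sum_right scale_right mult.commute)
    also have "\<dots> = T x \<bullet> y" by (simp add: T_def inner_sum_left inner_commute[of y])
    finally show ?thesis by simp
  qed
  have "linear T"
    unfolding T_def
    by (rule linearI) (simp_all add: add_left scale_left scaleR_add_left sum.distrib scaleR_sum_right)
  moreover have "inj T"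
  proof (rule injI)
    fix x y assume "T x = T y"
    then have "B (x - y) (x - y) = 0" using T[of x "x - y"] T[of y "x - y"] by (simp add: diff_left)
    then show "x = y" by (simp add: eq_0_iff)
  qed
  ultimately have "surj T" by (rule linear_injective_imp_surjective) simp
  then obtain x where "T x = (\<Sum>b\<in>Basis. f b *\<^sub>R b)" by (metis surjD)
  moreover have "f y = (\<Sum>b\<in>Basis. f b *\<^sub>R b) \<bullet> y" for y
  proof -
    have "f y = f (\<Sum>b\<in>Basis. (y \<bullet> b) *\<^sub>R b)" by (simp add: euclidean_representation)
    also have "\<dots> = (\<Sum>b\<in>Basis. (y \<bullet> b) * f b)" using assms by (simp add: linear_sum linear_scale)
    finally show ?thesis by (simp add: inner_sum_left inner_commute[of y] mult.commute)
  qed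
  ultimately show ?thesis using that T by metis
qed

lemma orthogonal_nonzero_exists:
  assumes "subspace V" "V \<noteq> UNIV"
  obtains x where "x \<noteq> 0" "\<And>v. v \<in> V \<Longrightarrow> B x v = 0"
proof -
  have "dim V < DIM('a)"
    using assms dim_eq_full[of V] dim_subset_UNIV[of V] span_eq_iff[of V] by (metis order_le_neq_trans)
  then obtain a where a: "a \<noteq> 0" "\<And>v. v \<in> span V \<Longrightarrow> orthogonal a v"
    using orthogonal_to_subspace_exists by blast
  have "linear (\<lambda>y. a \<bullet> y)" by (simp add: bounded_linear.linear bounded_linear_inner_right)
  then obtain x where x: "\<And>y. a \<bullet> y = B x y" using representation by blast
  have "x \<noteq> 0" using a(1) x[of a] by (auto simp: zero_left)
  then show ?thesis
    using that x a(2) by (metis orthogonal_def span_base)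
qed

text \<open>A vector orthogonal to both \<open>V\<close> and its complement \<open>W\<close> lies in
  \<open>W\<close> and so is orthogonal to itself; hence the two span everything.\<close>

lemma orthogonal_decomposition:
  assumes "subspace V"
  obtains v where "v \<in> V" "\<And>w. w \<in> V \<Longrightarrow> B (x - v) w = 0"
proof -
  define W where "W = {y. \<forall>w\<in>V. B y w = 0}"
  have W: "subspace W"
    by (auto simp: W_def subspace_def add_left scale_left zero_left)
  define U where "U = {v + w | v w. v \<in> V \<and> w \<in> W}"
  have U: "subspace U" unfolding U_def by (rule subspace_sums[OF assms W])
  have "U = UNIV"
  proof (rule ccontr)
    assume "U \<noteq> UNIV"
    then obtain z where z: "z \<noteq> 0" "\<And>v. v \<in> U \<Longrightarrow> B z v = 0"
      using orthogonal_nonzero_exists[OF U] by blast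
    have "V \<subseteq> U" "W \<subseteq> U"
      using subspace_0[OF W] subspace_0[OF assms] by (force simp: U_def)+
    then have "z \<in> W" using z by (auto simp: W_def)
    then show False using z \<open>W \<subseteq> U\<close> eq_0_iff by blast
  qed
  then obtain v w where "x = v + w" "v \<in> V" "w \<in> W" unfolding U_def by blast
  then show ?thesis using that by (auto simp: W_def)
qed

lemma representation_on:
  assumes "subspace V" "linear f"
  obtains x where "x \<in> V" "\<And>y. y \<in> V \<Longrightarrow> f y = B x y"
proof -
  obtain x where x: "\<And>y. f y = B x y" using representation[OF assms(2)] by blast
  obtain v where "v \<in> V" "\<And>w. w \<in> V \<Longrightarrow> B (x - v) w = 0"
    using orthogonal_decomposition[OF assms(1)] by blast
  then show ?thesis using that x by (metis diff_left eq_iff_diff_eq_0)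
qed

text \<open>Let \<open>x\<close> maximize the Rayleigh quotient on the sphere of \<open>U\<close>,
  with maximum \<open>l\<close>. Then the quadratic form \<open>q\<close> is nonnegative on
  \<open>U\<close> and vanishes at \<open>x\<close>, so its gradient direction \<open>w\<close> at
  \<open>x\<close> must be zero.\<close>

lemma symmetric_eigenvector:
  assumes U: "subspace U" "U \<noteq> {0}" and S: "linear S" "\<And>x. x \<in> U \<Longrightarrow> S x \<in> U"
    and symm: "\<And>x y. B (S x) y = B x (S y)"
  obtains x l where "x \<in> U" "x \<noteq> 0" "S x = l *\<^sub>R x"
proof -
  define C where "C = sphere 0 1 \<inter> U"
  obtain u where u: "u \<in> U" "u \<noteq> 0" using U subspace_0 by blast
  then have "(1 / norm u) *\<^sub>R u \<in> C" using U by (simp add: C_def subspace_scale)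
  moreover have "compact C"
    unfolding C_def using closed_subspace[OF U(1)] by (simp add: compact_Int_closed)
  moreover have "continuous_on C (\<lambda>x. B (S x) x / B x x)"
    using eq_0_iff by (intro continuous_intros linear_continuous_on_compose[OF _ S(1)])
      (force simp: C_def)+
  ultimately obtain x where x: "x \<in> C" and max: "\<And>y. y \<in> C \<Longrightarrow> B (S y) y / B y y \<le> B (S x) x / B x x"
    using continuous_attains_sup[of C "\<lambda>x. B (S x) x / B x x"] by auto
  define l where "l = B (S x) x / B x x"
  have xU: "x \<in> U" "x \<noteq> 0" using x by (auto simp: C_def)
  have le: "B (S y) y \<le> l * B y y" if "y \<in> U" for y
  proof (cases "y = 0")
    case False
    define z where "z = (1 / norm y) *\<^sub>R y"
    have "z \<in> C" using False that U by (simp add: C_def z_def subspace_scale)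
    then have "B (S z) z / B z z \<le> l" using max by (simp add: l_def)
    moreover have "B (S z) z / B z z = B (S y) y / B y y"
      using False S(1) by (simp add: z_def scale_left scale_right linear_scale)
    ultimately show ?thesis using pos[OF False] by (simp add: field_simps)
  qed (simp add: zero_left zero_right)
  define w where "w = l *\<^sub>R x - S x"
  have wU: "w \<in> U" using xU S U by (simp add: w_def subspace_diff subspace_scale)
  define q where "q = (\<lambda>y. l * B y y - B (S y) y)"
  have qx: "q x = 0" using pos[OF xU(2)] by (simp add: q_def l_def)
  have "B w w = 0"
  proof (rule ccontr)
    assume "B w w \<noteq> 0"
    then have w: "B w w > 0" using nonneg[of w] by simp
    have exp: "q (x - t *\<^sub>R w) = - 2 * t * B w w + t\<^sup>2 * q w" for t
    proof -
      have "q (x - t *\<^sub>R w) = q x - 2 * t * (l * B x w - B (S x) w) + t\<^sup>2 * q w"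
        using symm[of w x] sym[of w x] sym[of w "S x"]
        by (simp add: q_def linear_diff[OF S(1)] linear_scale[OF S(1)] diff_left diff_right scale_left scale_right
            algebra_simps power2_eq_square)
      also have "l * B x w - B (S x) w = B w w" by (simp add: w_def diff_left scale_left)
      finally show ?thesis using qx by simp
    qed
    have nn: "q (x - t *\<^sub>R w) \<ge> 0" for t
      using le[of "x - t *\<^sub>R w"] xU wU U by (simp add: q_def subspace_diff subspace_scale)
    \<comment> \<open>Any positive t with t q(w) < 2 B(w, w) makes q(x - t w) negative; adding B(w,
      w) to the denominator covers the case q(w) = 0.\<close>
    define t where "t = B w w / (q w + B w w)"
    have qw: "q w \<ge> 0" using le[OF wU] by (simp add: q_def)
    then have t: "t > 0" "t * q w < 2 * B w w"
      using w by (auto simp: t_def field_simps add_pos_nonneg add_nonneg_pos)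
    have "t * (t * q w - 2 * B w w) < 0" using t by (intro mult_pos_neg) auto
    then show False using nn[of t] exp[of t] by (simp add: power2_eq_square algebra_simps)
  qed
  then have "S x = l *\<^sub>R x" by (simp add: eq_0_iff w_def)
  then show ?thesis using that xU by blast
qed

text \<open>Induction on the dimension: unless every operator is scalar on \<open>U\<close>, one of
  them has a proper nonzero eigenspace there, which the others preserve because they commute with
  it.\<close>

lemma common_eigenvector:
  assumes "subspace U" "U \<noteq> {0}"
    and "\<And>S. S \<in> \<S> \<Longrightarrow> linear S" "\<And>S x. S \<in> \<S> \<Longrightarrow> x \<in> U \<Longrightarrow> S x \<in> U"
    and "\<And>S x y. S \<in> \<S> \<Longrightarrow> B (S x) y = B x (S y)"
    and "\<And>S S' x. S \<in> \<S> \<Longrightarrow> S' \<in> \<S> \<Longrightarrow> S (S' x) = S' (S x)"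
  shows "\<exists>x\<in>U. x \<noteq> 0 \<and> (\<forall>S\<in>\<S>. \<exists>l. S x = l *\<^sub>R x)"
  using assms
proof (induction "dim U" arbitrary: U rule: less_induct)
  case less
  note S = less.prems
  show ?case
  proof (cases "\<forall>S\<in>\<S>. \<exists>l. \<forall>x\<in>U. S x = l *\<^sub>R x")
    case True
    then show ?thesis using S(1,2) subspace_0 by blast
  next
    case False
    then obtain S where S0: "S \<in> \<S>" and no: "\<And>l. \<exists>x\<in>U. S x \<noteq> l *\<^sub>R x" by blast
    obtain x l where x: "x \<in> U" "x \<noteq> 0" "S x = l *\<^sub>R x"
      using symmetric_eigenvector[OF S(1,2) S(3)[OF S0] S(4)[OF S0] S(5)[OF S0]] by blast
    define V where "V = {x \<in> U. S x = l *\<^sub>R x}"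
    have V: "subspace V"
      using S(1) S(3)[OF S0]
      by (auto simp: V_def subspace_def linear_add linear_scale linear_0 scaleR_add_right)
    have "V \<subset> U" using no[of l] by (auto simp: V_def)
    then have "dim V < dim U" using V S(1) by (metis dim_psubset span_eq_iff)
    moreover have "V \<noteq> {0}" using x by (auto simp: V_def)
    moreover have "R x \<in> V" if "R \<in> \<S>" "x \<in> V" for R x
      using that S(4)[of R x] S(6)[OF S0 that(1), of x] S(3)[OF that(1)] by (auto simp: V_def linear_scale)
    ultimately have "\<exists>x\<in>V. x \<noteq> 0 \<and> (\<forall>S\<in>\<S>. \<exists>l. S x = l *\<^sub>R x)"
      using less.hyps[of V] V S(3,5,6) by blast
    then show ?thesis by (auto simp: V_def)
  qed
qed

text \<open>Symmetric operators preserve the orthogonal complement of their common eigenvectors. If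
  it were nonzero, it would contain such a vector, orthogonal to itself.\<close>

lemma span_common_eigenvectors:
  assumes "\<And>S. S \<in> \<S> \<Longrightarrow> linear S"
    and "\<And>S x y. S \<in> \<S> \<Longrightarrow> B (S x) y = B x (S y)"
    and "\<And>S S' x. S \<in> \<S> \<Longrightarrow> S' \<in> \<S> \<Longrightarrow> S (S' x) = S' (S x)"
  shows "span {x. \<forall>S\<in>\<S>. \<exists>l. S x = l *\<^sub>R x} = UNIV" (is "span ?E = UNIV")
proof (rule ccontr)
  assume ne: "span ?E \<noteq> UNIV"
  define U where "U = {y. \<forall>x\<in>?E. B y x = 0}"
  have U: "subspace U" by (auto simp: U_def subspace_def add_left scale_left zero_left)
  obtain z where "z \<noteq> 0" "\<And>v. v \<in> span ?E \<Longrightarrow> B z v = 0"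
    using orthogonal_nonzero_exists[OF subspace_span ne] by blast
  then have "z \<in> U" "z \<noteq> 0" by (auto simp: U_def intro: span_base)
  then have "U \<noteq> {0}" by blast
  moreover have "S y \<in> U" if "S \<in> \<S>" "y \<in> U" for S y
    unfolding U_def
  proof (intro CollectI ballI)
    fix x assume x: "x \<in> ?E"
    then obtain l where "S x = l *\<^sub>R x" using \<open>S \<in> \<S>\<close> by blast
    then show "B (S y) x = 0"
      using that x assms(2)[OF that(1), of y x] by (auto simp: U_def scale_right)
  qed
  ultimately obtain x where "x \<in> U" "x \<noteq> 0" "x \<in> ?E"
    using common_eigenvector[of U \<S>] U assms by blast
  then show False using eq_0_iff by (auto simp: U_def)
qed

lemma orthogonal_span_eq_0:
  assumes "span E = UNIV" "\<And>u. u \<in> E \<Longrightarrow> B x u = 0"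
  shows "x = 0"
proof -
  have "B x x = 0"
    by (rule linear_eq_0_on_span[OF lin_right[of x] assms(2)]) (use assms(1) in auto)
  then show ?thesis by (simp add: eq_0_iff)
qed

text \<open>Used with \<open>E = exp S = exp T\<close>: eigenvectors of \<open>S\<close> and \<open>T\<close> with distinct eigenvalues belong to
  distinct eigenvalues of \<open>E\<close>, hence are orthogonal.\<close>

lemma symmetric_log_unique:
  assumes S: "linear S" "\<And>x y. B (S x) y = B x (S y)"
    and T: "linear T" "\<And>x y. B (T x) y = B x (T y)"
    and E: "\<And>x y. B (E x) y = B x (E y)"
    and SE: "\<And>x l. S x = l *\<^sub>R x \<Longrightarrow> E x = exp l *\<^sub>R x"
    and TE: "\<And>x l. T x = l *\<^sub>R x \<Longrightarrow> E x = exp l *\<^sub>R x"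
  shows "S x = T x"
proof -
  have spanS: "span {x. \<exists>l. S x = l *\<^sub>R x} = UNIV"
    using span_common_eigenvectors[of "{S}"] S by simp
  have spanT: "span {x. \<exists>l. T x = l *\<^sub>R x} = UNIV"
    using span_common_eigenvectors[of "{T}"] T by simp
  show ?thesis
  proof (rule linear_eq_on_span[OF S(1) T(1)])
    show "x \<in> span {x. \<exists>l. S x = l *\<^sub>R x}" by (simp add: spanS)
    fix v assume "v \<in> {x. \<exists>l. S x = l *\<^sub>R x}"
    then obtain l where l: "S v = l *\<^sub>R v" by blast
    have "T v - l *\<^sub>R v = 0"
    proof (rule orthogonal_span_eq_0[OF spanT])
      fix u assume "u \<in> {x. \<exists>l. T x = l *\<^sub>R x}"
      then obtain m where m: "T u = m *\<^sub>R u" by blast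
      have "exp l * B v u = exp m * B v u"
        using E[of v u] SE[OF l] TE[OF m] by (simp add: scale_left scale_right)
      then have "l = m \<or> B v u = 0" by auto
      then show "B (T v - l *\<^sub>R v) u = 0"
        using T(2)[of v u] m by (auto simp: diff_left scale_left scale_right)
    qed
    then show "S v = T v" using l by simp
  qed
qed

end

section \<open>Smooth maps\<close>

lemma smooth_on_frechet:
  "smooth_on S f \<Longrightarrow> smooth_on S (\<lambda>x. frechet_derivative f (at x) v)"
  unfolding smooth_on_def by (metis Ck_on.simps(2))

lemma smooth_on_continuous_on: "smooth_on S f \<Longrightarrow> continuous_on S f"
  unfolding smooth_on_def by (metis Ck_on.simps(1))

lemma smooth_on_has_derivative:
  assumes "smooth_on S f" "open S" "x \<in> S"
  shows "(f has_derivative frechet_derivative f (at x)) (at x)"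
proof -
  have "f differentiable_on S"
    using assms(1) unfolding smooth_on_def by (metis Ck_on.simps(2))
  then show ?thesis
    using assms(2,3) by (simp add: differentiable_on_eq_differentiable_at frechet_derivative_works)
qed

lemma has_derivative_transform_nhds:
  assumes "(f has_derivative f') (at x)" "eventually (\<lambda>y. f y = g y) (nhds x)"
  shows "(g has_derivative f') (at x)"
proof -
  have "eventually (\<lambda>y. f y = g y) (at x)"
    using assms(2) by (auto simp: eventually_at_filter elim: eventually_mono)
  then show ?thesis
    by (rule has_derivative_transform_eventually[OF assms(1)]) (use eventually_nhds_x_imp_x[OF assms(2)] in auto)
qed

lemma differentiable_transform_nhds:
  "f differentiable (at x) \<Longrightarrow> eventually (\<lambda>y. f y = g y) (nhds x) \<Longrightarrow> g differentiable (at x)"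
  using has_derivative_transform_nhds unfolding differentiable_def by blast

lemma has_derivative_Pair_right: "((\<lambda>z. (v, z)) has_derivative (\<lambda>q. (0, q))) (at w)"
  and has_derivative_Pair_left: "((\<lambda>z. (z, w)) has_derivative (\<lambda>q. (q, 0))) (at v)"
  by (auto intro!: derivative_eq_intros)

lemma linear_Basis_expansion:
  fixes f :: "'a::euclidean_space \<Rightarrow> 'b::real_vector"
  assumes "linear f"
  shows "f x = (\<Sum>b\<in>Basis. (x \<bullet> b) *\<^sub>R f b)"
proof -
  have "f x = f (\<Sum>b\<in>Basis. (x \<bullet> b) *\<^sub>R b)"
    by (simp add: euclidean_representation)
  then show ?thesis
    using assms by (simp add: linear_sum linear_scale)
qed

lemma linear_norm_le_sum_Basis:
  fixes f :: "'a::euclidean_space \<Rightarrow> 'b::real_normed_vector"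
  assumes "linear f"
  shows "norm (f h) \<le> (\<Sum>b\<in>Basis. norm (f b)) * norm h"
proof -
  have "f h = (\<Sum>b\<in>Basis. (h \<bullet> b) *\<^sub>R f b)"
    by (rule linear_Basis_expansion[OF assms])
  also have "norm \<dots> \<le> (\<Sum>b\<in>Basis. norm (f b) * norm h)"
    proof (rule order_trans[OF norm_sum], rule sum_mono)
    fix b :: 'a assume "b \<in> Basis"
    then have "\<bar>h \<bullet> b\<bar> * norm (f b) \<le> norm h * norm (f b)"
      by (intro mult_right_mono Basis_le_norm) auto
    then show "norm ((h \<bullet> b) *\<^sub>R f b) \<le> norm (f b) * norm h"
      by (simp add: mult.commute)
  qed
  finally show ?thesis by (simp add: sum_distrib_right)
qed

text \<open>The derivative along each basis vector is continuous, hence bounded on the compact ball;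
  the sum of the bounds controls the operator norm.\<close>

lemma smooth_on_lipschitz_cball:
  fixes f :: "'a::euclidean_space \<Rightarrow> 'b::euclidean_space"
  assumes f: "smooth_on S f" "open S" and sub: "cball x r \<subseteq> S"
  obtains L where "L-lipschitz_on (cball x r) f"
proof -
  have "\<exists>K. \<forall>p\<in>cball x r. norm (frechet_derivative f (at p) b) \<le> K" for b
  proof -
    have "continuous_on (cball x r) (\<lambda>p. frechet_derivative f (at p) b)"
      using continuous_on_subset[OF smooth_on_continuous_on[OF smooth_on_frechet[OF f(1)]] sub] .
    then have "bounded ((\<lambda>p. frechet_derivative f (at p) b) ` cball x r)"
      by (intro compact_imp_bounded compact_continuous_image) auto
    then show ?thesis by (auto simp: bounded_iff)
  qed
  then obtain K where K: "\<And>b p. p \<in> cball x r \<Longrightarrow> norm (frechet_derivative f (at p) b) \<le> K b"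
    by metis
  define L where "L = \<bar>\<Sum>b\<in>Basis. K b\<bar>"
  have D: "(f has_derivative frechet_derivative f (at p)) (at p)" if "p \<in> cball x r" for p
    using smooth_on_has_derivative[OF f] that sub by auto
  have "dist (f p) (f q) \<le> L * dist p q" if pq: "p \<in> cball x r" "q \<in> cball x r" for p q
    unfolding dist_norm
  proof (rule differentiable_bound[OF convex_cball _ _ pq])
    fix z assume z: "z \<in> cball x r"
    show "(f has_derivative frechet_derivative f (at z)) (at z within cball x r)"
      using D[OF z] has_derivative_at_withinI by blast
    have lin: "linear (frechet_derivative f (at z))"
      using D[OF z] has_derivative_linear by blast
    show "onorm (frechet_derivative f (at z)) \<le> L"
    proof (rule onorm_le)
      fix h
      have "norm (frechet_derivative f (at z) h) \<le> (\<Sum>b\<in>Basis. norm (frechet_derivative f (at z) b)) * norm h"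
        by (rule linear_norm_le_sum_Basis[OF lin])
      also have "\<dots> \<le> L * norm h"
      proof (rule mult_right_mono)
        have "(\<Sum>b\<in>Basis. norm (frechet_derivative f (at z) b)) \<le> (\<Sum>b\<in>Basis. K b)"
          by (intro sum_mono K z)
        then show "(\<Sum>b\<in>Basis. norm (frechet_derivative f (at z) b)) \<le> L"
          by (simp add: L_def)
      qed simp
      finally show "norm (frechet_derivative f (at z) h) \<le> L * norm h" .
    qed
  qed
  then have "L-lipschitz_on (cball x r) f"
    by (auto simp: lipschitz_on_def L_def)
  then show ?thesis using that by blast
qed

section \<open>Charts of a Lie group\<close>

context lie_group begin

lemma chart_openin: "c \<in> atlas G \<Longrightarrow> openin (topo G) (fst c)"
  and chart_open: "c \<in> atlas G \<Longrightarrow> open (snd c ` fst c)"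
  and chart_homeo: "c \<in> atlas G \<Longrightarrow>
        homeomorphic_map (subtopology (topo G) (fst c)) (top_of_set (snd c ` fst c)) (snd c)"
  and atlas_cover: "carrier G = (\<Union>c\<in>atlas G. fst c)"
  using smooth_atlas topspace_topo by (auto simp: smooth_atlas_def)

lemma chart_carrier: "c \<in> atlas G \<Longrightarrow> fst c \<subseteq> carrier G"
  using atlas_cover by blast

lemma chart_inj: "c \<in> atlas G \<Longrightarrow> inj_on (snd c) (fst c)"
  using homeomorphic_imp_injective_map[OF chart_homeo, of c] chart_carrier[of c]
  by (simp add: topspace_topo Int_absorb1)

lemma chart_inv_left [simp]: "c \<in> atlas G \<Longrightarrow> g \<in> fst c \<Longrightarrow> chart_inv c (snd c g) = g"
  unfolding chart_inv_def using chart_inj by (simp add: inv_into_f_f)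

lemma chart_inv_right [simp]: "v \<in> snd c ` fst c \<Longrightarrow> snd c (chart_inv c v) = v"
  unfolding chart_inv_def by (erule f_inv_into_f)

lemma chart_inv_mem: "v \<in> snd c ` fst c \<Longrightarrow> chart_inv c v \<in> fst c"
  unfolding chart_inv_def by (erule inv_into_into)

lemma chart_inv_carrier: "c \<in> atlas G \<Longrightarrow> v \<in> snd c ` fst c \<Longrightarrow> chart_inv c v \<in> carrier G"
  by (rule subsetD[OF chart_carrier chart_inv_mem])

lemma continuous_chart: "c \<in> atlas G \<Longrightarrow> continuous_map (subtopology (topo G) (fst c)) euclidean (snd c)"
  using homeomorphic_imp_continuous_map[OF chart_homeo] continuous_map_in_subtopology by blast

lemma continuous_chart_inv:
  assumes c: "c \<in> atlas G"
  shows "continuous_map (top_of_set (snd c ` fst c)) (topo G) (chart_inv c)"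
proof -
  have ts: "topspace (subtopology (topo G) (fst c)) = fst c"
    using chart_carrier[OF c] topspace_topo by auto
  obtain k where k: "homeomorphic_maps (subtopology (topo G) (fst c)) (top_of_set (snd c ` fst c)) (snd c) k"
    using chart_homeo[OF c] homeomorphic_map_maps by blast
  then have ck: "continuous_map (top_of_set (snd c ` fst c)) (topo G) k"
    and kinv: "\<And>g. g \<in> fst c \<Longrightarrow> k (snd c g) = g"
    using ts by (auto simp: homeomorphic_maps_def continuous_map_in_subtopology)
  show ?thesis
  proof (rule continuous_map_eq[OF ck])
    fix v assume "v \<in> topspace (top_of_set (snd c ` fst c))"
    then obtain g where "g \<in> fst c" "v = snd c g" by auto
    then show "k v = chart_inv c v" using kinv chart_inv_left[OF c] by metis
  qed
qed

lemma openin_chart_preimage: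
  assumes c: "c \<in> atlas G" and B: "open B"
  shows "openin (topo G) {g \<in> fst c. snd c g \<in> B}"
proof -
  have ts: "topspace (subtopology (topo G) (fst c)) = fst c"
    using chart_carrier[OF c] topspace_topo by auto
  have "openin (subtopology (topo G) (fst c)) {g \<in> fst c. snd c g \<in> B}"
    using openin_continuous_map_preimage[OF continuous_chart[OF c], of B] B unfolding ts by simp
  then show ?thesis
    by (rule openin_trans_full[OF _ chart_openin[OF c]])
qed

lemma continuous_map_mult:
  assumes "continuous_map X (topo G) f" "continuous_map X (topo G) g"
  shows "continuous_map X (topo G) (\<lambda>x. f x \<otimes> g x)"
proof -
  have "continuous_map X (prod_topology (topo G) (topo G)) (\<lambda>x. (f x, g x))"
    using assms by (simp add: continuous_map_pairedI)
  from continuous_map_compose[OF this continuous_mult] show ?thesis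
    by (simp add: o_def)
qed

lemma continuous_map_inverse:
  assumes "continuous_map X (topo G) f"
  shows "continuous_map X (topo G) (\<lambda>x. inv f x)"
  using continuous_map_compose[OF assms continuous_inv] by (simp add: o_def)

lemma continuous_left_translation: "g \<in> carrier G \<Longrightarrow> continuous_map (topo G) (topo G) (\<lambda>x. g \<otimes> x)"
  by (intro continuous_map_mult) (auto simp: topspace_topo)

lemma open_preimage_topo:
  assumes "continuous_map (top_of_set S) (topo G) f" "open S" "openin (topo G) Q"
  shows "open {x \<in> S. f x \<in> Q}"
  using openin_continuous_map_preimage[OF assms(1,3)] assms(2) by (simp add: openin_open_eq)

lemma eventually_in_topo:
  assumes "continuous_map (top_of_set S) (topo G) f" "open S" "openin (topo G) Q" "x \<in> S" "f x \<in> Q"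
  shows "eventually (\<lambda>y. f y \<in> Q) (nhds x)"
  unfolding eventually_nhds
  using open_preimage_topo[OF assms(1-3)] assms(4,5) by blast

definition mult_dom :: "('g, 'e) chart \<Rightarrow> ('g, 'e) chart \<Rightarrow> ('g, 'e) chart \<Rightarrow> ('e \<times> 'e) set" where
  "mult_dom c d b =
     {(v, w). v \<in> snd c ` fst c \<and> w \<in> snd d ` fst d \<and> chart_inv c v \<otimes> chart_inv d w \<in> fst b}"

definition mult_in :: "('g, 'e) chart \<Rightarrow> ('g, 'e) chart \<Rightarrow> ('g, 'e) chart \<Rightarrow> 'e \<times> 'e \<Rightarrow> 'e" where
  "mult_in c d b = (\<lambda>(v, w). snd b (chart_inv c v \<otimes> chart_inv d w))"

lemma mult_domI:
  "\<lbrakk>v \<in> snd c ` fst c; w \<in> snd d ` fst d; chart_inv c v \<otimes> chart_inv d w \<in> fst b\<rbrakk> \<Longrightarrow>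
    (v, w) \<in> mult_dom c d b"
  by (simp add: mult_dom_def)

lemma smooth_mult_in:
  "\<lbrakk>c \<in> atlas G; d \<in> atlas G; b \<in> atlas G\<rbrakk> \<Longrightarrow> smooth_on (mult_dom c d b) (mult_in c d b)"
  unfolding mult_dom_def mult_in_def by (rule smooth_mult)

lemma open_mult_dom:
  assumes "c \<in> atlas G" "d \<in> atlas G" "b \<in> atlas G"
  shows "open (mult_dom c d b)"
proof -
  let ?S = "(snd c ` fst c) \<times> (snd d ` fst d)"
  have "continuous_map (top_of_set ?S) (topo G) (\<lambda>p. chart_inv c (fst p) \<otimes> chart_inv d (snd p))"
  proof (intro continuous_map_mult)
    show "continuous_map (top_of_set ?S) (topo G) (\<lambda>p. chart_inv c (fst p))"
      by (rule continuous_map_compose[OF _ continuous_chart_inv[OF assms(1)], unfolded o_def])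
        (auto intro!: continuous_intros)
    show "continuous_map (top_of_set ?S) (topo G) (\<lambda>p. chart_inv d (snd p))"
      by (rule continuous_map_compose[OF _ continuous_chart_inv[OF assms(2)], unfolded o_def])
        (auto intro!: continuous_intros)
  qed
  from open_preimage_topo[OF this _ chart_openin[OF assms(3)]]
  have "open {p \<in> ?S. chart_inv c (fst p) \<otimes> chart_inv d (snd p) \<in> fst b}"
    using assms chart_open by (simp add: open_Times)
  moreover have "{p \<in> ?S. chart_inv c (fst p) \<otimes> chart_inv d (snd p) \<in> fst b} = mult_dom c d b"
    by (auto simp: mult_dom_def)
  ultimately show ?thesis by simp
qed

lemma mult_in_has_derivative:
  assumes "c \<in> atlas G" "d \<in> atlas G" "b \<in> atlas G" "p \<in> mult_dom c d b"
  shows "(mult_in c d b has_derivative frechet_derivative (mult_in c d b) (at p)) (at p)"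
  using smooth_on_has_derivative[OF smooth_mult_in open_mult_dom] assms by blast

section \<open>The adjoint representation\<close>

abbreviation "\<phi> \<equiv> snd (id_chart G)"
abbreviation "\<psi> \<equiv> chart_inv (id_chart G)"
abbreviation "U0 \<equiv> fst (id_chart G)"
abbreviation "V0 \<equiv> \<phi> ` U0"
abbreviation "e0 \<equiv> id_coord G"
abbreviation "M0 \<equiv> mult_in (id_chart G) (id_chart G) (id_chart G)"
abbreviation "D0 \<equiv> mult_dom (id_chart G) (id_chart G) (id_chart G)"
abbreviation "dM p \<equiv> frechet_derivative M0 (at p)"

lemma id_chart: "id_chart G \<in> atlas G" "\<one> \<in> U0"
proof -
  have "\<exists>c. c \<in> atlas G \<and> \<one> \<in> fst c" using atlas_cover by blast
  then have "id_chart G \<in> atlas G \<and> \<one> \<in> U0" unfolding id_chart_def by (rule someI_ex[where P = "\<lambda>c. c \<in> atlas G \<and> \<one> \<in> fst c"])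
  then show "id_chart G \<in> atlas G" "\<one> \<in> U0" by blast+
qed

lemma id_coord: "e0 \<in> V0" "\<psi> e0 = \<one>" "\<phi> \<one> = e0"
  unfolding id_coord_def using id_chart chart_inv_left[OF id_chart] by blast+

lemmas psi_phi = chart_inv_left[OF id_chart(1)]
lemmas phi_psi = chart_inv_right[where c = "id_chart G"]
lemmas psi_U0 = chart_inv_mem[where c = "id_chart G"]
lemmas psi_carrier = chart_inv_carrier[OF id_chart(1)]
lemmas open_V0 = chart_open[OF id_chart(1)]
lemmas openin_U0 = chart_openin[OF id_chart(1)]
lemmas continuous_psi = continuous_chart_inv[OF id_chart(1)]
lemmas open_D0 = open_mult_dom[OF id_chart(1) id_chart(1) id_chart(1)]
lemmas smooth_M0 = smooth_mult_in[OF id_chart(1) id_chart(1) id_chart(1)]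
lemmas M0_derivative = mult_in_has_derivative[OF id_chart(1) id_chart(1) id_chart(1)]

lemma M0_apply: "M0 (v, w) = \<phi> (\<psi> v \<otimes> \<psi> w)"
  by (simp add: mult_in_def)

lemma mem_D0: "(v, w) \<in> D0 \<longleftrightarrow> v \<in> V0 \<and> w \<in> V0 \<and> \<psi> v \<otimes> \<psi> w \<in> U0"
  by (simp add: mult_dom_def)

lemma psi_M0: "(v, w) \<in> D0 \<Longrightarrow> \<psi> (M0 (v, w)) = \<psi> v \<otimes> \<psi> w"
  by (simp add: M0_apply mem_D0 psi_phi)

lemma M0_e0: "v \<in> V0 \<Longrightarrow> M0 (v, e0) = v" "v \<in> V0 \<Longrightarrow> M0 (e0, v) = v"
  using psi_carrier by (auto simp: M0_apply id_coord phi_psi)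

lemma D0_e0: "v \<in> V0 \<Longrightarrow> (v, e0) \<in> D0" "v \<in> V0 \<Longrightarrow> (e0, v) \<in> D0"
  using psi_carrier[of v] id_coord(1) psi_U0[of v] by (simp_all only: mem_D0 id_coord(2) r_one l_one)

lemma dM_linear: "p \<in> D0 \<Longrightarrow> linear (dM p)"
  using M0_derivative has_derivative_linear by blast

lemma M0_derivative_snd:
  assumes "(v, w) \<in> D0"
  shows "((\<lambda>z. M0 (v, z)) has_derivative (\<lambda>q. dM (v, w) (0, q))) (at w)"
  by (rule has_derivative_compose[OF has_derivative_Pair_right M0_derivative[OF assms]])

lemma M0_derivative_fst:
  assumes "(v, w) \<in> D0"
  shows "((\<lambda>z. M0 (z, w)) has_derivative (\<lambda>q. dM (v, w) (q, 0))) (at v)"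
  by (rule has_derivative_compose[OF has_derivative_Pair_left M0_derivative[OF assms]])

definition conj_in :: "'g \<Rightarrow> 'e \<Rightarrow> 'e" where
  "conj_in g v = \<phi> (g \<otimes> \<psi> v \<otimes> inv g)"

lemma conj_in_e0: "g \<in> carrier G \<Longrightarrow> conj_in g e0 = e0"
  by (simp add: conj_in_def id_coord)

lemma conj_in_eventually:
  assumes "g \<in> carrier G"
  shows "eventually (\<lambda>v. v \<in> V0 \<and> g \<otimes> \<psi> v \<otimes> inv g \<in> U0) (nhds e0)"
proof (rule eventually_conj)
  show "eventually (\<lambda>v. v \<in> V0) (nhds e0)"
    using eventually_nhds open_V0 id_coord(1) by blast
  have "continuous_map (top_of_set V0) (topo G) (\<lambda>v. g \<otimes> \<psi> v \<otimes> inv g)"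
    using assms by (intro continuous_map_mult continuous_psi) (auto simp: topspace_topo)
  then show "eventually (\<lambda>v. g \<otimes> \<psi> v \<otimes> inv g \<in> U0) (nhds e0)"
    by (rule eventually_in_topo[OF _ open_V0 openin_U0 id_coord(1)]) (use assms id_coord id_chart in auto)
qed

text \<open>\<open>Ad\<close> is defined by \<open>frechet_derivative\<close>, which is meaningful
  only once differentiability is known. Since \<open>g\<close> may lie outside the identity chart,
  conjugation is split into two products, read in a chart \<open>d\<close> at \<open>g\<close> and a
  chart \<open>b\<close> at \<open>inv g\<close>.\<close>

lemma conj_in_has_derivative:
  assumes g: "g \<in> carrier G"
  shows "(conj_in g has_derivative Ad G g) (at e0)"
proof -
  obtain d where d: "d \<in> atlas G" "g \<in> fst d" using g atlas_cover by blast
  obtain b where b: "b \<in> atlas G" "inv g \<in> fst b" using g atlas_cover inv_closed by blast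
  define f1 where "f1 = (\<lambda>v. mult_in d (id_chart G) d (snd d g, v))"
  define f2 where "f2 = (\<lambda>w. mult_in d b (id_chart G) (w, snd b (inv g)))"
  have f1e: "f1 e0 = snd d g" using d g by (simp add: f1_def mult_in_def id_coord)
  have "(snd d g, e0) \<in> mult_dom d (id_chart G) d"
  proof (intro mult_domI)
    show "chart_inv d (snd d g) \<otimes> \<psi> e0 \<in> fst d"
      by (simp only: chart_inv_left[OF d] id_coord(2) r_one[OF g] d(2))
  qed (use d(2) id_coord(1) in blast)+
  from mult_in_has_derivative[OF d(1) id_chart(1) d(1) this]
  have 1: "(f1 has_derivative (\<lambda>q. frechet_derivative (mult_in d (id_chart G) d) (at (snd d g, e0)) (0, q))) (at e0)"
    unfolding f1_def by (rule has_derivative_compose[OF has_derivative_Pair_right])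
  have "(snd d g, snd b (inv g)) \<in> mult_dom d b (id_chart G)"
  proof (intro mult_domI)
    show "chart_inv d (snd d g) \<otimes> chart_inv b (snd b (inv g)) \<in> U0"
      by (simp only: chart_inv_left[OF d] chart_inv_left[OF b] r_inv[OF g] id_chart(2))
  qed (use d(2) b(2) in blast)+
  from mult_in_has_derivative[OF d(1) b(1) id_chart(1) this]
  have 2: "(f2 has_derivative (\<lambda>q. frechet_derivative (mult_in d b (id_chart G)) (at (snd d g, snd b (inv g))) (q, 0)))
      (at (f1 e0))"
    unfolding f2_def f1e by (rule has_derivative_compose[OF has_derivative_Pair_left])
  have diff: "(\<lambda>v. f2 (f1 v)) differentiable (at e0)"
    using has_derivative_compose[OF 1 2] by (rule differentiableI)
  have "continuous_map (top_of_set V0) (topo G) (\<lambda>v. g \<otimes> \<psi> v)"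
    using g by (intro continuous_map_mult continuous_psi) (auto simp: topspace_topo)
  then have "eventually (\<lambda>v. g \<otimes> \<psi> v \<in> fst d) (nhds e0)"
    by (rule eventually_in_topo[OF _ open_V0 chart_openin[OF d(1)] id_coord(1)]) (use d g id_coord in auto)
  then have "eventually (\<lambda>v. f2 (f1 v) = conj_in g v) (nhds e0)"
    by (rule eventually_mono) (simp add: f1_def f2_def mult_in_def conj_in_def d b)
  with diff have "conj_in g differentiable (at e0)"
    by (rule differentiable_transform_nhds)
  then show ?thesis
    unfolding Ad_def conj_in_def[abs_def] by (simp add: frechet_derivative_works)
qed

lemma Ad_linear: "g \<in> carrier G \<Longrightarrow> linear (Ad G g)"
  using conj_in_has_derivative has_derivative_linear by blast

lemma Ad_eqI:
  assumes "g \<in> carrier G" "(f has_derivative f') (at e0)" "eventually (\<lambda>v. conj_in g v = f v) (nhds e0)"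
  shows "Ad G g = f'"
proof -
  have "(conj_in g has_derivative f') (at e0)"
    by (rule has_derivative_transform_nhds[OF assms(2)]) (use assms(3) in \<open>auto elim: eventually_mono\<close>)
  then show ?thesis using conj_in_has_derivative[OF assms(1)] has_derivative_unique by blast
qed

lemma Ad_one: "Ad G \<one> X = X"
proof -
  have "Ad G \<one> = (\<lambda>X. X)"
  proof (rule Ad_eqI)
    show "eventually (\<lambda>v. conj_in \<one> v = v) (nhds e0)"
      by (rule eventually_mono[OF conj_in_eventually[OF one_closed]])
        (simp add: conj_in_def psi_carrier phi_psi)
  qed auto
  then show ?thesis by simp
qed

lemma Ad_mult:
  assumes "g \<in> carrier G" "h \<in> carrier G"
  shows "Ad G (g \<otimes> h) X = Ad G g (Ad G h X)"
proof -
  have "Ad G (g \<otimes> h) = (\<lambda>X. Ad G g (Ad G h X))"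
  proof (rule Ad_eqI)
    show "((\<lambda>v. conj_in g (conj_in h v)) has_derivative (\<lambda>X. Ad G g (Ad G h X))) (at e0)"
      by (rule has_derivative_compose[OF conj_in_has_derivative[OF assms(2)]])
        (use conj_in_has_derivative assms conj_in_e0 in simp)
    show "eventually (\<lambda>v. conj_in (g \<otimes> h) v = conj_in g (conj_in h v)) (nhds e0)"
    proof (rule eventually_mono[OF conj_in_eventually[OF assms(2)]])
      fix v assume v: "v \<in> V0 \<and> h \<otimes> \<psi> v \<otimes> inv h \<in> U0"
      then have "conj_in g (conj_in h v) = \<phi> (g \<otimes> (h \<otimes> \<psi> v \<otimes> inv h) \<otimes> inv g)"
        by (simp add: conj_in_def psi_phi)
      also have "g \<otimes> (h \<otimes> \<psi> v \<otimes> inv h) \<otimes> inv g = g \<otimes> h \<otimes> \<psi> v \<otimes> inv (g \<otimes> h)"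
        using assms v psi_carrier[of v] by (simp add: inv_mult_group m_assoc)
      finally show "conj_in (g \<otimes> h) v = conj_in g (conj_in h v)"
        by (simp add: conj_in_def)
    qed
  qed (use assms in auto)
  then show ?thesis by simp
qed

lemma Ad_inv:
  assumes "g \<in> carrier G"
  shows "Ad G (inv g) (Ad G g X) = X" "Ad G g (Ad G (inv g) X) = X"
  using Ad_mult[of "inv g" g X] Ad_mult[of g "inv g" X] assms by (simp_all add: Ad_one)

definition inv_in :: "'e \<Rightarrow> 'e" where "inv_in v = \<phi> (inv \<psi> v)"

lemma inv_in_eventually: "eventually (\<lambda>v. v \<in> V0 \<and> inv \<psi> v \<in> U0) (nhds e0)"
proof (rule eventually_conj)
  show "eventually (\<lambda>v. v \<in> V0) (nhds e0)"
    using eventually_nhds open_V0 id_coord(1) by blast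
  have "continuous_map (top_of_set V0) (topo G) (\<lambda>v. inv \<psi> v)"
    by (intro continuous_map_inverse continuous_psi)
  then show "eventually (\<lambda>v. inv \<psi> v \<in> U0) (nhds e0)"
    by (rule eventually_in_topo[OF _ open_V0 openin_U0 id_coord(1)]) (use id_coord id_chart in auto)
qed

lemma inv_in_differentiable: "inv_in differentiable (at e0)"
proof -
  let ?S = "{v \<in> V0. inv \<psi> v \<in> U0}"
  have "open ?S"
    by (intro open_preimage_topo[OF _ open_V0 openin_U0] continuous_map_inverse continuous_psi)
  moreover have "e0 \<in> ?S" using id_coord id_chart by simp
  ultimately show ?thesis
    using smooth_on_has_derivative[OF smooth_inv[OF id_chart(1) id_chart(1)]]
    unfolding inv_in_def[abs_def] by (blast intro: differentiableI)
qed

text \<open>Near the identity, \<open>Ad\<close> is expressed by differentials of the multiplication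
  at points that depend on \<open>v\<close>. The outer differential is expanded in the basis because
  smoothness of \<open>M0\<close> makes \<open>dM p q\<close> differentiable in \<open>p\<close> for
  a fixed vector \<open>q\<close> only.\<close>

lemma Ad_psi:
  assumes v: "v \<in> V0" "inv \<psi> v \<in> U0"
  shows "Ad G (\<psi> v) Y = (\<Sum>b\<in>Basis. (dM (v, e0) (0, Y) \<bullet> b) *\<^sub>R dM (v, inv_in v) (b, 0))"
proof -
  have D: "(v, inv_in v) \<in> D0"
    using v psi_carrier[OF v(1)] id_chart by (auto simp: mem_D0 inv_in_def psi_phi)
  have A: "Ad G (\<psi> v) = (\<lambda>X. dM (v, inv_in v) (dM (v, e0) (0, X), 0))"
  proof (rule Ad_eqI)
    show "((\<lambda>w. M0 (M0 (v, w), inv_in v)) has_derivative (\<lambda>X. dM (v, inv_in v) (dM (v, e0) (0, X), 0))) (at e0)"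
      by (rule has_derivative_compose[OF M0_derivative_snd[OF D0_e0(1)[OF v(1)]]])
        (use M0_derivative_fst[OF D] M0_e0 v in simp)
    have "continuous_map (top_of_set V0) (topo G) (\<lambda>w. \<psi> v \<otimes> \<psi> w)"
      using psi_carrier[OF v(1)] by (intro continuous_map_mult continuous_psi) (auto simp: topspace_topo)
    then have "eventually (\<lambda>w. \<psi> v \<otimes> \<psi> w \<in> U0) (nhds e0)"
      by (rule eventually_in_topo[OF _ open_V0 openin_U0 id_coord(1)])
        (use v psi_carrier psi_U0 id_coord in auto)
    then show "eventually (\<lambda>w. conj_in (\<psi> v) w = M0 (M0 (v, w), inv_in v)) (nhds e0)"
      by (rule eventually_mono) (simp add: conj_in_def M0_apply psi_phi inv_in_def v)
  qed (use psi_carrier v in auto)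
  have "dM (v, inv_in v) (q, 0) = (\<Sum>b\<in>Basis. (q \<bullet> b) *\<^sub>R dM (v, inv_in v) (b, 0))" for q
  proof -
    have "linear (\<lambda>q. dM (v, inv_in v) (q, 0))"
      using M0_derivative_fst[OF D] has_derivative_linear by blast
    from linear_Basis_expansion[OF this] show ?thesis .
  qed
  then show ?thesis unfolding A .
qed

text \<open>Ensures that \<open>bracket\<close> is a true derivative and not an arbitrary value of
  \<open>frechet_derivative\<close>.\<close>

lemma bracket_has_derivative:
  "((\<lambda>v. Ad G (\<psi> v) Y) has_derivative (\<lambda>X. bracket G X Y)) (at e0)"
proof -
  have e: "(e0, e0) \<in> D0" "inv_in e0 = e0"
    using id_coord id_chart by (auto simp: mem_D0 inv_in_def)
  have dM_diff: "(\<lambda>p. dM p q) differentiable (at (e0, e0))" for q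
    using smooth_on_has_derivative[OF smooth_on_frechet[OF smooth_M0] open_D0 e(1)] by (blast intro: differentiableI)
  have d: "(\<lambda>v. (v, inv_in v)) differentiable (at e0)" "(\<lambda>v. (v, e0)) differentiable (at e0)"
    using inv_in_differentiable has_derivative_Pair[OF has_derivative_ident] has_derivative_Pair_left
    unfolding differentiable_def by blast+
  have 1: "(\<lambda>v. dM (v, inv_in v) q) differentiable (at e0)" for q
    by (rule differentiable_compose[where f = "\<lambda>p. dM p q", OF _ d(1)]) (simp add: dM_diff e(2))
  have 2: "(\<lambda>v. dM (v, e0) q) differentiable (at e0)" for q
    by (rule differentiable_compose[where f = "\<lambda>p. dM p q", OF _ d(2)]) (rule dM_diff)
  have "(\<lambda>v. \<Sum>b\<in>Basis. (dM (v, e0) (0, Y) \<bullet> b) *\<^sub>R dM (v, inv_in v) (b, 0)) differentiable (at e0)"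
    using 1 2 by (intro differentiable_sum) auto
  moreover have "eventually (\<lambda>v. (\<Sum>b\<in>Basis. (dM (v, e0) (0, Y) \<bullet> b) *\<^sub>R dM (v, inv_in v) (b, 0)) =
      Ad G (\<psi> v) Y) (nhds e0)"
    using inv_in_eventually Ad_psi by (auto elim: eventually_mono)
  ultimately have "(\<lambda>v. Ad G (\<psi> v) Y) differentiable (at e0)"
    by (rule differentiable_transform_nhds)
  then show ?thesis unfolding bracket_def by (simp add: frechet_derivative_works)
qed

end

section \<open>One-parameter subgroups and the exponential map\<close>

lemma has_vector_derivative_shift:
  fixes f :: "real \<Rightarrow> 'a::real_normed_vector"
  assumes "((\<lambda>h. f (t + h)) has_vector_derivative D) (at 0)"
  shows "(f has_vector_derivative D) (at t)"
proof -
  have 1: "((\<lambda>s. s - t) has_derivative (\<lambda>h. h)) (at t)"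
    by (auto intro!: derivative_eq_intros)
  have "((\<lambda>s. f (t + (s - t))) has_derivative (\<lambda>h. h *\<^sub>R D)) (at t)"
    by (rule has_derivative_compose[OF 1, where g = "\<lambda>h. f (t + h)"])
      (use assms in \<open>simp add: has_vector_derivative_def\<close>)
  then show ?thesis by (simp add: has_vector_derivative_def)
qed

lemma has_vector_derivative_compose:
  assumes "(f has_vector_derivative X) (at t)" "(g has_derivative g') (at (f t))"
  shows "((\<lambda>s. g (f s)) has_vector_derivative g' X) (at t)"
proof -
  have "((\<lambda>s. g (f s)) has_derivative (\<lambda>h. g' (h *\<^sub>R X))) (at t)"
    by (rule has_derivative_compose[OF assms(1)[unfolded has_vector_derivative_def] assms(2)])
  moreover have "linear g'" using assms(2) by (rule has_derivative_linear)
  ultimately show ?thesis by (simp add: has_vector_derivative_def linear_scale)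
qed

lemma has_vector_derivative_transform_nhds:
  assumes "(f has_vector_derivative f') (at x)" "eventually (\<lambda>y. f y = g y) (nhds x)"
  shows "(g has_vector_derivative f') (at x)"
  using assms unfolding has_vector_derivative_def by (rule has_derivative_transform_nhds)

context lie_group begin

text \<open>The left invariant vector field with value \<open>X\<close> at the identity, in the chart there.\<close>

definition left_field :: "'e \<Rightarrow> 'e \<Rightarrow> 'e" where
  "left_field X v = dM (v, e0) (0, X)"

text \<open>On the larger ball the left invariant fields are Lipschitz, so integral curves are
  unique there. Products of points of the smaller ball stay in the larger one, so short integral
  curves can be translated without leaving the region of uniqueness.\<close>

lemma chart_radius:
  obtains r r' where "r > 0" "r' > 0" "r' \<le> r" "cball e0 r \<subseteq> V0"
    "\<And>X. \<exists>L. L-lipschitz_on (cball e0 r) (left_field X)"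
    "\<And>v w. v \<in> cball e0 r' \<Longrightarrow> w \<in> cball e0 r' \<Longrightarrow> (v, w) \<in> D0 \<and> M0 (v, w) \<in> ball e0 r"
proof -
  have e: "(e0, e0) \<in> D0" by (rule D0_e0(1)[OF id_coord(1)])
  obtain r where r: "r > 0" "cball (e0, e0) r \<subseteq> D0"
    using bspec[OF open_contains_cball[THEN iffD1, OF open_D0] e] by blast
  have sub: "(v, e0) \<in> cball (e0, e0) r" if "v \<in> cball e0 r" for v
    using that by (simp add: dist_Pair_Pair)
  then have V: "cball e0 r \<subseteq> V0" using r(2) mem_D0 by blast
  have L: "\<exists>L. L-lipschitz_on (cball e0 r) (left_field X)" for X
  proof -
    obtain L where "L-lipschitz_on (cball (e0, e0) r) (\<lambda>p. dM p (0, X))"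
      using smooth_on_lipschitz_cball[OF smooth_on_frechet[OF smooth_M0] open_D0 r(2)] by blast
    then have "L-lipschitz_on (cball e0 r) (left_field X)"
      using lipschitz_onD[OF _ sub sub] lipschitz_on_nonneg
      by (fastforce simp: lipschitz_on_def left_field_def dist_Pair_Pair)
    then show ?thesis by blast
  qed
  have op: "open {p \<in> D0. M0 p \<in> ball e0 r}"
  proof -
    have "{p \<in> D0. M0 p \<in> ball e0 r} = D0 \<inter> M0 -` ball e0 r" by blast
    then show ?thesis
      using continuous_open_preimage[OF smooth_on_continuous_on[OF smooth_M0] open_D0 open_ball] by metis
  qed
  have mem: "(e0, e0) \<in> {p \<in> D0. M0 p \<in> ball e0 r}"
    using e r M0_e0(1)[OF id_coord(1)] by simp
  obtain s where s: "s > 0" "cball (e0, e0) s \<subseteq> {p \<in> D0. M0 p \<in> ball e0 r}"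
    using bspec[OF open_contains_cball[THEN iffD1, OF op] mem] by blast
  define r' where "r' = min r (s / 2)"
  have "(v, w) \<in> D0 \<and> M0 (v, w) \<in> ball e0 r" if "v \<in> cball e0 r'" "w \<in> cball e0 r'" for v w
  proof -
    have "dist (e0, e0) (v, w) \<le> dist e0 v + dist e0 w"
      unfolding dist_Pair_Pair by (rule sqrt_sum_squares_le_sum) auto
    also have "\<dots> \<le> s" using that by (simp add: r'_def)
    finally show ?thesis using s by auto
  qed
  moreover have "r' > 0" "r' \<le> r" using r s by (auto simp: r'_def)
  ultimately show ?thesis using that[of r r'] r V L by blast
qed

lemma left_field_e0: "left_field X e0 = X"
proof -
  have e: "(e0, e0) \<in> D0" by (rule D0_e0(1)[OF id_coord(1)])
  have "((\<lambda>z. z) has_derivative (\<lambda>q. dM (e0, e0) (0, q))) (at e0)"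
    by (rule has_derivative_transform_nhds[OF M0_derivative_snd[OF e]])
      (use open_V0 id_coord(1) M0_e0 in \<open>auto simp: eventually_nhds intro!: exI[of _ V0]\<close>)
  then have "(\<lambda>q. dM (e0, e0) (0, q)) = (\<lambda>q. q)"
    using has_derivative_ident has_derivative_unique by blast
  then show ?thesis by (metis left_field_def)
qed

text \<open>Associativity of the multiplication, differentiated in the third factor at the
  identity.\<close>

lemma left_field_invariant:
  assumes vw: "(v, w) \<in> D0"
  shows "dM (v, w) (0, left_field X w) = left_field X (M0 (v, w))"
proof -
  have w: "w \<in> V0" and v: "v \<in> V0" and m: "M0 (v, w) \<in> V0"
    using vw by (auto simp: mem_D0 M0_apply)
  have a: "((\<lambda>z. M0 (v, M0 (w, z))) has_derivative (\<lambda>X. dM (v, w) (0, dM (w, e0) (0, X)))) (at e0)"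
    by (rule has_derivative_compose[OF M0_derivative_snd[OF D0_e0(1)[OF w]]])
      (use M0_derivative_snd[OF vw] M0_e0 w in simp)
  have b: "((\<lambda>z. M0 (M0 (v, w), z)) has_derivative (\<lambda>X. dM (M0 (v, w), e0) (0, X))) (at e0)"
    by (rule M0_derivative_snd[OF D0_e0(1)[OF m]])
  have "continuous_map (top_of_set V0) (topo G) (\<lambda>z. \<psi> w \<otimes> \<psi> z)"
    using psi_carrier[OF w] by (intro continuous_map_mult continuous_psi) (auto simp: topspace_topo)
  then have "eventually (\<lambda>z. \<psi> w \<otimes> \<psi> z \<in> U0) (nhds e0)"
    by (rule eventually_in_topo[OF _ open_V0 openin_U0 id_coord(1)])
      (use w psi_carrier psi_U0 id_coord(2) in auto)
  moreover have "eventually (\<lambda>z. z \<in> V0) (nhds e0)"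
    using open_V0 id_coord(1) eventually_nhds by blast
  ultimately have "eventually (\<lambda>z. M0 (v, M0 (w, z)) = M0 (M0 (v, w), z)) (nhds e0)"
  proof eventually_elim
    case (elim z)
    then have "(w, z) \<in> D0" using w by (simp add: mem_D0)
    then show ?case
      using psi_M0[OF vw] psi_M0[of w z] psi_carrier[OF w] psi_carrier[OF v] psi_carrier[OF elim(2)]
      by (simp add: M0_apply m_assoc)
  qed
  then have "(\<lambda>X. dM (v, w) (0, dM (w, e0) (0, X))) = (\<lambda>X. dM (M0 (v, w), e0) (0, X))"
    by (rule has_derivative_unique[OF has_derivative_transform_nhds[OF a] b])
  then show ?thesis unfolding left_field_def by (rule fun_cong)
qed

lemma one_parameter_basic:
  assumes "one_parameter_subgroup G X \<gamma>"
  shows "\<gamma> t \<in> carrier G" "\<gamma> 0 = \<one>" "\<gamma> (s + t) = \<gamma> s \<otimes> \<gamma> t"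
proof -
  have c: "\<gamma> t \<in> carrier G" for t
    using assms continuous_map_image_subset_topspace topspace_topo
    by (fastforce simp: one_parameter_subgroup_def)
  have h: "\<gamma> (s + t) = \<gamma> s \<otimes> \<gamma> t" for s t
    using assms by (simp add: one_parameter_subgroup_def)
  show "\<gamma> t \<in> carrier G" "\<gamma> (s + t) = \<gamma> s \<otimes> \<gamma> t" by (rule c, rule h)
  show "\<gamma> 0 = \<one>" using h[of 0 0] c by (metis add_0 l_cancel_one)
qed

lemma hom_power:
  assumes "\<And>s t. \<gamma> (s + t) = \<gamma> s \<otimes> \<gamma> t" "\<gamma> 0 = \<one>" "\<And>t::real. \<gamma> t \<in> carrier G"
  shows "\<gamma> (real n * t) = \<gamma> t [^] n"
proof (induction n)
  case (Suc n)
  have "real (Suc n) * t = real n * t + t" by (simp add: algebra_simps)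
  then show ?case using Suc assms by simp
qed (simp add: assms)

lemma one_parameter_eventually:
  assumes "one_parameter_subgroup G X \<gamma>" "openin (topo G) Q" "\<gamma> t \<in> Q"
  shows "eventually (\<lambda>s. \<gamma> s \<in> Q) (nhds t)"
  by (rule eventually_in_topo[of UNIV]) (use assms in \<open>auto simp: one_parameter_subgroup_def\<close>)

text \<open>The homomorphism property makes the velocity at \<open>t\<close> the left translate of
  the velocity at 0, so one-parameter subgroups are integral curves of
  \<open>left_field X\<close>.\<close>

lemma one_parameter_derivative:
  assumes \<gamma>: "one_parameter_subgroup G X \<gamma>" and t: "\<gamma> t \<in> U0"
  shows "((\<lambda>s. \<phi> (\<gamma> s)) has_vector_derivative left_field X (\<phi> (\<gamma> t))) (at t)"
proof (rule has_vector_derivative_shift)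
  have p: "\<phi> (\<gamma> t) \<in> V0" using t by blast
  have d: "((\<lambda>s. \<phi> (\<gamma> s)) has_vector_derivative X) (at 0)"
    using \<gamma> by (simp add: one_parameter_subgroup_def)
  have "((\<lambda>h. M0 (\<phi> (\<gamma> t), \<phi> (\<gamma> h))) has_vector_derivative dM (\<phi> (\<gamma> t), e0) (0, X)) (at 0)"
    by (rule has_vector_derivative_compose[OF d])
      (use M0_derivative_snd[OF D0_e0(1)[OF p]] one_parameter_basic(2)[OF \<gamma>] id_coord(3) in simp)
  moreover have "eventually (\<lambda>h. \<gamma> h \<in> U0) (nhds 0)"
    by (rule one_parameter_eventually[OF \<gamma> openin_U0]) (simp add: one_parameter_basic(2)[OF \<gamma>] id_chart(2))
  then have "eventually (\<lambda>h. M0 (\<phi> (\<gamma> t), \<phi> (\<gamma> h)) = \<phi> (\<gamma> (t + h))) (nhds 0)"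
    by (rule eventually_mono) (simp add: M0_apply psi_phi t one_parameter_basic(3)[OF \<gamma>])
  ultimately show "((\<lambda>h. \<phi> (\<gamma> (t + h))) has_vector_derivative left_field X (\<phi> (\<gamma> t))) (at 0)"
    unfolding left_field_def by (rule has_vector_derivative_transform_nhds)
qed

text \<open>Near 0 both curves solve the same differential equation; elsewhere the value at t is the
  n-th power of the value at t/n.\<close>

lemma one_parameter_unique:
  assumes \<gamma>1: "one_parameter_subgroup G X \<gamma>1" and \<gamma>2: "one_parameter_subgroup G X \<gamma>2"
  shows "\<gamma>1 = \<gamma>2"
proof -
  obtain r where r: "r > 0" "cball e0 r \<subseteq> V0"
    and lip: "\<exists>L. L-lipschitz_on (cball e0 r) (left_field X)"
    using chart_radius by metis
  then obtain L where L: "L-lipschitz_on (cball e0 r) (left_field X)" by blast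
  define Q where "Q = {g \<in> U0. \<phi> g \<in> ball e0 r}"
  have Q: "openin (topo G) Q" unfolding Q_def by (intro openin_chart_preimage id_chart) auto
  have Q1: "\<one> \<in> Q" using id_chart id_coord(3) r by (simp add: Q_def)
  have "eventually (\<lambda>s. \<gamma>1 s \<in> Q) (nhds 0)" "eventually (\<lambda>s. \<gamma>2 s \<in> Q) (nhds 0)"
    using one_parameter_eventually[OF _ Q] \<gamma>1 \<gamma>2 one_parameter_basic(2) Q1 by metis+
  then have "eventually (\<lambda>s. \<gamma>1 s \<in> Q \<and> \<gamma>2 s \<in> Q) (nhds 0)" by (rule eventually_conj)
  then obtain \<delta> where \<delta>: "\<delta> > 0" "\<And>s. \<bar>s\<bar> < \<delta> \<Longrightarrow> \<gamma>1 s \<in> Q \<and> \<gamma>2 s \<in> Q"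
    unfolding eventually_nhds_metric by (auto simp: dist_real_def)
  have loc: "\<gamma>1 t = \<gamma>2 t" if t: "\<bar>t\<bar> < \<delta>" for t
  proof -
    have "\<phi> (\<gamma>1 t) = \<phi> (\<gamma>2 t)"
    proof (rule ode_unique[OF L, where a = "-\<delta>" and b = \<delta> and \<tau> = 0 and t = t
          and x = "\<lambda>s. \<phi> (\<gamma>1 s)" and y = "\<lambda>s. \<phi> (\<gamma>2 s)"])
      fix s assume "s \<in> {-\<delta><..<\<delta>}"
      then have "\<gamma>1 s \<in> Q" "\<gamma>2 s \<in> Q" using \<delta>(2)[of s] by auto
      then have "\<gamma>1 s \<in> U0" "\<gamma>2 s \<in> U0" "\<phi> (\<gamma>1 s) \<in> cball e0 r" "\<phi> (\<gamma>2 s) \<in> cball e0 r"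
        by (simp_all add: Q_def less_imp_le)
      then show "((\<lambda>s. \<phi> (\<gamma>1 s)) has_vector_derivative left_field X (\<phi> (\<gamma>1 s))) (at s)"
        "((\<lambda>s. \<phi> (\<gamma>2 s)) has_vector_derivative left_field X (\<phi> (\<gamma>2 s))) (at s)"
        "\<phi> (\<gamma>1 s) \<in> cball e0 r" "\<phi> (\<gamma>2 s) \<in> cball e0 r"
        by (auto intro: one_parameter_derivative[OF \<gamma>1] one_parameter_derivative[OF \<gamma>2])
    qed (use t \<delta> one_parameter_basic(2)[OF \<gamma>1] one_parameter_basic(2)[OF \<gamma>2] in auto)
    moreover have "\<gamma>1 t \<in> U0" "\<gamma>2 t \<in> U0" using \<delta>(2)[OF t] by (auto simp: Q_def)
    ultimately show ?thesis using psi_phi by metis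
  qed
  show ?thesis
  proof
    fix t
    obtain n :: nat where n: "\<bar>t\<bar> / \<delta> < real n" using reals_Archimedean2 by blast
    moreover have "0 \<le> \<bar>t\<bar> / \<delta>" using \<delta> by simp
    ultimately have "0 < real n" by linarith
    then have "n > 0" by simp
    then have "\<bar>t / real n\<bar> < \<delta>" using n \<delta> by (simp add: pos_divide_less_eq abs_div mult.commute)
    with \<open>n > 0\<close> have "\<gamma>1 (t / real n) = \<gamma>2 (t / real n)" "real n * (t / real n) = t" using loc by auto
    then show "\<gamma>1 t = \<gamma>2 t"
      using hom_power[of \<gamma>1 n "t / real n"] hom_power[of \<gamma>2 n "t / real n"]
        one_parameter_basic[OF \<gamma>1] one_parameter_basic[OF \<gamma>2] by simp
  qed
qed

text \<open>The extension is the n-th power of f(t/n) for any n so large that t/n lies in the domain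
  of \<open>f\<close>.\<close>

lemma local_hom_extend:
  assumes \<delta>: "\<delta> > 0" and car: "\<And>t. \<bar>t\<bar> < \<delta> \<Longrightarrow> f t \<in> carrier G"
    and add: "\<And>s t. \<bar>s\<bar> < \<delta> \<Longrightarrow> \<bar>t\<bar> < \<delta> \<Longrightarrow> \<bar>s + t\<bar> < \<delta> \<Longrightarrow> f (s + t) = f s \<otimes> f t"
  obtains \<gamma> :: "real \<Rightarrow> 'g" where "\<And>s t. \<gamma> (s + t) = \<gamma> s \<otimes> \<gamma> t" "\<And>t. \<bar>t\<bar> < \<delta> \<Longrightarrow> \<gamma> t = f t"
    "\<And>t. \<gamma> t \<in> carrier G"
proof -
  have f0: "f 0 = \<one>" using add[of 0 0] car[of 0] \<delta> l_cancel_one[of "f 0" "f 0"] by simp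
  have pow: "f (real k * u) = f u [^] k" if "real k * \<bar>u\<bar> < \<delta>" for k u
    using that
  proof (induction k)
    case (Suc k)
    then have le: "real k * \<bar>u\<bar> + \<bar>u\<bar> < \<delta>" by (simp add: algebra_simps)
    then have 1: "real k * \<bar>u\<bar> < \<delta>" "\<bar>u\<bar> < \<delta>"
      using abs_ge_zero[of u] mult_nonneg_nonneg[of "real k" "\<bar>u\<bar>"] by linarith+
    have "\<bar>real k * u + u\<bar> < \<delta>"
      using le abs_triangle_ineq[of "real k * u" u] by (simp add: abs_mult)
    then have "f (real k * u + u) = f (real k * u) \<otimes> f u"
      using 1 by (intro add) (auto simp: abs_mult)
    then show ?case using Suc.IH[OF 1(1)] by (simp add: algebra_simps)
  qed (simp add: f0)
  \<comment> \<open>One more than the rounded quotient, since the bound has to be strict and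
    \<open>N 0\<close> positive.\<close>
  define N where "N = (\<lambda>t. nat \<lceil>\<bar>t\<bar> / \<delta>\<rceil> + 1)"
  have N: "\<bar>t\<bar> < real (N t) * \<delta>" "N t > 0" for t
  proof -
    have "\<bar>t\<bar> / \<delta> < real (N t)" unfolding N_def by linarith
    then show "\<bar>t\<bar> < real (N t) * \<delta>" using \<delta> by (simp add: field_simps)
  qed (simp add: N_def)
  define \<gamma> where "\<gamma> = (\<lambda>t. f (t / real (N t)) [^] N t)"
  have small: "\<bar>t / real n\<bar> < \<delta>" if "\<bar>t\<bar> < real n * \<delta>" "n > 0" for t n
    using that by (simp add: field_simps abs_div)
  have eq: "\<gamma> t = f (t / real n) [^] n" if n: "\<bar>t\<bar> < real n * \<delta>" "n > 0" for t n
  proof -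
    \<comment> \<open>Replacing m by a multiple m k does not change the power. Comparing
      \<open>N t\<close> and \<open>n\<close> with their product then shows that the choice of n is
      irrelevant.\<close>
    have *: "f (t / real m) [^] m = f (t / real (m * k)) [^] (m * k)"
      if "\<bar>t\<bar> < real m * \<delta>" "m > 0" "k > 0" for m k
    proof -
      have eqs: "real k * (t / real (m * k)) = t / real m" using that by simp
      have sm: "real k * \<bar>t / real (m * k)\<bar> = \<bar>t / real m\<bar>" using that by (simp add: abs_div abs_mult)
      have "\<bar>t / real (m * k)\<bar> \<le> \<bar>t / real m\<bar>"
        using that sm by (metis abs_ge_zero mult_le_cancel_right1 of_nat_1 of_nat_le_iff Suc_leI One_nat_def not_le)
      then have c: "f (t / real (m * k)) \<in> carrier G"
        using small[OF that(1,2)] by (intro car) linarith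
      have "f (t / real m) = f (t / real (m * k)) [^] k"
        using pow[of k "t / real (m * k)"] small[OF that(1,2)] sm eqs by simp
      then show ?thesis using c by (simp add: nat_pow_pow mult.commute)
    qed
    show ?thesis
      unfolding \<gamma>_def using *[OF N, of n] *[OF n, of "N t"] n N by (simp add: mult.commute)
  qed
  have carg: "\<gamma> t \<in> carrier G" for t
    unfolding \<gamma>_def using car[OF small[OF N]] by simp
  show ?thesis
  proof (rule that[OF _ _ carg])
    show "\<gamma> t = f t" if "\<bar>t\<bar> < \<delta>" for t
      using eq[of t 1] that car[OF that] by simp
    fix s t
    obtain n :: nat where n: "(\<bar>s\<bar> + \<bar>t\<bar>) / \<delta> < real n" using reals_Archimedean2 by blast
    then have n': "n > 0" "\<bar>s\<bar> + \<bar>t\<bar> < real n * \<delta>"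
    proof -
      have "0 \<le> (\<bar>s\<bar> + \<bar>t\<bar>) / \<delta>" using \<delta> by simp
      then have "0 < real n" using n by linarith
      then show "n > 0" by simp
      show "\<bar>s\<bar> + \<bar>t\<bar> < real n * \<delta>" using n \<delta> by (simp add: pos_divide_less_eq)
    qed
    then have lt: "\<bar>s\<bar> < real n * \<delta>" "\<bar>t\<bar> < real n * \<delta>" "\<bar>s + t\<bar> < real n * \<delta>" by linarith+
    note sm = small[OF lt(1) n'(1)] small[OF lt(2) n'(1)] small[OF lt(3) n'(1)]
    have "f (s / real n + t / real n) = f (s / real n) \<otimes> f (t / real n)"
      "f (t / real n + s / real n) = f (t / real n) \<otimes> f (s / real n)"
      using sm by (intro add; simp add: add_divide_distrib add.commute)+
    then have fe: "f ((s + t) / real n) = f (s / real n) \<otimes> f (t / real n)"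
      and comm: "f (s / real n) \<otimes> f (t / real n) = f (t / real n) \<otimes> f (s / real n)"
      by (simp_all add: add_divide_distrib add.commute)
    show "\<gamma> (s + t) = \<gamma> s \<otimes> \<gamma> t"
      unfolding eq[OF lt(1) n'(1)] eq[OF lt(2) n'(1)] eq[OF lt(3) n'(1)] fe
      by (rule pow_mult_distrib[OF comm car[OF sm(1)] car[OF sm(2)]])
  qed
qed

text \<open>The integral curve \<open>x\<close> through the identity is a local homomorphism: for
  fixed s, both x(s + u) and the product of x(s) and x(u) are integral curves in u that start at
  x(s).\<close>

lemma one_parameter_exists: "\<exists>\<gamma>. one_parameter_subgroup G X \<gamma>"
proof -
  obtain r r' where r: "r > 0" "r' > 0" "r' \<le> r" "cball e0 r \<subseteq> V0"
    and lip: "\<exists>L. L-lipschitz_on (cball e0 r) (left_field X)"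
    and mult: "\<And>v w. v \<in> cball e0 r' \<Longrightarrow> w \<in> cball e0 r' \<Longrightarrow> (v, w) \<in> D0 \<and> M0 (v, w) \<in> ball e0 r"
    using chart_radius by metis
  obtain L where L: "L-lipschitz_on (cball e0 r) (left_field X)" using lip by blast
  have "cball e0 r' \<subseteq> cball e0 r" using r by auto
  then have L': "L-lipschitz_on (cball e0 r') (left_field X)" using L lipschitz_on_subset by blast
  obtain \<epsilon> x where \<epsilon>: "\<epsilon> > 0" and x0: "x 0 = e0"
    and xb: "\<And>t. t \<in> {-\<epsilon><..<\<epsilon>} \<Longrightarrow> x t \<in> ball e0 r'"
    and xd: "\<And>t. t \<in> {-\<epsilon><..<\<epsilon>} \<Longrightarrow> (x has_vector_derivative left_field X (x t)) (at t)"
    using ode_local_solution[OF L' r(2)] by metis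
  have xc: "x t \<in> cball e0 r'" if "t \<in> {-\<epsilon><..<\<epsilon>}" for t
    using xb[OF that] by (simp add: less_imp_le)
  have xV: "x t \<in> V0" if "t \<in> {-\<epsilon><..<\<epsilon>}" for t
    using xc[OF that] r by auto
  define f where "f = (\<lambda>t. \<psi> (x t))"
  \<comment> \<open>Half the interval, so that the sum of two parameters remains in the domain of
    \<open>x\<close>.\<close>
  define \<delta> where "\<delta> = \<epsilon> / 2"
  have \<delta>: "\<delta> > 0" using \<epsilon> by (simp add: \<delta>_def)
  have car: "f t \<in> carrier G" if "\<bar>t\<bar> < \<delta>" for t
    unfolding f_def using that by (intro psi_carrier xV) (auto simp: \<delta>_def)
  have add: "f (s + t) = f s \<otimes> f t" if s: "\<bar>s\<bar> < \<delta>" and t: "\<bar>t\<bar> < \<delta>" for s t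
  proof -
    have "x (s + t) = M0 (x s, x t)"
    proof (rule ode_unique[OF L, where a = "-\<delta>" and b = \<delta> and \<tau> = 0 and t = t
          and x = "\<lambda>u. x (s + u)" and y = "\<lambda>u. M0 (x s, x u)"])
      fix u assume u: "u \<in> {-\<delta><..<\<delta>}"
      then have su: "s + u \<in> {-\<epsilon><..<\<epsilon>}" "u \<in> {-\<epsilon><..<\<epsilon>}" "s \<in> {-\<epsilon><..<\<epsilon>}"
        using s by (auto simp: \<delta>_def)
      have shift: "((\<lambda>u. s + u) has_vector_derivative 1) (at u)"
        by (auto intro!: derivative_eq_intros)
      have "(x has_derivative (\<lambda>h. h *\<^sub>R left_field X (x (s + u)))) (at (s + u))"
        using xd[OF su(1)] by (simp add: has_vector_derivative_def)
      from has_vector_derivative_compose[OF shift this]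
      show "((\<lambda>u. x (s + u)) has_vector_derivative left_field X (x (s + u))) (at u)" by simp
      have D: "(x s, x u) \<in> D0" and M: "M0 (x s, x u) \<in> ball e0 r"
        using mult[OF xc[OF su(3)] xc[OF su(2)]] by auto
      from has_vector_derivative_compose[OF xd[OF su(2)] M0_derivative_snd[OF D]]
      show "((\<lambda>u. M0 (x s, x u)) has_vector_derivative left_field X (M0 (x s, x u))) (at u)"
        unfolding left_field_invariant[OF D] .
      show "M0 (x s, x u) \<in> cball e0 r" using M by (simp add: less_imp_le)
      show "x (s + u) \<in> cball e0 r" using xc[OF su(1)] r by auto
    next
      have "s \<in> {-\<epsilon><..<\<epsilon>}" using s by (auto simp: \<delta>_def)
      then show "x (s + 0) = M0 (x s, x 0)" using M0_e0(1)[OF xV] by (simp add: x0)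
    qed (use \<delta> t in auto)
    moreover have "(x s, x t) \<in> D0"
    proof -
      have "s \<in> {-\<epsilon><..<\<epsilon>}" "t \<in> {-\<epsilon><..<\<epsilon>}" using s t by (auto simp: \<delta>_def)
      then show ?thesis using mult[OF xc xc] by blast
    qed
    ultimately show ?thesis unfolding f_def using psi_M0 by metis
  qed
  obtain \<gamma> :: "real \<Rightarrow> 'g" where hom: "\<And>s t. \<gamma> (s + t) = \<gamma> s \<otimes> \<gamma> t"
    and loc: "\<And>t. \<bar>t\<bar> < \<delta> \<Longrightarrow> \<gamma> t = f t" and gcar: "\<And>t. \<gamma> t \<in> carrier G"
    using local_hom_extend[of \<delta> f] \<delta> car add by blast
  have "continuous_map euclideanreal (topo G) \<gamma>"
    unfolding continuous_map_def
  proof (intro conjI allI impI)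
    show "\<gamma> \<in> topspace euclideanreal \<rightarrow> topspace (topo G)" using gcar topspace_topo by auto
    fix Q assume Q: "openin (topo G) Q"
    \<comment> \<open>Continuity at \<open>t0\<close> is continuity of \<open>f\<close> at 0
      translated by \<open>\<gamma> t0\<close>.\<close>
    have "eventually (\<lambda>t. t \<in> {t. \<gamma> t \<in> Q}) (nhds t0)" if t0: "\<gamma> t0 \<in> Q" for t0
    proof -
      let ?I = "{-\<delta><..<\<delta>}"
      have "continuous_on ?I x"
      proof (intro continuous_at_imp_continuous_on ballI)
        fix u assume "u \<in> ?I"
        then have "u \<in> {-\<epsilon><..<\<epsilon>}" by (auto simp: \<delta>_def)
        then show "isCont x u" by (rule has_vector_derivative_continuous[OF xd])
      qed
      moreover have "x ` ?I \<subseteq> V0" using xV by (auto simp: \<delta>_def)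
      ultimately have "continuous_map (top_of_set ?I) (top_of_set V0) x" by auto
      from continuous_map_compose[OF this continuous_psi]
      have "continuous_map (top_of_set ?I) (topo G) f" by (simp add: f_def o_def)
      then have "continuous_map (top_of_set ?I) (topo G) (\<lambda>h. \<gamma> t0 \<otimes> f h)"
        using gcar[of t0] by (intro continuous_map_mult) (auto simp: topspace_topo)
      then have "eventually (\<lambda>h. \<gamma> t0 \<otimes> f h \<in> Q) (nhds 0)"
        by (rule eventually_in_topo[OF _ _ Q]) (use \<delta> t0 gcar[of t0] in \<open>auto simp: f_def x0 id_coord(2)\<close>)
      then have "eventually (\<lambda>h. \<gamma> t0 \<otimes> f h \<in> Q \<and> h \<in> ?I) (nhds 0)"
        by (rule eventually_conj) (rule eventually_nhds_in_open, use \<delta> in auto)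
      moreover have "filterlim (\<lambda>t. t - t0) (nhds (t0 - t0)) (nhds t0)"
        by (intro tendsto_diff filterlim_ident tendsto_const)
      then have "filterlim (\<lambda>t. t - t0) (nhds 0) (nhds t0)" by simp
      ultimately have "eventually (\<lambda>t. \<gamma> t0 \<otimes> f (t - t0) \<in> Q \<and> t - t0 \<in> ?I) (nhds t0)"
        by (rule eventually_compose_filterlim)
      then show ?thesis
      proof (rule eventually_mono)
        fix t assume t: "\<gamma> t0 \<otimes> f (t - t0) \<in> Q \<and> t - t0 \<in> ?I"
        then have "\<gamma> t = \<gamma> t0 \<otimes> f (t - t0)"
          using hom[of t0 "t - t0"] loc[of "t - t0"] by auto
        then show "t \<in> {t. \<gamma> t \<in> Q}" using t by simp
      qed
    qed
    then have "\<forall>t0\<in>{t. \<gamma> t \<in> Q}. \<exists>T. open T \<and> t0 \<in> T \<and> T \<subseteq> {t. \<gamma> t \<in> Q}"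
      unfolding eventually_nhds by (metis mem_Collect_eq subsetI)
    then have "open {t. \<gamma> t \<in> Q}" by (rule open_subopen[THEN iffD2])
    then show "openin euclideanreal {x \<in> topspace euclideanreal. \<gamma> x \<in> Q}" by simp
  qed
  moreover have "((\<lambda>t. \<phi> (\<gamma> t)) has_vector_derivative X) (at 0)"
  proof (rule has_vector_derivative_transform_nhds)
    show "(x has_vector_derivative X) (at 0)"
      using xd[of 0] \<epsilon> by (simp add: x0 left_field_e0)
    have "eventually (\<lambda>t. t \<in> {-\<delta><..<\<delta>}) (nhds 0)"
      by (rule eventually_nhds_in_open) (use \<delta> in auto)
    then show "eventually (\<lambda>t. x t = \<phi> (\<gamma> t)) (nhds 0)"
    proof (rule eventually_mono)
      fix t assume "t \<in> {-\<delta><..<\<delta>}"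
      then have "\<bar>t\<bar> < \<delta>" "t \<in> {-\<epsilon><..<\<epsilon>}" by (auto simp: \<delta>_def)
      then show "x t = \<phi> (\<gamma> t)" using loc[of t] xV[of t] by (simp add: f_def)
    qed
  qed
  ultimately have "one_parameter_subgroup G X \<gamma>"
    using hom by (simp add: one_parameter_subgroup_def)
  then show ?thesis by blast
qed

section \<open>The exponential map\<close>

abbreviation "Exp \<equiv> lie_exp G"

lemma one_parameter_the: "one_parameter_subgroup G X (THE \<gamma>. one_parameter_subgroup G X \<gamma>)"
  by (rule theI'[OF ex_ex1I[OF one_parameter_exists one_parameter_unique]])

lemma one_parameter_rescale:
  assumes \<gamma>: "one_parameter_subgroup G X \<gamma>"
  shows "one_parameter_subgroup G (c *\<^sub>R X) (\<lambda>t. \<gamma> (c * t))"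
proof -
  have "continuous_map euclideanreal euclideanreal (\<lambda>t. c * t)" by (auto intro!: continuous_intros)
  then have "continuous_map euclideanreal (topo G) (\<lambda>t. \<gamma> (c * t))"
    using continuous_map_compose[of euclideanreal euclideanreal "\<lambda>t. c * t" "topo G" \<gamma>] \<gamma>
    by (simp add: one_parameter_subgroup_def o_def)
  moreover have "((\<lambda>t. \<phi> (\<gamma> (c * t))) has_vector_derivative c *\<^sub>R X) (at 0)"
  proof -
    have "((\<lambda>t. c * t) has_vector_derivative c) (at 0)"
      by (auto intro!: derivative_eq_intros)
    moreover have "((\<lambda>t. \<phi> (\<gamma> t)) has_derivative (\<lambda>h. h *\<^sub>R X)) (at (c * 0))"
      using \<gamma> by (simp add: one_parameter_subgroup_def has_vector_derivative_def)
    ultimately show ?thesis by (rule has_vector_derivative_compose)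
  qed
  ultimately show ?thesis
    using \<gamma> by (simp add: one_parameter_subgroup_def distrib_left)
qed

text \<open>\<open>lie_exp\<close> evaluates a uniquely described curve at time 1; rescaling time
  recovers the whole curve from the values at multiples of \<open>X\<close>.\<close>

lemma one_parameter_Exp: "one_parameter_subgroup G X (\<lambda>t. Exp (t *\<^sub>R X))"
proof -
  define \<gamma> where "\<gamma> = (THE \<gamma>. one_parameter_subgroup G X \<gamma>)"
  have \<gamma>: "one_parameter_subgroup G X \<gamma>" unfolding \<gamma>_def by (rule one_parameter_the)
  have "Exp (t *\<^sub>R X) = \<gamma> t" for t
    using one_parameter_unique[OF one_parameter_the one_parameter_rescale[OF \<gamma>, of t]]
    by (simp add: lie_exp_def)
  then show ?thesis using \<gamma> by simp
qed

lemma Exp_unique: "one_parameter_subgroup G X \<gamma> \<Longrightarrow> Exp (t *\<^sub>R X) = \<gamma> t"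
  using one_parameter_unique[OF one_parameter_Exp] by metis

lemma Exp_carrier [simp]: "Exp X \<in> carrier G"
  using one_parameter_basic(1)[OF one_parameter_Exp, where t = 1 and X = X] by simp

lemma Exp_zero [simp]: "Exp 0 = \<one>"
  using one_parameter_basic(2)[OF one_parameter_Exp, where X = 0] by simp

lemma Exp_add: "Exp ((s + t) *\<^sub>R X) = Exp (s *\<^sub>R X) \<otimes> Exp (t *\<^sub>R X)"
  by (rule one_parameter_basic(3)[OF one_parameter_Exp])

lemma Exp_neg: "Exp (- X) = inv Exp X"
proof -
  have "Exp (- X) \<otimes> Exp X = \<one>" using Exp_add[of "-1" 1 X] by simp
  then show ?thesis using inv_equality by simp
qed

lemma Exp_derivative: "((\<lambda>t. \<phi> (Exp (t *\<^sub>R X))) has_vector_derivative X) (at 0)"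
  using one_parameter_Exp[of X] by (simp add: one_parameter_subgroup_def)

lemma continuous_Exp_line: "continuous_map euclideanreal (topo G) (\<lambda>t. Exp (t *\<^sub>R X))"
  using one_parameter_Exp[of X] by (simp add: one_parameter_subgroup_def)

lemma Exp_eventually_U0: "eventually (\<lambda>t. Exp (t *\<^sub>R X) \<in> U0) (nhds 0)"
  by (rule one_parameter_eventually[OF one_parameter_Exp openin_U0]) (simp add: id_chart)

lemma Exp_line_inject:
  assumes "\<And>t. Exp (t *\<^sub>R X) = Exp (t *\<^sub>R Y)"
  shows "X = Y"
  using Exp_derivative[of X] Exp_derivative[of Y] assms vector_derivative_unique_at by auto

text \<open>Conjugation by \<open>g\<close> turns a one-parameter subgroup into another one, whose
  velocity at 0 is \<open>Ad G g X\<close> by the chain rule.\<close>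

lemma Exp_conj:
  assumes g: "g \<in> carrier G"
  shows "g \<otimes> Exp X \<otimes> inv g = Exp (Ad G g X)"
proof -
  let ?\<gamma> = "\<lambda>t. g \<otimes> Exp (t *\<^sub>R X) \<otimes> inv g"
  have "continuous_map euclideanreal (topo G) ?\<gamma>"
    using g by (intro continuous_map_mult continuous_Exp_line) (auto simp: topspace_topo)
  moreover have "?\<gamma> (s + t) = ?\<gamma> s \<otimes> ?\<gamma> t" for s t
  proof -
    have "?\<gamma> s \<otimes> ?\<gamma> t = g \<otimes> Exp (s *\<^sub>R X) \<otimes> (inv g \<otimes> g) \<otimes> Exp (t *\<^sub>R X) \<otimes> inv g"
      using g by (simp only: m_assoc m_closed Exp_carrier inv_closed)
    also have "\<dots> = g \<otimes> (Exp (s *\<^sub>R X) \<otimes> Exp (t *\<^sub>R X)) \<otimes> inv g"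
      using g by (simp add: m_assoc)
    finally show ?thesis by (simp add: Exp_add)
  qed
  moreover have "((\<lambda>t. \<phi> (?\<gamma> t)) has_vector_derivative Ad G g X) (at 0)"
  proof (rule has_vector_derivative_transform_nhds)
    show "((\<lambda>t. conj_in g (\<phi> (Exp (t *\<^sub>R X)))) has_vector_derivative Ad G g X) (at 0)"
      by (rule has_vector_derivative_compose[OF Exp_derivative])
        (use conj_in_has_derivative[OF g] in \<open>simp add: id_coord(3)\<close>)
    show "eventually (\<lambda>t. conj_in g (\<phi> (Exp (t *\<^sub>R X))) = \<phi> (?\<gamma> t)) (nhds 0)"
      by (rule eventually_mono[OF Exp_eventually_U0[of X]]) (simp add: conj_in_def psi_phi)
  qed
  ultimately have "one_parameter_subgroup G (Ad G g X) ?\<gamma>"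
    unfolding one_parameter_subgroup_def by blast
  from Exp_unique[OF this, of 1] show ?thesis by simp
qed

lemma Ad_bounded_linear: "g \<in> carrier G \<Longrightarrow> bounded_linear (Ad G g)"
  using Ad_linear by (simp add: linear_conv_bounded_linear)

text \<open>Differentiability in the chart gives continuity at the identity. Writing g as h times
  inv(h) g moves this to an arbitrary h, as \<open>Ad\<close> is multiplicative.\<close>

lemma continuous_Ad: "continuous_map (topo G) euclidean (\<lambda>g. Ad G g Y)"
  unfolding continuous_map_def
proof (intro conjI allI impI)
  fix Q :: "'e set" assume "openin euclidean Q"
  then have Q: "open Q" by simp
  show "openin (topo G) {g \<in> topspace (topo G). Ad G g Y \<in> Q}"
  proof (subst openin_subopen, intro ballI)
    fix h assume "h \<in> {g \<in> topspace (topo G). Ad G g Y \<in> Q}"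
    then have h: "h \<in> carrier G" "Ad G h Y \<in> Q" by (auto simp: topspace_topo)
    have "isCont (\<lambda>v. Ad G (\<psi> v) Y) e0"
      using bracket_has_derivative[of Y] has_derivative_continuous by blast
    moreover have "continuous_on UNIV (Ad G h)"
      by (rule linear_continuous_on[OF Ad_bounded_linear[OF h(1)]])
    then have "isCont (Ad G h) (Ad G (\<psi> e0) Y)" by (simp add: continuous_on_eq_continuous_at)
    ultimately have "isCont (\<lambda>v. Ad G h (Ad G (\<psi> v) Y)) e0" by (rule isCont_o2)
    then have "((\<lambda>v. Ad G h (Ad G (\<psi> v) Y)) \<longlongrightarrow> Ad G h (Ad G (\<psi> e0) Y)) (nhds e0)"
      unfolding isCont_def
      by (rule tendsto_at_iff_tendsto_nhds[of "\<lambda>v. Ad G h (Ad G (\<psi> v) Y)", THEN iffD1])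
    then have "((\<lambda>v. Ad G h (Ad G (\<psi> v) Y)) \<longlongrightarrow> Ad G h Y) (nhds e0)"
      by (simp only: id_coord(2) Ad_one)
    then have "eventually (\<lambda>v. Ad G h (Ad G (\<psi> v) Y) \<in> Q) (nhds e0)"
      using topological_tendstoD Q h(2) by blast
    then obtain S where S: "open S" "e0 \<in> S" "\<And>v. v \<in> S \<Longrightarrow> Ad G h (Ad G (\<psi> v) Y) \<in> Q"
      unfolding eventually_nhds by blast
    define O1 where "O1 = {g \<in> U0. \<phi> g \<in> S}"
    define O2 where "O2 = {g \<in> topspace (topo G). inv h \<otimes> g \<in> O1}"
    have "openin (topo G) O1" unfolding O1_def by (rule openin_chart_preimage[OF id_chart(1) S(1)])
    then have "openin (topo G) O2"
      unfolding O2_def using continuous_left_translation[of "inv h"] h(1) openin_continuous_map_preimage by blast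
    moreover have "h \<in> O2" using h(1) id_chart S id_coord(3) by (simp add: O1_def O2_def topspace_topo)
    moreover have "O2 \<subseteq> {g \<in> topspace (topo G). Ad G g Y \<in> Q}"
    proof
      fix g assume g: "g \<in> O2"
      then have gc: "g \<in> carrier G" and U: "inv h \<otimes> g \<in> U0" "\<phi> (inv h \<otimes> g) \<in> S"
        by (auto simp: O1_def O2_def topspace_topo)
      have "g = h \<otimes> (inv h \<otimes> g)" using gc h(1) by (simp add: m_assoc[symmetric])
      then have "Ad G g Y = Ad G h (Ad G (inv h \<otimes> g) Y)"
        using Ad_mult[of h "inv h \<otimes> g" Y] gc h(1) by simp
      also have "\<dots> \<in> Q" using S(3)[OF U(2)] U(1) by (simp add: psi_phi)
      finally show "g \<in> {g \<in> topspace (topo G). Ad G g Y \<in> Q}" using gc by (simp add: topspace_topo)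
    qed
    ultimately show "\<exists>T. openin (topo G) T \<and> h \<in> T \<and> T \<subseteq> {g \<in> topspace (topo G). Ad G g Y \<in> Q}"
      by blast
  qed
qed simp

section \<open>The bracket\<close>

lemma bracket_linear_left: "linear (\<lambda>X. bracket G X Y)"
  using bracket_has_derivative has_derivative_linear by blast

lemma bracket_eqI:
  assumes "((\<lambda>v. f v) has_derivative f') (at e0)" "\<And>v. v \<in> V0 \<Longrightarrow> f v = Ad G (\<psi> v) Y"
  shows "bracket G X Y = f' X"
proof -
  have "((\<lambda>v. Ad G (\<psi> v) Y) has_derivative f') (at e0)"
    by (rule has_derivative_transform_nhds[OF assms(1)])
      (use assms(2) open_V0 id_coord(1) in \<open>auto simp: eventually_nhds\<close>)
  from has_derivative_unique[OF bracket_has_derivative this] show ?thesis by metis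
qed

lemma bracket_linear_right: "linear (\<lambda>Y. bracket G X Y)"
proof (rule linearI)
  show "bracket G X (Y + Z) = bracket G X Y + bracket G X Z" for Y Z
    by (rule bracket_eqI[OF has_derivative_add[OF bracket_has_derivative[of Y] bracket_has_derivative[of Z]]])
      (simp add: linear_add[OF Ad_linear] psi_carrier)
  show "bracket G X (c *\<^sub>R Y) = c *\<^sub>R bracket G X Y" for c Y
    by (rule bracket_eqI[OF has_derivative_scaleR_right[OF bracket_has_derivative[of Y]]])
      (simp add: linear_scale[OF Ad_linear] psi_carrier)
qed

lemma bracket_bilinear: "bilinear (bracket G)"
  using bracket_linear_left bracket_linear_right by (simp add: bilinear_def)

lemma bracket_bounded_bilinear: "bounded_bilinear (bracket G)"
  using bracket_bilinear bilinear_conv_bounded_bilinear by blast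

lemmas bracket_add_left = linear_add[OF bracket_linear_left]
  and bracket_add_right = linear_add[OF bracket_linear_right]
  and bracket_diff_left = linear_diff[OF bracket_linear_left]
  and bracket_diff_right = linear_diff[OF bracket_linear_right]
  and bracket_scale_left = linear_scale[OF bracket_linear_left]
  and bracket_scale_right = linear_scale[OF bracket_linear_right]
  and bracket_zero_left = linear_0[OF bracket_linear_left]
  and bracket_zero_right = linear_0[OF bracket_linear_right]
  and bracket_neg_left = linear_neg[OF bracket_linear_left]
  and bracket_neg_right = linear_neg[OF bracket_linear_right]

section \<open>The adjoint representation along one-parameter subgroups\<close>

lemma Ad_Exp_derivative_0: "((\<lambda>t. Ad G (Exp (t *\<^sub>R X)) Y) has_vector_derivative bracket G X Y) (at 0)"
proof (rule has_vector_derivative_transform_nhds)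
  show "((\<lambda>t. Ad G (\<psi> (\<phi> (Exp (t *\<^sub>R X)))) Y) has_vector_derivative bracket G X Y) (at 0)"
    by (rule has_vector_derivative_compose[OF Exp_derivative])
      (use bracket_has_derivative[of Y] in \<open>simp add: id_coord(3)\<close>)
  show "eventually (\<lambda>t. Ad G (\<psi> (\<phi> (Exp (t *\<^sub>R X)))) Y = Ad G (Exp (t *\<^sub>R X)) Y) (nhds 0)"
    by (rule eventually_mono[OF Exp_eventually_U0[of X]]) (simp add: psi_phi)
qed

lemma Ad_Exp_derivative:
  "((\<lambda>t. Ad G (Exp (t *\<^sub>R X)) Y) has_vector_derivative bracket G X (Ad G (Exp (t *\<^sub>R X)) Y)) (at t)"
proof (rule has_vector_derivative_shift)
  have "(\<lambda>h. Ad G (Exp ((t + h) *\<^sub>R X)) Y) = (\<lambda>h. Ad G (Exp (h *\<^sub>R X)) (Ad G (Exp (t *\<^sub>R X)) Y))"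
    using Exp_add[of _ t X] by (simp add: Ad_mult[symmetric] add.commute)
  then show "((\<lambda>h. Ad G (Exp ((t + h) *\<^sub>R X)) Y) has_vector_derivative
      bracket G X (Ad G (Exp (t *\<^sub>R X)) Y)) (at 0)"
    using Ad_Exp_derivative_0 by simp
qed

lemma Ad_Exp_derivative':
  "((\<lambda>t. Ad G (Exp (t *\<^sub>R X)) Y) has_vector_derivative Ad G (Exp (t *\<^sub>R X)) (bracket G X Y)) (at t)"
proof (rule has_vector_derivative_shift)
  have eq: "(\<lambda>h. Ad G (Exp ((t + h) *\<^sub>R X)) Y) = (\<lambda>h. Ad G (Exp (t *\<^sub>R X)) (Ad G (Exp (h *\<^sub>R X)) Y))"
    using Exp_add[of t _ X] by (simp add: Ad_mult[symmetric])
  have "bounded_linear (Ad G (Exp (t *\<^sub>R X)))"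
    by (simp add: Ad_bounded_linear)
  then show "((\<lambda>h. Ad G (Exp ((t + h) *\<^sub>R X)) Y) has_vector_derivative
      Ad G (Exp (t *\<^sub>R X)) (bracket G X Y)) (at 0)"
    unfolding eq by (rule bounded_linear.has_vector_derivative[OF _ Ad_Exp_derivative_0])
qed

text \<open>After multiplication by exp(-ct) the curve has derivative zero.\<close>

lemma Ad_Exp_eigenvector:
  assumes "bracket G X Y = c *\<^sub>R Y"
  shows "Ad G (Exp (t *\<^sub>R X)) Y = exp (c * t) *\<^sub>R Y"
proof -
  define f where "f = (\<lambda>t. exp (- c * t) *\<^sub>R Ad G (Exp (t *\<^sub>R X)) Y)"
  have "(f has_vector_derivative 0) (at s within UNIV)" for s
  proof -
    have "((\<lambda>t. exp (- c * t)) has_real_derivative - c * exp (- c * s)) (at s)"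
      by (auto intro!: derivative_eq_intros)
    from has_vector_derivative_scaleR[OF this Ad_Exp_derivative'[of X Y s]]
    show ?thesis
      unfolding f_def using assms by (simp add: linear_scale[OF Ad_linear] mult.commute)
  qed
  then have "f t = f 0"
    using has_vector_derivative_zero_constant[of UNIV f] by (metis UNIV_I convex_UNIV)
  then have "exp (- c * t) *\<^sub>R Ad G (Exp (t *\<^sub>R X)) Y = Y" by (simp add: f_def Ad_one)
  then have "exp (c * t) *\<^sub>R (exp (- c * t) *\<^sub>R Ad G (Exp (t *\<^sub>R X)) Y) = exp (c * t) *\<^sub>R Y" by simp
  then show ?thesis by (simp add: exp_add[symmetric])
qed

lemma Ad_Exp_fixed: "bracket G X Y = 0 \<Longrightarrow> Ad G (Exp X) Y = Y"
  using Ad_Exp_eigenvector[of X Y 0 1] by simp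

text \<open>The identity Ad(g) Ad(exp(tX)) = Ad(exp(t Ad(g) X)) Ad(g), differentiated at t =
  0.\<close>

lemma Ad_bracket:
  assumes g: "g \<in> carrier G"
  shows "Ad G g (bracket G X Y) = bracket G (Ad G g X) (Ad G g Y)"
proof -
  have eq: "Ad G g (Ad G (Exp (t *\<^sub>R X)) Y) = Ad G (Exp (t *\<^sub>R Ad G g X)) (Ad G g Y)" for t
  proof -
    have "Exp (t *\<^sub>R Ad G g X) = g \<otimes> Exp (t *\<^sub>R X) \<otimes> inv g"
      using Exp_conj[OF g, of "t *\<^sub>R X"] by (simp add: linear_scale[OF Ad_linear[OF g]])
    then have "Exp (t *\<^sub>R Ad G g X) \<otimes> g = g \<otimes> Exp (t *\<^sub>R X)"
      using g by (simp add: m_assoc)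
    then show ?thesis using g by (simp add: Ad_mult[symmetric])
  qed
  from bounded_linear.has_vector_derivative[OF Ad_bounded_linear[OF g] Ad_Exp_derivative_0]
  have "((\<lambda>t. Ad G g (Ad G (Exp (t *\<^sub>R X)) Y)) has_vector_derivative Ad G g (bracket G X Y)) (at 0)" .
  then show ?thesis
    unfolding eq using Ad_Exp_derivative_0 vector_derivative_unique_at by blast
qed

text \<open>The elements exp(tX) commute with each other, so Ad(exp(tX)) X does not depend on t; the
  bracket is its derivative.\<close>

lemma bracket_self: "bracket G X X = 0"
proof -
  have "Ad G (Exp (t *\<^sub>R X)) X = X" for t
  proof (rule Exp_line_inject)
    fix s
    have "Exp (t *\<^sub>R X) \<otimes> Exp (s *\<^sub>R X) = Exp (s *\<^sub>R X) \<otimes> Exp (t *\<^sub>R X)"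
      by (metis Exp_add add.commute)
    then have "Exp (t *\<^sub>R X) \<otimes> Exp (s *\<^sub>R X) \<otimes> inv Exp (t *\<^sub>R X) = Exp (s *\<^sub>R X)"
      by (simp add: m_assoc)
    then show "Exp (s *\<^sub>R Ad G (Exp (t *\<^sub>R X)) X) = Exp (s *\<^sub>R X)"
      using Exp_conj[of "Exp (t *\<^sub>R X)" "s *\<^sub>R X"] by (simp add: linear_scale[OF Ad_linear])
  qed
  then have "((\<lambda>t. X) has_vector_derivative bracket G X X) (at (0::real))"
    using Ad_Exp_derivative_0[of X X] by simp
  then show ?thesis using has_vector_derivative_const vector_derivative_unique_at by blast
qed

lemma bracket_antisym: "bracket G X Y = - bracket G Y X"
proof -
  have "bracket G X Y + bracket G Y X = 0"
    using bracket_self[of "X + Y"] bracket_self[of X] bracket_self[of Y]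
    by (simp add: bracket_add_left bracket_add_right add.commute)
  then show ?thesis by (simp add: eq_neg_iff_add_eq_0)
qed

text \<open>\<open>Ad_bracket\<close> along exp(tX), differentiated at t = 0.\<close>

lemma jacobi: "bracket G X (bracket G Y Z) = bracket G (bracket G X Y) Z + bracket G Y (bracket G X Z)"
proof -
  have eq: "Ad G (Exp (t *\<^sub>R X)) (bracket G Y Z) =
      bracket G (Ad G (Exp (t *\<^sub>R X)) Y) (Ad G (Exp (t *\<^sub>R X)) Z)" for t
    by (rule Ad_bracket) simp
  have "((\<lambda>t. bracket G (Ad G (Exp (t *\<^sub>R X)) Y) (Ad G (Exp (t *\<^sub>R X)) Z)) has_vector_derivative
      (bracket G (Ad G (Exp (0 *\<^sub>R X)) Y) (bracket G X Z) + bracket G (bracket G X Y) (Ad G (Exp (0 *\<^sub>R X)) Z))) (at 0)"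
    by (rule bounded_bilinear.has_vector_derivative[OF bracket_bounded_bilinear Ad_Exp_derivative_0 Ad_Exp_derivative_0])
  then have "((\<lambda>t. Ad G (Exp (t *\<^sub>R X)) (bracket G Y Z)) has_vector_derivative
      (bracket G Y (bracket G X Z) + bracket G (bracket G X Y) Z)) (at 0)"
    by (simp add: eq Ad_one)
  then show ?thesis
    using Ad_Exp_derivative_0[of X "bracket G Y Z"] vector_derivative_unique_at by (metis add.commute)
qed

text \<open>By \<open>Ad_Exp_fixed\<close> the two one-parameter subgroups commute, so their product
  is one as well. Its velocity is X + Y because the differential of the multiplication at the
  identity is addition.\<close>

lemma Exp_add_commuting:
  assumes "bracket G X Y = 0"
  shows "Exp (X + Y) = Exp X \<otimes> Exp Y"
proof -
  have comm: "Exp (s *\<^sub>R X) \<otimes> Exp (t *\<^sub>R Y) = Exp (t *\<^sub>R Y) \<otimes> Exp (s *\<^sub>R X)" for s t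
  proof -
    have "Ad G (Exp (s *\<^sub>R X)) (t *\<^sub>R Y) = t *\<^sub>R Y"
      by (rule Ad_Exp_fixed) (simp add: bracket_scale_left bracket_scale_right assms)
    then have "Exp (s *\<^sub>R X) \<otimes> Exp (t *\<^sub>R Y) \<otimes> inv Exp (s *\<^sub>R X) = Exp (t *\<^sub>R Y)"
      using Exp_conj[of "Exp (s *\<^sub>R X)" "t *\<^sub>R Y"] by simp
    then show ?thesis by (metis Exp_carrier inv_solve_right' m_closed)
  qed
  let ?\<gamma> = "\<lambda>t. Exp (t *\<^sub>R X) \<otimes> Exp (t *\<^sub>R Y)"
  have "continuous_map euclideanreal (topo G) ?\<gamma>"
    by (intro continuous_map_mult continuous_Exp_line)
  moreover have "?\<gamma> (s + t) = ?\<gamma> s \<otimes> ?\<gamma> t" for s t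
  proof -
    have "?\<gamma> s \<otimes> ?\<gamma> t = Exp (s *\<^sub>R X) \<otimes> (Exp (s *\<^sub>R Y) \<otimes> Exp (t *\<^sub>R X)) \<otimes> Exp (t *\<^sub>R Y)"
      by (simp add: m_assoc)
    also have "\<dots> = (Exp (s *\<^sub>R X) \<otimes> Exp (t *\<^sub>R X)) \<otimes> (Exp (s *\<^sub>R Y) \<otimes> Exp (t *\<^sub>R Y))"
      unfolding comm[of t s, symmetric] by (simp add: m_assoc)
    finally show ?thesis by (simp add: Exp_add)
  qed
  moreover have "((\<lambda>t. \<phi> (?\<gamma> t)) has_vector_derivative X + Y) (at 0)"
  proof (rule has_vector_derivative_transform_nhds)
    have e: "(e0, e0) \<in> D0" by (rule D0_e0(1)[OF id_coord(1)])
    have "((\<lambda>t. (\<phi> (Exp (t *\<^sub>R X)), \<phi> (Exp (t *\<^sub>R Y)))) has_vector_derivative (X, Y)) (at 0)"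
      by (intro has_vector_derivative_Pair Exp_derivative)
    then have "((\<lambda>t. M0 (\<phi> (Exp (t *\<^sub>R X)), \<phi> (Exp (t *\<^sub>R Y)))) has_vector_derivative dM (e0, e0) (X, Y)) (at 0)"
      by (rule has_vector_derivative_compose) (use M0_derivative[OF e] in \<open>simp add: id_coord(3)\<close>)
    moreover have "dM (e0, e0) (X, Y) = X + Y"
    proof -
      have "((\<lambda>z. z) has_derivative (\<lambda>q. dM (e0, e0) (q, 0))) (at e0)"
        by (rule has_derivative_transform_nhds[OF M0_derivative_fst[OF e]])
          (use open_V0 id_coord(1) M0_e0 in \<open>auto simp: eventually_nhds intro!: exI[of _ V0]\<close>)
      then have "(\<lambda>q. dM (e0, e0) (q, 0)) = (\<lambda>q. q)"
        using has_derivative_ident has_derivative_unique by blast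
      then have "dM (e0, e0) (X, 0) = X" by metis
      moreover have "dM (e0, e0) (0, Y) = Y" using left_field_e0 by (simp add: left_field_def)
      moreover have "dM (e0, e0) ((X, 0) + (0, Y)) = dM (e0, e0) (X, 0) + dM (e0, e0) (0, Y)"
        by (rule linear_add[OF dM_linear[OF e]])
      ultimately show ?thesis by simp
    qed
    ultimately show "((\<lambda>t. M0 (\<phi> (Exp (t *\<^sub>R X)), \<phi> (Exp (t *\<^sub>R Y)))) has_vector_derivative X + Y) (at 0)" by simp
    show "eventually (\<lambda>t. M0 (\<phi> (Exp (t *\<^sub>R X)), \<phi> (Exp (t *\<^sub>R Y))) = \<phi> (?\<gamma> t)) (nhds 0)"
      using Exp_eventually_U0[of X] Exp_eventually_U0[of Y] by eventually_elim (simp add: M0_apply psi_phi)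
  qed
  ultimately have "one_parameter_subgroup G (X + Y) ?\<gamma>"
    unfolding one_parameter_subgroup_def by blast
  from Exp_unique[OF this, of 1] show ?thesis by simp
qed

text \<open>In orthonormal coordinates of an abelian subspace \<open>Exp\<close> is a product of
  one-parameter subgroups. This takes the place of continuous dependence of solutions on the vector
  field.\<close>

lemma continuous_Exp_abelian:
  assumes "abelian_subspace G S"
  shows "continuous_map (top_of_set S) (topo G) Exp"
proof -
  have S: "subspace S" and ab: "\<And>X Y. X \<in> S \<Longrightarrow> Y \<in> S \<Longrightarrow> bracket G X Y = 0"
    using assms by (auto simp: abelian_subspace_def)
  obtain B where B: "B \<subseteq> S" "pairwise orthogonal B" "\<And>x. x \<in> B \<Longrightarrow> norm x = 1" "independent B" "span B = S"
    using orthonormal_basis_subspace[OF S] by metis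
  then have finB: "finite B" using independent_imp_finite by blast
  have "continuous_map (top_of_set S) (topo G) (\<lambda>X. Exp (\<Sum>b\<in>F. (X \<bullet> b) *\<^sub>R b))" if "F \<subseteq> B" for F
    using finite_subset[OF that finB] that
  proof (induction F rule: finite_induct)
    case empty
    then show ?case by (simp add: topspace_topo)
  next
    case (insert b F)
    have "continuous_map (top_of_set S) euclideanreal (\<lambda>X. X \<bullet> b)"
      by (auto intro!: continuous_intros)
    from continuous_map_compose[OF this continuous_Exp_line]
    have 1: "continuous_map (top_of_set S) (topo G) (\<lambda>X. Exp ((X \<bullet> b) *\<^sub>R b))" by (simp add: o_def)
    have "Exp (\<Sum>c\<in>insert b F. (X \<bullet> c) *\<^sub>R c) = Exp ((X \<bullet> b) *\<^sub>R b) \<otimes> Exp (\<Sum>c\<in>F. (X \<bullet> c) *\<^sub>R c)" for X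
    proof -
      have "(\<Sum>c\<in>F. (X \<bullet> c) *\<^sub>R c) \<in> S" "(X \<bullet> b) *\<^sub>R b \<in> S"
        using insert.prems B(1) S by (auto intro!: subspace_sum subspace_scale)
      then show ?thesis
        using insert.hyps Exp_add_commuting[OF ab] by simp
    qed
    then show ?case
      using continuous_map_mult[OF 1 insert.IH] insert.prems by simp
  qed
  from this[OF order_refl] show ?thesis
  proof (rule continuous_map_eq)
    fix X assume "X \<in> topspace (top_of_set S)"
    then have X: "X \<in> span B" using B by simp
    have "(\<Sum>b\<in>B. (X \<bullet> b) *\<^sub>R b) = X"
      using X
    proof (induction rule: span_induct_alt)
      case (step c x y)
      have "(\<Sum>b\<in>B. (x \<bullet> b) *\<^sub>R b) = (\<Sum>b\<in>B. if b = x then x else 0)"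
      proof (rule sum.cong)
        fix b assume b: "b \<in> B"
        show "(x \<bullet> b) *\<^sub>R b = (if b = x then x else 0)"
          using b step.hyps B(2,3) by (auto simp: pairwise_def orthogonal_def dot_square_norm)
      qed simp
      also have "\<dots> = x" using finB step.hyps by simp
      finally show ?case
        using step.IH by (simp add: inner_add_left scaleR_add_left sum.distrib scaleR_sum_right[symmetric]
            scaleR_scaleR[symmetric] del: scaleR_scaleR)
    qed simp
    then show "Exp (\<Sum>b\<in>B. (X \<bullet> b) *\<^sub>R b) = Exp X" by simp
  qed
qed

text \<open>Gronwall: with k = |X| K the curve \<open>c\<close> has norm at most exp(k) |v| on
  [0, 1], so its velocity [X, c] has norm at most k exp(k) |v|, which bounds the displacement in
  unit time.\<close>

lemma Ad_Exp_near_identity: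
  assumes K: "\<And>X Y. norm (bracket G X Y) \<le> norm X * norm Y * K" "K \<ge> 0"
  shows "norm (Ad G (Exp X) v - v) \<le> norm X * K * exp (norm X * K) * norm v"
proof -
  define k where "k = norm X * K"
  define c where "c = (\<lambda>t. Ad G (Exp (t *\<^sub>R X)) v)"
  have c': "(c has_vector_derivative bracket G X (c t)) (at t)" for t
    unfolding c_def by (rule Ad_Exp_derivative)
  have k0: "k \<ge> 0" using K by (simp add: k_def)
  have ble: "norm (bracket G X (c t)) \<le> k * norm (c t)" for t
    using K(1)[of X "c t"] by (simp add: k_def algebra_simps)
  have bound: "norm (c t) \<le> exp k * norm v" if t: "0 \<le> t" "t \<le> 1" for t
  proof -
    have u: "((\<lambda>t. exp (- 2 * k * t) * (c t \<bullet> c t)) has_real_derivative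
        exp (- 2 * k * s) * (- 2 * k * (c s \<bullet> c s) + 2 * (c s \<bullet> bracket G X (c s)))) (at s)" for s
    proof -
      have "((\<lambda>s. c s \<bullet> c s) has_derivative (\<lambda>h. c s \<bullet> (h *\<^sub>R bracket G X (c s)) + (h *\<^sub>R bracket G X (c s)) \<bullet> c s)) (at s)"
        using c'[of s] unfolding has_vector_derivative_def by (intro has_derivative_inner)
      then have d: "((\<lambda>s. c s \<bullet> c s) has_real_derivative 2 * (c s \<bullet> bracket G X (c s))) (at s)"
        unfolding has_field_derivative_def
        by (rule has_derivative_eq_rhs) (auto simp: inner_commute algebra_simps)
      show ?thesis
        by (rule derivative_eq_intros d refl | simp add: algebra_simps)+
    qed
    have "exp (- 2 * k * t) * (c t \<bullet> c t) \<le> exp (- 2 * k * 0) * (c 0 \<bullet> c 0)"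
    proof (rule DERIV_nonpos_imp_nonincreasing[OF t(1)])
      fix s
      have "c s \<bullet> bracket G X (c s) \<le> norm (c s) * (k * norm (c s))"
        using Cauchy_Schwarz_ineq2[of "c s" "bracket G X (c s)"] mult_left_mono[OF ble norm_ge_zero, of "c s" s]
        by linarith
      then have "exp (- 2 * k * s) * (- 2 * k * (c s \<bullet> c s) + 2 * (c s \<bullet> bracket G X (c s))) \<le> 0"
        by (intro mult_nonneg_nonpos) (auto simp: dot_square_norm power2_eq_square algebra_simps)
      then show "\<exists>y. DERIV (\<lambda>t. exp (- 2 * k * t) * (c t \<bullet> c t)) s :> y \<and> y \<le> 0" using u by blast
    qed
    then have "exp (- 2 * k * t) * (norm (c t))\<^sup>2 \<le> (norm v)\<^sup>2"
      by (simp add: c_def Ad_one dot_square_norm)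
    then have "(norm (c t))\<^sup>2 \<le> exp (2 * k * t) * (norm v)\<^sup>2"
      by (simp add: exp_minus field_simps)
    also have "\<dots> \<le> exp (2 * k) * (norm v)\<^sup>2"
      using k0 t by (intro mult_right_mono) (auto simp: mult_left_le)
    also have "\<dots> = (exp k * norm v)\<^sup>2"
      by (simp add: power_mult_distrib exp_double)
    finally show ?thesis by (rule power2_le_imp_le) simp
  qed
  have "norm (c 1 - c 0) \<le> (k * (exp k * norm v)) * norm (1 - 0 :: real)"
  proof (rule differentiable_bound[of "{0..1}"])
    fix t :: real assume t: "t \<in> {0..1}"
    show "(c has_derivative (\<lambda>h. h *\<^sub>R bracket G X (c t))) (at t within {0..1})"
      using c'[of t] has_derivative_at_withinI unfolding has_vector_derivative_def by blast
    show "onorm (\<lambda>h. h *\<^sub>R bracket G X (c t)) \<le> k * (exp k * norm v)"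
    proof (rule onorm_le)
      fix h :: real
      have "norm (bracket G X (c t)) \<le> k * (exp k * norm v)"
        using ble[of t] mult_left_mono[OF bound[of t] k0] t by auto
      then show "norm (h *\<^sub>R bracket G X (c t)) \<le> k * (exp k * norm v) * norm h"
        by (simp add: mult.commute mult_left_mono)
    qed
  qed auto
  then show ?thesis by (simp add: c_def Ad_one k_def algebra_simps)
qed

text \<open>Continuity at 0 in all directions, also outside abelian subspaces; the contraction of
  \<open>nil\<close> to 0 relies on it.\<close>

lemma Ad_Exp_tendsto:
  assumes "(X \<longlongrightarrow> 0) F"
  shows "((\<lambda>s. Ad G (Exp (X s)) v) \<longlongrightarrow> v) F"
proof -
  obtain K where K: "K \<ge> 0" "\<And>X Y. norm (bracket G X Y) \<le> norm X * norm Y * K"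
    using bounded_bilinear.nonneg_bounded[OF bracket_bounded_bilinear] by blast
  have "((\<lambda>s. norm (X s)) \<longlongrightarrow> 0) F" using assms tendsto_norm_zero by blast
  then have "((\<lambda>s. norm (X s) * K * exp (norm (X s) * K) * norm v) \<longlongrightarrow> 0 * K * exp (0 * K) * norm v) F"
    by (intro tendsto_intros)
  then have "((\<lambda>s. norm (X s) * K * exp (norm (X s) * K) * norm v) \<longlongrightarrow> 0) F" by simp
  then have "((\<lambda>s. Ad G (Exp (X s)) v - v) \<longlongrightarrow> 0) F"
    by (rule Lim_null_comparison[rotated]) (simp add: Ad_Exp_near_identity[OF K(2,1)])
  then show ?thesis by (simp add: LIM_zero_iff)
qed

end

section \<open>The Killing form\<close>

context lie_group begin

lemma linear_bracket_bracket: "linear (\<lambda>Z. bracket G X (bracket G Y Z))"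
  using linear_compose[OF bracket_linear_right bracket_linear_right, of X Y] by (simp add: o_def)

lemma killing_bilinear: "bilinear (killing G)"
  unfolding bilinear_def killing_def
  by (auto intro!: linearI simp: bracket_add_left bracket_add_right bracket_scale_left bracket_scale_right
      linear_trace_add linear_trace_scaleR)

lemma killing_sym: "killing G X Y = killing G Y X"
  unfolding killing_def by (rule linear_trace_commute[OF bracket_linear_right bracket_linear_right])

text \<open>An automorphism conjugates ad, and the trace is invariant under conjugation.\<close>

lemma killing_automorphism:
  assumes T: "linear T" "linear T'" "\<And>x. T' (T x) = x" "\<And>x. T (T' x) = x"
    and br: "\<And>X Y. T (bracket G X Y) = bracket G (T X) (T Y)"
  shows "killing G (T X) (T Y) = killing G X Y"
proof -
  have "killing G (T X) (T Y) = linear_trace (\<lambda>Z. T (bracket G X (bracket G Y (T' Z))))"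
    by (simp add: killing_def br T(4))
  also have "\<dots> = linear_trace (\<lambda>Z. bracket G X (bracket G Y (T' (T Z))))"
  proof (rule linear_trace_commute[OF T(1)])
    show "linear (\<lambda>Z. bracket G X (bracket G Y (T' Z)))"
      using linear_compose[OF T(2) linear_bracket_bracket] by (simp add: o_def)
  qed
  finally show ?thesis by (simp add: killing_def T(3))
qed

lemma killing_Ad: "g \<in> carrier G \<Longrightarrow> killing G (Ad G g X) (Ad G g Y) = killing G X Y"
  by (rule killing_automorphism[where T' = "Ad G (inv g)"]) (auto simp: Ad_linear Ad_inv Ad_bracket)

lemma killing_invariant: "killing G (bracket G Z X) Y = - killing G X (bracket G Z Y)"
proof -
  have 1: "bracket G (bracket G U V) W = bracket G U (bracket G V W) - bracket G V (bracket G U W)" for U V W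
    using jacobi[of U V W] by (simp add: algebra_simps)
  have "killing G (bracket G Z X) Y =
      linear_trace (\<lambda>W. bracket G Z (bracket G X (bracket G Y W)))
      - linear_trace (\<lambda>W. bracket G X (bracket G Z (bracket G Y W)))"
    by (simp add: killing_def 1 linear_trace_minus)
  also have "linear_trace (\<lambda>W. bracket G Z (bracket G X (bracket G Y W)))
      = linear_trace (\<lambda>W. bracket G X (bracket G Y (bracket G Z W)))"
    by (rule linear_trace_commute[OF bracket_linear_right linear_bracket_bracket])
  also have "\<dots> - linear_trace (\<lambda>W. bracket G X (bracket G Z (bracket G Y W)))
      = - killing G X (bracket G Z Y)"
    by (simp add: killing_def 1 bracket_diff_right linear_trace_minus)
  finally show ?thesis .
qed

end

section \<open>Cartan decomposition\<close>

text \<open>A Cartan decomposition and a positive system assert the existence of an involution and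
  of a regular element. Both are fixed here, so that \<theta> yields the inner product and
  positivity of a root is the sign of its value at \<open>H0\<close>.\<close>

locale cartan_lie_group = lie_group G
  for G :: "('g, 'e::euclidean_space, 'm) lie_struct_scheme" (structure) +
  fixes K :: "'g set" and \<theta> :: "'e \<Rightarrow> 'e" and \<pp> \<aa> :: "'e set" and H0 :: 'e
  assumes subgroup_K: "subgroup K G"
    and involution: "cartan_involution G \<theta>"
    and lie_K: "lie_subalgebra G K = {X. \<theta> X = X}"
    and pp: "\<pp> = {X. \<theta> X = - X}"
    and max_aa: "maximal_abelian_subspace G \<pp> \<aa>"
    and H0: "H0 \<in> \<aa>"
    and regular: "\<And>\<alpha>. \<alpha> \<in> restricted_roots G \<aa> \<Longrightarrow> \<alpha> H0 \<noteq> 0"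
begin

lemma theta_linear: "linear \<theta>" and theta_theta [simp]: "\<theta> (\<theta> X) = X"
  and theta_bracket: "\<theta> (bracket G X Y) = bracket G (\<theta> X) (\<theta> Y)"
  and theta_pos: "X \<noteq> 0 \<Longrightarrow> - killing G X (\<theta> X) > 0"
  using involution by (auto simp: cartan_involution_def)

lemma killing_theta: "killing G (\<theta> X) (\<theta> Y) = killing G X Y"
  by (rule killing_automorphism[where T' = \<theta>]) (auto simp: theta_linear theta_bracket)

definition form :: "'e \<Rightarrow> 'e \<Rightarrow> real" where
  "form X Y = - killing G X (\<theta> Y)"

lemma killing_linear: "linear (\<lambda>X. killing G X Y)" "linear (\<lambda>Y. killing G X Y)"
  using killing_bilinear by (auto simp: bilinear_def)

sublocale form: inner_product form
proof
  have 1: "linear (\<lambda>Y. killing G X (\<theta> Y))" for X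
    using linear_compose[OF theta_linear killing_linear(2)] by (simp add: o_def)
  show "bilinear form"
    unfolding bilinear_def form_def
    using linear_compose_neg[OF killing_linear(1)] linear_compose_neg[OF 1] by simp
  show "form X Y = form Y X" for X Y
    using killing_theta[of X "\<theta> Y"] killing_sym[of "\<theta> X" Y] by (simp add: form_def)
  show "X \<noteq> 0 \<Longrightarrow> form X X > 0" for X
    using theta_pos by (simp add: form_def)
qed

section \<open>The action of \<open>K\<close> on the Cartan decomposition\<close>

lemma K_carrier: "k \<in> K \<Longrightarrow> k \<in> carrier G"
  using subgroup_K subgroup.mem_carrier by fast

lemma K_inv: "k \<in> K \<Longrightarrow> inv k \<in> K"
  using subgroup_K subgroup.m_inv_closed by fast

lemma K_mult: "k \<in> K \<Longrightarrow> l \<in> K \<Longrightarrow> k \<otimes> l \<in> K"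
  using subgroup_K subgroup.m_closed by fast

lemma Exp_in_K: "\<theta> X = X \<Longrightarrow> Exp (t *\<^sub>R X) \<in> K"
  using lie_K by (auto simp: lie_subalgebra_def)

lemma Ad_K_fixed:
  assumes k: "k \<in> K" and X: "\<theta> X = X"
  shows "\<theta> (Ad G k X) = Ad G k X"
proof -
  have "Exp (t *\<^sub>R Ad G k X) \<in> K" for t
  proof -
    have "Exp (t *\<^sub>R Ad G k X) = k \<otimes> Exp (t *\<^sub>R X) \<otimes> inv k"
      using Exp_conj[OF K_carrier[OF k], of "t *\<^sub>R X"] by (simp add: linear_scale[OF Ad_linear[OF K_carrier[OF k]]])
    then show ?thesis using K_mult[OF K_mult[OF k Exp_in_K[OF X]] K_inv[OF k]] by simp
  qed
  then show ?thesis using lie_K by (auto simp: lie_subalgebra_def)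
qed

text \<open>\<pp> is Killing orthogonal to Lie(K), which \<open>K\<close> preserves. Here
  \<open>Z\<close> is twice the \<theta>-fixed part of \<open>Ad G k X\<close>; carried back by
  \<open>inv k\<close> it is orthogonal to \<open>X\<close>. This gives B(Z, Z) = 0, while B is
  negative definite on fixed vectors.\<close>

lemma Ad_K_negated:
  assumes k: "k \<in> K" and X: "\<theta> X = - X"
  shows "\<theta> (Ad G k X) = - Ad G k X"
proof -
  have kc: "k \<in> carrier G" by (rule K_carrier[OF k])
  define Y where "Y = Ad G k X"
  define Z where "Z = Y + \<theta> Y"
  have Z: "\<theta> Z = Z" by (simp add: Z_def linear_add[OF theta_linear] add.commute)
  define W where "W = Ad G (inv k) Z"
  have W: "\<theta> W = W" unfolding W_def by (rule Ad_K_fixed[OF K_inv[OF k] Z])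
  have "killing G X W = 0"
    using killing_theta[of X W] by (simp add: W X linear_neg[OF killing_linear(1)])
  moreover have "killing G X W = killing G Y Z"
    using killing_Ad[OF kc, of X W] by (simp add: W_def Y_def Ad_inv kc)
  moreover have "killing G (\<theta> Y) Z = killing G Y Z" using killing_theta[of Y Z] by (simp add: Z)
  ultimately have "killing G Z Z = 0"
    using linear_add[OF killing_linear(1), of Y "\<theta> Y" Z] by (simp add: Z_def)
  then have "Z = 0" using form.eq_0_iff[of Z] by (simp add: form_def Z)
  then show ?thesis by (simp add: Z_def Y_def eq_neg_iff_add_eq_0 add.commute)
qed

lemma Ad_K_theta:
  assumes k: "k \<in> K"
  shows "\<theta> (Ad G k X) = Ad G k (\<theta> X)"
proof -
  have lin: "linear (Ad G k)" by (rule Ad_linear[OF K_carrier[OF k]])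
  have "\<theta> (Ad G k (X + \<theta> X)) = Ad G k (X + \<theta> X)"
    by (rule Ad_K_fixed[OF k]) (simp add: linear_add[OF theta_linear] add.commute)
  then have 1: "\<theta> (Ad G k X) + \<theta> (Ad G k (\<theta> X)) = Ad G k X + Ad G k (\<theta> X)"
    by (simp only: linear_add[OF lin] linear_add[OF theta_linear])
  have "\<theta> (Ad G k (X - \<theta> X)) = - Ad G k (X - \<theta> X)"
    by (rule Ad_K_negated[OF k]) (simp add: linear_diff[OF theta_linear])
  then have 2: "\<theta> (Ad G k X) - \<theta> (Ad G k (\<theta> X)) = - (Ad G k X - Ad G k (\<theta> X))"
    by (simp only: linear_diff[OF lin] linear_diff[OF theta_linear])
  have "\<theta> (Ad G k X) + \<theta> (Ad G k X) = (\<theta> (Ad G k X) + \<theta> (Ad G k (\<theta> X))) + (\<theta> (Ad G k X) - \<theta> (Ad G k (\<theta> X)))"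
    by simp
  also have "\<dots> = Ad G k (\<theta> X) + Ad G k (\<theta> X)" by (simp only: 1 2) simp
  finally have "2 *\<^sub>R \<theta> (Ad G k X) = 2 *\<^sub>R Ad G k (\<theta> X)" by (simp only: scaleR_2)
  then show ?thesis by simp
qed

lemma Ad_K_form:
  assumes k: "k \<in> K"
  shows "form (Ad G k X) (Ad G k Y) = form X Y"
  using killing_Ad[OF K_carrier[OF k]] by (simp add: form_def Ad_K_theta[OF k])

lemma Ad_K_form_left: "k \<in> K \<Longrightarrow> form (Ad G k X) Y = form X (Ad G (inv k) Y)"
  using Ad_K_form[of k X "Ad G (inv k) Y"] by (simp add: Ad_inv K_carrier)

lemma ad_symmetric:
  assumes "H \<in> \<pp>"
  shows "form (bracket G H X) Y = form X (bracket G H Y)"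
proof -
  have "\<theta> (bracket G H Y) = - bracket G H (\<theta> Y)"
    using assms by (simp add: theta_bracket pp bracket_neg_left)
  then show ?thesis
    by (simp add: form_def killing_invariant linear_neg[OF killing_linear(2)])
qed

lemma center_trivial:
  assumes "\<And>Y. bracket G X Y = 0"
  shows "X = 0"
proof -
  have "killing G X (\<theta> X) = 0" by (simp add: killing_def assms linear_trace_def)
  then show ?thesis using form.eq_0_iff[of X] by (simp add: form_def)
qed

lemma form_bounded_bilinear: "bounded_bilinear form"
  by (rule form.bounded_bilin)

text \<open>ad H is symmetric, so applying exp(tH) in one argument and exp(-tH) in the other keeps
  \<open>f\<close> constant. \<open>Y'\<close> is chosen such that f(1) and f(0) are the two
  sides.\<close>

lemma Ad_Exp_symmetric:
  assumes H: "H \<in> \<pp>"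
  shows "form (Ad G (Exp H) X) Y = form X (Ad G (Exp H) Y)"
proof -
  define Y' where "Y' = Ad G (Exp H) Y"
  define f where "f = (\<lambda>t. form (Ad G (Exp (t *\<^sub>R H)) X) (Ad G (Exp (t *\<^sub>R (- H))) Y'))"
  have "(f has_vector_derivative 0) (at t within UNIV)" for t
  proof -
    have "(f has_vector_derivative
        (form (Ad G (Exp (t *\<^sub>R H)) X) (bracket G (- H) (Ad G (Exp (t *\<^sub>R (- H))) Y'))
        + form (bracket G H (Ad G (Exp (t *\<^sub>R H)) X)) (Ad G (Exp (t *\<^sub>R (- H))) Y'))) (at t)"
      unfolding f_def
      by (rule bounded_bilinear.has_vector_derivative[OF form_bounded_bilinear Ad_Exp_derivative Ad_Exp_derivative])
    then show ?thesis
      by (simp add: ad_symmetric[OF H] bracket_neg_left form.neg_right)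
  qed
  then obtain c where "\<And>t. f t = c"
    using has_vector_derivative_zero_constant[of UNIV f] by auto
  then have "f 1 = f 0" by metis
  then show ?thesis
    by (simp add: f_def Ad_one Y'_def Exp_neg Ad_inv)
qed

text \<open>ad X and ad H are symmetric with the same exponential, hence equal, and the Lie algebra
  has no center. Only the operators \<open>Ad\<close> are compared, so this is injectivity of
  \<open>Exp\<close> on \<pp> even modulo the kernel of \<open>Ad\<close>.\<close>

lemma Exp_pp_inject:
  assumes X: "X \<in> \<pp>" and H: "H \<in> \<pp>" and eq: "\<And>v. Ad G (Exp X) v = Ad G (Exp H) v"
  shows "X = H"
proof -
  have "bracket G X Y = bracket G H Y" for Y
  proof (rule form.symmetric_log_unique[where S = "bracket G X" and T = "bracket G H" and E = "Ad G (Exp X)"])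
    show "bracket G X x = l *\<^sub>R x \<Longrightarrow> Ad G (Exp X) x = exp l *\<^sub>R x" for x l
      using Ad_Exp_eigenvector[of X x l 1] by simp
    show "bracket G H x = l *\<^sub>R x \<Longrightarrow> Ad G (Exp X) x = exp l *\<^sub>R x" for x l
      using Ad_Exp_eigenvector[of H x l 1] eq by simp
  qed (simp_all add: bracket_linear_right ad_symmetric X H Ad_Exp_symmetric)
  then have "X - H = 0" by - (rule center_trivial, simp add: bracket_diff_left)
  then show ?thesis by simp
qed

lemma pp_scale: "X \<in> \<pp> \<Longrightarrow> c *\<^sub>R X \<in> \<pp>"
  by (simp add: pp linear_scale[OF theta_linear])

text \<open>Let P = Ad(exp X) and Q = Ad(exp H), which are symmetric, while Ad(k) is orthogonal.
  Multiplying P = Q Ad(k) by its transpose gives P P = Q Q, that is Ad(exp(2X)) = Ad(exp(2H)), and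
  \<open>Exp_pp_inject\<close> applies.\<close>

lemma Exp_polar_unique:
  assumes X: "X \<in> \<pp>" and H: "H \<in> \<pp>" and k: "k \<in> K" and eq: "Exp X = Exp H \<otimes> k"
  shows "X = H"
proof -
  let ?P = "Ad G (Exp X)" and ?Q = "Ad G (Exp H)" and ?P' = "Ad G (inv Exp X)" and ?Q' = "Ad G (inv Exp H)"
  have mH: "- H \<in> \<pp>" using pp_scale[OF H, of "-1"] by simp
  have "k = inv Exp H \<otimes> Exp X"
    using K_carrier[OF k] by (simp add: eq m_assoc[symmetric])
  then have Adk: "Ad G k v = ?Q' (?P v)" for v by (simp add: Ad_mult)
  have "?P (?Q' (?Q' (?P v))) = v" for v
  proof -
    have "form (?P (?Q' (?Q' (?P v))) - v) w = 0" for w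
      using Ad_K_form[OF k, of v w] Ad_Exp_symmetric[OF X, of "?Q' (?Q' (?P v))" w]
        Ad_Exp_symmetric[OF mH, of "?Q' (?P v)" "?P w"]
      by (simp add: Adk Exp_neg form.diff_left)
    then show ?thesis using form.eq_0_iff by (metis right_minus_eq)
  qed
  then have PQ: "?P (?Q' (?Q' w)) = ?P' w" for w
    by (metis Ad_inv(2) Exp_carrier)
  have "?P (?P v) = ?Q (?Q v)" for v
  proof -
    have "?P v = ?P' (?Q (?Q v))" using PQ[of "?Q (?Q v)"] by (simp add: Ad_inv)
    then show ?thesis by (simp add: Ad_inv)
  qed
  moreover have "Exp (2 *\<^sub>R Z) = Exp Z \<otimes> Exp Z" for Z using Exp_add[of 1 1 Z] by simp
  ultimately have "Ad G (Exp (2 *\<^sub>R X)) v = Ad G (Exp (2 *\<^sub>R H)) v" for v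
    by (simp add: Ad_mult)
  then have "2 *\<^sub>R X = 2 *\<^sub>R H" by (rule Exp_pp_inject[OF pp_scale[OF X] pp_scale[OF H]])
  then show ?thesis by simp
qed

section \<open>The group \<open>A\<close>, its normalizer and its centralizer\<close>

abbreviation "A \<equiv> split_torus G \<aa>"
abbreviation "T \<equiv> normalizer_in G K A"
abbreviation "M \<equiv> centralizer_in G K A"

lemma aa_abelian: "abelian_subspace G \<aa>" and aa_subspace: "subspace \<aa>" and aa_pp: "H \<in> \<aa> \<Longrightarrow> H \<in> \<pp>"
  and aa_commute: "H \<in> \<aa> \<Longrightarrow> H' \<in> \<aa> \<Longrightarrow> bracket G H H' = 0"
  using max_aa by (auto simp: maximal_abelian_subspace_def abelian_subspace_def)

lemma pp_subspace: "subspace \<pp>"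
  by (auto simp: pp subspace_def linear_0[OF theta_linear] linear_add[OF theta_linear] linear_scale[OF theta_linear])

text \<open>Together with \<aa> such an \<open>X\<close> spans an abelian subspace of \<pp>, to
  which maximality applies.\<close>

lemma aa_maximal:
  assumes X: "X \<in> \<pp>" and comm: "\<And>H. H \<in> \<aa> \<Longrightarrow> bracket G H X = 0"
  shows "X \<in> \<aa>"
proof -
  let ?b = "span (insert X \<aa>)"
  have comm': "bracket G X H = 0" if "H \<in> \<aa>" for H
    using comm[OF that] bracket_antisym[of X H] by simp
  have decomp: "\<exists>c H. H \<in> \<aa> \<and> Y = H + c *\<^sub>R X" if Y: "Y \<in> ?b" for Y
  proof -
    obtain c where "Y - c *\<^sub>R X \<in> span \<aa>" using Y unfolding span_breakdown_eq by blast
    then have "Y - c *\<^sub>R X \<in> \<aa>" using aa_subspace by (simp add: span_eq_iff[THEN iffD2])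
    then show ?thesis by (metis diff_add_cancel)
  qed
  have "abelian_subspace G ?b"
    unfolding abelian_subspace_def
  proof (intro conjI ballI)
    fix Y Z assume "Y \<in> ?b" "Z \<in> ?b"
    then obtain c H d H' where "H \<in> \<aa>" "Y = H + c *\<^sub>R X" "H' \<in> \<aa>" "Z = H' + d *\<^sub>R X"
      using decomp by metis
    then show "bracket G Y Z = 0"
      by (simp add: bracket_add_left bracket_add_right bracket_scale_left bracket_scale_right
          comm comm' aa_commute bracket_self)
  qed (rule subspace_span)
  moreover have "?b \<subseteq> \<pp>"
    by (rule span_minimal[OF _ pp_subspace]) (use X aa_pp in blast)
  moreover have "\<aa> \<subseteq> ?b" using span_superset by blast
  ultimately have "?b = \<aa>" using max_aa by (simp add: maximal_abelian_subspace_def)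
  then show ?thesis by (metis insertI1 span_base)
qed

lemma A_carrier: "a \<in> A \<Longrightarrow> a \<in> carrier G"
  by (auto simp: split_torus_def)

lemma Exp_aa_add: "H \<in> \<aa> \<Longrightarrow> H' \<in> \<aa> \<Longrightarrow> Exp (H + H') = Exp H \<otimes> Exp H'"
  by (rule Exp_add_commuting[OF aa_commute])

lemma Ad_K_pp: "k \<in> K \<Longrightarrow> X \<in> \<pp> \<Longrightarrow> Ad G k X \<in> \<pp>"
  using Ad_K_negated by (simp add: pp)

lemma Ad_K_aa_mem:
  assumes k: "k \<in> K" and H: "H \<in> \<aa>" and mem: "k \<otimes> Exp H \<otimes> inv k \<in> A"
  shows "Ad G k H \<in> \<aa>"
proof -
  obtain H' where H': "H' \<in> \<aa>" "Exp (Ad G k H) = Exp H'"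
    using mem unfolding Exp_conj[OF K_carrier[OF k]] split_torus_def by (rule imageE)
  then have "Ad G k H = H'" by (intro Exp_pp_inject[OF Ad_K_pp[OF k aa_pp[OF H]] aa_pp]) simp_all
  then show ?thesis using H' by simp
qed

lemma Ad_aa_image:
  assumes k: "k \<in> K" and sub: "\<And>H. H \<in> \<aa> \<Longrightarrow> Ad G k H \<in> \<aa>"
  shows "Ad G k ` \<aa> = \<aa>"
proof -
  have kc: "k \<in> carrier G" by (rule K_carrier[OF k])
  have inj: "inj_on (Ad G k) (span \<aa>)"
    by (rule inj_on_inverseI[where g = "Ad G (inv k)"]) (simp add: Ad_inv kc)
  have "subspace (Ad G k ` \<aa>)" by (rule linear_subspace_image[OF Ad_linear[OF kc] aa_subspace])
  moreover have "dim (Ad G k ` \<aa>) = dim \<aa>" by (rule dim_image_eq[OF Ad_linear[OF kc] inj])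
  ultimately show ?thesis using sub aa_subspace by (intro subspace_dim_equal) auto
qed

text \<open>Trades conjugation of the group \<open>A\<close> for the linear action on \<aa>; this
  rests on the injectivity of \<open>Exp\<close> on \<pp>.\<close>

lemma T_iff: "k \<in> T \<longleftrightarrow> k \<in> K \<and> (\<forall>H\<in>\<aa>. Ad G k H \<in> \<aa>)"
proof
  assume k: "k \<in> T"
  then have kK: "k \<in> K" and "\<And>a. a \<in> A \<Longrightarrow> k \<otimes> a \<otimes> inv k \<in> A"
    by (auto simp: normalizer_in_def)
  then show "k \<in> K \<and> (\<forall>H\<in>\<aa>. Ad G k H \<in> \<aa>)"
    using Ad_K_aa_mem by (auto simp: split_torus_def)
next
  assume k: "k \<in> K \<and> (\<forall>H\<in>\<aa>. Ad G k H \<in> \<aa>)"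
  then have im: "Ad G k ` \<aa> = \<aa>" using Ad_aa_image by blast
  have "(\<lambda>a. k \<otimes> a \<otimes> inv k) ` A = Exp ` (Ad G k ` \<aa>)"
    using k Exp_conj[OF K_carrier] by (auto simp: split_torus_def image_image)
  then show "k \<in> T" using k im by (simp add: normalizer_in_def split_torus_def)
qed

lemma T_K: "t \<in> T \<Longrightarrow> t \<in> K" and T_aa: "t \<in> T \<Longrightarrow> H \<in> \<aa> \<Longrightarrow> Ad G t H \<in> \<aa>"
  by (auto simp: T_iff)

lemma T_carrier: "t \<in> T \<Longrightarrow> t \<in> carrier G"
  by (rule K_carrier[OF T_K])

lemma T_one: "\<one> \<in> T"
  using subgroup.one_closed[OF subgroup_K] by (simp add: T_iff Ad_one)

lemma T_mult: "s \<in> T \<Longrightarrow> t \<in> T \<Longrightarrow> s \<otimes> t \<in> T"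
  by (simp add: T_iff K_mult Ad_mult K_carrier)

lemma T_inv:
  assumes t: "t \<in> T"
  shows "inv t \<in> T"
proof -
  have im: "Ad G t ` \<aa> = \<aa>" using Ad_aa_image t by (simp add: T_iff)
  have "Ad G (inv t) H \<in> \<aa>" if "H \<in> \<aa>" for H
  proof -
    obtain H' where "H' \<in> \<aa>" "H = Ad G t H'" using im \<open>H \<in> \<aa>\<close> by blast
    then show ?thesis using Ad_inv(1)[OF T_carrier[OF t]] by simp
  qed
  then show ?thesis using t K_inv by (simp add: T_iff)
qed

lemma M_fixes:
  assumes "m \<in> M" "H \<in> \<aa>"
  shows "Ad G m H = H"
proof -
  have m: "m \<in> K" "m \<otimes> Exp H = Exp H \<otimes> m"
    using assms by (auto simp: centralizer_in_def split_torus_def)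
  have mc: "m \<in> carrier G" by (rule K_carrier[OF m(1)])
  have "m \<otimes> Exp H \<otimes> inv m = Exp H" using mc by (simp add: m(2) m_assoc)
  then have "Exp (Ad G m H) = Exp H" by (simp add: Exp_conj[OF mc])
  then show ?thesis 
    by (intro Exp_pp_inject[OF Ad_K_pp[OF m(1) aa_pp[OF assms(2)]] aa_pp[OF assms(2)]]) simp
qed

lemma M_T: "m \<in> M \<Longrightarrow> m \<in> T"
  using M_fixes by (simp add: T_iff) (simp add: centralizer_in_def)

section \<open>Restricted roots\<close>

text \<open>Roots are represented by the vectors of \<open>\<aa>\<close> dual to them with respect to the form.\<close>

definition rs :: "'e \<Rightarrow> 'e set" where
  "rs h = {X. \<forall>H\<in>\<aa>. bracket G H X = form h H *\<^sub>R X}"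

definition \<Delta> :: "'e set" where
  "\<Delta> = {h \<in> \<aa>. h \<noteq> 0 \<and> rs h \<noteq> {0}}"

definition pos_roots :: "'e set" where
  "pos_roots = {h \<in> \<Delta>. form h H0 > 0}"

lemma rs_subspace: "subspace (rs h)"
  by (auto simp: rs_def subspace_def bracket_zero_right bracket_add_right bracket_scale_right scaleR_add_right)

lemma rs_bracket: "H \<in> \<aa> \<Longrightarrow> X \<in> rs h \<Longrightarrow> bracket G H X = form h H *\<^sub>R X"
  by (simp add: rs_def)

text \<open>ad(h - h') is symmetric, and its eigenvalues on the two spaces differ by the squared
  length of h - h'.\<close>

lemma rs_orthogonal:
  assumes "h \<in> \<aa>" "h' \<in> \<aa>" "h \<noteq> h'" "X \<in> rs h" "Y \<in> rs h'"
  shows "form X Y = 0"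
proof -
  let ?H = "h - h'"
  have H: "?H \<in> \<aa>" using assms aa_subspace by (simp add: subspace_diff)
  have "form h ?H * form X Y = form h' ?H * form X Y"
    using ad_symmetric[OF aa_pp[OF H], of X Y] rs_bracket[OF H assms(4)] rs_bracket[OF H assms(5)]
    by (simp add: form.scale_left form.scale_right)
  then have "form ?H ?H * form X Y = 0" by (simp add: form.diff_left left_diff_distrib)
  then show ?thesis using form.eq_0_iff[of ?H] assms(3) by simp
qed

lemma rs_add: "X \<in> rs h \<Longrightarrow> Y \<in> rs h' \<Longrightarrow> bracket G X Y \<in> rs (h + h')"
  by (simp add: rs_def jacobi[of _ X Y] bracket_scale_left bracket_scale_right form.add_left scaleR_add_left)

lemma rs_theta:
  assumes "X \<in> rs h"
  shows "\<theta> X \<in> rs (- h)"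
  unfolding rs_def
proof (intro CollectI ballI)
  fix H assume H: "H \<in> \<aa>"
  have "bracket G H (\<theta> X) = \<theta> (bracket G (\<theta> H) X)" by (simp add: theta_bracket)
  also have "\<theta> H = - H" using aa_pp[OF H] by (simp add: pp)
  finally show "bracket G H (\<theta> X) = form (- h) H *\<^sub>R \<theta> X"
    using rs_bracket[OF H assms]
    by (simp add: bracket_neg_left linear_neg[OF theta_linear] linear_scale[OF theta_linear] form.neg_left)
qed

lemma rs_Ad:
  assumes t: "t \<in> T" and X: "X \<in> rs h"
  shows "Ad G t X \<in> rs (Ad G t h)"
  unfolding rs_def
proof (intro CollectI ballI)
  fix H assume H: "H \<in> \<aa>"
  have tc: "t \<in> carrier G" by (rule T_carrier[OF t])
  have "bracket G H (Ad G t X) = Ad G t (bracket G (Ad G (inv t) H) X)"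
    by (simp add: Ad_bracket Ad_inv tc)
  also have "\<dots> = form h (Ad G (inv t) H) *\<^sub>R Ad G t X"
    using rs_bracket[OF T_aa[OF T_inv[OF t] H] X] by (simp add: linear_scale[OF Ad_linear[OF tc]])
  finally show "bracket G H (Ad G t X) = form (Ad G t h) H *\<^sub>R Ad G t X"
    by (simp add: Ad_K_form_left T_K t)
qed

lemma Ad_zero_iff: "g \<in> carrier G \<Longrightarrow> Ad G g X = 0 \<longleftrightarrow> X = 0"
  using Ad_inv(1)[of g X] linear_0[OF Ad_linear, of g] linear_0[OF Ad_linear, of "inv g"] by auto

lemma \<Delta>_Ad:
  assumes t: "t \<in> T" and h: "h \<in> \<Delta>"
  shows "Ad G t h \<in> \<Delta>"
proof -
  obtain X where "X \<in> rs h" "X \<noteq> 0"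
    using h subspace_0[OF rs_subspace, of h] by (auto simp: \<Delta>_def)
  then have "Ad G t X \<in> rs (Ad G t h)" "Ad G t X \<noteq> 0"
    using rs_Ad[OF t] Ad_zero_iff[OF T_carrier[OF t]] by auto
  then show ?thesis using h t T_aa Ad_zero_iff[OF T_carrier[OF t]] by (auto simp: \<Delta>_def)
qed

lemma \<Delta>_aa: "h \<in> \<Delta> \<Longrightarrow> h \<in> \<aa>"
  by (simp add: \<Delta>_def)

text \<open>Nonzero vectors chosen from different root spaces are orthogonal, hence
  independent.\<close>

lemma finite_\<Delta>: "finite \<Delta>"
proof -
  have "\<exists>X. X \<in> rs h \<and> X \<noteq> 0" if "h \<in> \<Delta>" for h
    using that subspace_0[OF rs_subspace, of h] by (auto simp: \<Delta>_def)
  then obtain x where x: "\<And>h. h \<in> \<Delta> \<Longrightarrow> x h \<in> rs h \<and> x h \<noteq> 0" by metis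
  have orth: "form (x h) (x h') = 0" if "h \<in> \<Delta>" "h' \<in> \<Delta>" "h \<noteq> h'" for h h'
    using rs_orthogonal that x \<Delta>_aa by blast
  have "inj_on x \<Delta>"
  proof (rule inj_onI)
    fix h h' assume h: "h \<in> \<Delta>" "h' \<in> \<Delta>" "x h = x h'"
    show "h = h'"
    proof (rule ccontr)
      assume "h \<noteq> h'"
      then have "form (x h) (x h) = 0" using orth[of h h'] h by simp
      then show False using x[OF h(1)] form.eq_0_iff by blast
    qed
  qed
  moreover have "independent (x ` \<Delta>)"
    unfolding dependent_def
  proof
    assume "\<exists>a\<in>x ` \<Delta>. a \<in> span (x ` \<Delta> - {a})"
    then obtain h where h: "h \<in> \<Delta>" "x h \<in> span (x ` \<Delta> - {x h})" by blast
    have "form (x h) (x h) = 0"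
      by (rule linear_eq_0_on_span[OF form.lin_right _ h(2)]) (use orth h(1) in blast)
    then show False using x[OF h(1)] form.eq_0_iff by blast
  qed
  ultimately show ?thesis using independent_imp_finite finite_imageD by blast
qed

text \<open>The eigenvalue is a Rayleigh quotient of ad H at \<open>X\<close>, so it is linear in H
  and has a dual vector in \<aa>.\<close>

lemma common_eigenvector_rs:
  assumes "\<And>H. H \<in> \<aa> \<Longrightarrow> \<exists>l. bracket G H X = l *\<^sub>R X" "X \<noteq> 0"
  shows "\<exists>h\<in>\<aa>. X \<in> rs h"
proof -
  define f where "f = (\<lambda>H. form (bracket G H X) X / form X X)"
  have "linear f"
    unfolding f_def
    by (rule linearI) (simp_all add: bracket_add_left bracket_scale_left form.add_left form.scale_left add_divide_distrib)
  then obtain h where h: "h \<in> \<aa>" "\<And>H. H \<in> \<aa> \<Longrightarrow> f H = form h H"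
    using form.representation_on[OF aa_subspace] by metis
  have "bracket G H X = form h H *\<^sub>R X" if H: "H \<in> \<aa>" for H
  proof -
    obtain l where l: "bracket G H X = l *\<^sub>R X" using assms(1)[OF H] by blast
    then have "f H = l" using assms(2) form.eq_0_iff[of X] by (simp add: f_def form.scale_left)
    then show ?thesis using h(2)[OF H] l by simp
  qed
  then show ?thesis using h(1) by (auto simp: rs_def)
qed

text \<open>The roots span \<aa>: the operators ad H with H in \<aa> commute and are symmetric, so
  their common eigenvectors span the Lie algebra. If every root vanishes on \<open>u\<close>, then
  ad u kills these eigenvectors and \<open>u\<close> is central.\<close>

lemma orthogonal_roots_zero:
  assumes u: "u \<in> \<aa>" and orth: "\<And>h. h \<in> \<Delta> \<Longrightarrow> form h u = 0"
  shows "u = 0"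
proof (rule center_trivial)
  let ?S = "bracket G ` \<aa>"
  have "span {x. \<forall>S\<in>?S. \<exists>l. S x = l *\<^sub>R x} = UNIV"
  proof (rule form.span_common_eigenvectors)
    show "S (S' x) = S' (S x)" if SS: "S \<in> ?S" "S' \<in> ?S" for S S' x
    proof -
      obtain H H' where H: "S = bracket G H" "S' = bracket G H'" "H \<in> \<aa>" "H' \<in> \<aa>"
        using SS by blast
      show ?thesis
        unfolding H(1,2) using jacobi[of H H' x] aa_commute[OF H(3,4)] by (simp add: bracket_zero_left)
    qed
  qed (auto simp: bracket_linear_right ad_symmetric aa_pp)
  moreover have "bracket G u X = 0" if X: "X \<in> {x. \<forall>S\<in>?S. \<exists>l. S x = l *\<^sub>R x}" for X
  proof (cases "X = 0")
    case False
    then obtain h where h: "h \<in> \<aa>" "X \<in> rs h" using common_eigenvector_rs X by auto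
    have "form h u = 0"
    proof (cases "h = 0")
      case False
      then have "h \<in> \<Delta>" using h \<open>X \<noteq> 0\<close> by (auto simp: \<Delta>_def)
      then show ?thesis by (rule orth)
    qed (simp add: form.zero_left)
    then show ?thesis using rs_bracket[OF u h(2)] by simp
  qed (simp add: bracket_zero_right)
  ultimately show "bracket G u Y = 0" for Y
    using linear_eq_0_on_span[OF bracket_linear_right] by blast
qed

text \<open>Passes from a functional to its dual vector;
  \<open>restricted_root_of_root_vector\<close> leads back.\<close>

lemma root_vector_of_restricted_root:
  assumes "\<alpha> \<in> restricted_roots G \<aa>"
  obtains h where "h \<in> \<Delta>" "root_space G \<aa> \<alpha> = rs h" "\<And>H. H \<in> \<aa> \<Longrightarrow> \<alpha> H = form h H"
proof -
  obtain f H1 where f: "linear f" "\<alpha> = restrict f \<aa>" and H1: "H1 \<in> \<aa>" "\<alpha> H1 \<noteq> 0"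
    and ne: "root_space G \<aa> \<alpha> \<noteq> {0}"
    using assms unfolding restricted_roots_def by blast
  obtain h where h: "h \<in> \<aa>" "\<And>H. H \<in> \<aa> \<Longrightarrow> f H = form h H"
    using form.representation_on[OF aa_subspace f(1)] by metis
  have eq: "\<alpha> H = form h H" if "H \<in> \<aa>" for H using that f h by simp
  have rs: "root_space G \<aa> \<alpha> = rs h" by (simp add: root_space_def rs_def eq)
  moreover have "h \<noteq> 0" using H1 eq by (auto simp: form.zero_left)
  ultimately have "h \<in> \<Delta>" using h ne by (simp add: \<Delta>_def)
  then show ?thesis using that rs eq by blast
qed

lemma restricted_root_of_root_vector:
  assumes h: "h \<in> \<Delta>"
  shows "restrict (form h) \<aa> \<in> restricted_roots G \<aa>" "root_space G \<aa> (restrict (form h) \<aa>) = rs h"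
proof -
  show rs: "root_space G \<aa> (restrict (form h) \<aa>) = rs h"
    by (simp add: root_space_def rs_def)
  have "form h h \<noteq> 0" using h form.eq_0_iff by (auto simp: \<Delta>_def)
  then show "restrict (form h) \<aa> \<in> restricted_roots G \<aa>"
    unfolding restricted_roots_def using h rs form.lin_right[of h] by (force simp: \<Delta>_def)
qed

lemma root_regular: "h \<in> \<Delta> \<Longrightarrow> form h H0 \<noteq> 0"
  using regular[OF restricted_root_of_root_vector(1)] H0 by fastforce

lemma nilradical_space:
  "(\<Union>\<alpha>\<in>{\<alpha> \<in> restricted_roots G \<aa>. \<alpha> H0 > 0}. root_space G \<aa> \<alpha>) = (\<Union>h\<in>pos_roots. rs h)"
proof (intro subset_antisym subsetI)
  fix X assume "X \<in> (\<Union>\<alpha>\<in>{\<alpha> \<in> restricted_roots G \<aa>. \<alpha> H0 > 0}. root_space G \<aa> \<alpha>)"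
  then obtain \<alpha> where \<alpha>: "\<alpha> \<in> restricted_roots G \<aa>" "\<alpha> H0 > 0" "X \<in> root_space G \<aa> \<alpha>" by blast
  obtain h where "h \<in> \<Delta>" "root_space G \<aa> \<alpha> = rs h" "\<And>H. H \<in> \<aa> \<Longrightarrow> \<alpha> H = form h H"
    using root_vector_of_restricted_root[OF \<alpha>(1)] by blast
  then show "X \<in> (\<Union>h\<in>pos_roots. rs h)" using \<alpha> H0 by (auto simp: pos_roots_def)
next
  fix X assume "X \<in> (\<Union>h\<in>pos_roots. rs h)"
  then obtain h where "h \<in> \<Delta>" "form h H0 > 0" "X \<in> rs h" by (auto simp: pos_roots_def)
  then show "X \<in> (\<Union>\<alpha>\<in>{\<alpha> \<in> restricted_roots G \<aa>. \<alpha> H0 > 0}. root_space G \<aa> \<alpha>)"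
    using restricted_root_of_root_vector[of h] H0 by (intro UN_I[of "restrict (form h) \<aa>"]) auto
qed

section \<open>Reflections and dominance\<close>

lemma root_form_pos: "h \<in> \<Delta> \<Longrightarrow> form h h > 0"
  by (rule form.pos) (simp add: \<Delta>_def)

text \<open>The reflection is the exponential of a multiple of Y = X + \<theta> X, which lies in
  Lie(K). ad Y kills the kernel of \<alpha> in \<aa> and rotates the plane of \<alpha> and Z = X -
  \<theta> X; half a turn negates \<alpha>.\<close>

lemma weyl_reflection:
  assumes \<alpha>: "\<alpha> \<in> \<Delta>"
  obtains s where "s \<in> T" "\<And>H. H \<in> \<aa> \<Longrightarrow> Ad G s H = H - (2 * form \<alpha> H / form \<alpha> \<alpha>) *\<^sub>R \<alpha>"
proof -
  have \<alpha>a: "\<alpha> \<in> \<aa>" by (rule \<Delta>_aa[OF \<alpha>])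
  obtain X where X: "X \<in> rs \<alpha>" "X \<noteq> 0"
    using \<alpha> subspace_0[OF rs_subspace, of \<alpha>] by (auto simp: \<Delta>_def)
  define Y where "Y = X + \<theta> X"
  define Z where "Z = X - \<theta> X"
  define c where "c = form X X"
  define q where "q = form \<alpha> \<alpha>"
  define W where "W = bracket G X (\<theta> X)"
  have c: "c > 0" unfolding c_def by (rule form.pos[OF X(2)])
  have q: "q > 0" unfolding q_def by (rule root_form_pos[OF \<alpha>])
  have YH: "bracket G Y H = - form \<alpha> H *\<^sub>R Z" if H: "H \<in> \<aa>" for H
  proof -
    have "bracket G H Y = form \<alpha> H *\<^sub>R Z"
      using rs_bracket[OF H X(1)] rs_bracket[OF H rs_theta[OF X(1)]]
      by (simp add: Y_def Z_def bracket_add_right form.neg_left scaleR_diff_right)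
    then show ?thesis using bracket_antisym[of Y H] by simp
  qed
  \<comment> \<open>\<open>W\<close> is negated by \<theta> and commutes with \<aa>, so it lies in
    \<aa> by maximality; its pairings with \<aa> then identify it.\<close>
  have W: "W = - c *\<^sub>R \<alpha>"
  proof -
    have "\<theta> W = - W" using bracket_antisym[of "\<theta> X" X] by (simp add: W_def theta_bracket)
    moreover have "W \<in> rs 0" unfolding W_def using rs_add[OF X(1) rs_theta[OF X(1)]] by simp
    then have "bracket G H W = 0" if "H \<in> \<aa>" for H
      using rs_bracket[OF that] by (simp add: form.zero_left)
    ultimately have Wa: "W \<in> \<aa>" by (intro aa_maximal) (auto simp: pp)
    have "form W H = - c * form \<alpha> H" if H: "H \<in> \<aa>" for H
    proof -
      have "form W H = killing G W H"
        using aa_pp[OF H] by (simp add: form_def pp linear_neg[OF killing_linear(2)])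
      also have "\<dots> = killing G (\<theta> X) (bracket G H X)"
        unfolding W_def killing_invariant bracket_antisym[of X H] by (simp add: linear_neg[OF killing_linear(2)])
      also have "\<dots> = form \<alpha> H * killing G X (\<theta> X)"
        using rs_bracket[OF H X(1)] killing_sym by (simp add: linear_scale[OF killing_linear(2)])
      finally show ?thesis by (simp add: c_def form_def)
    qed
    then have "form (W + c *\<^sub>R \<alpha>) H = 0" if "H \<in> \<aa>" for H
      using that by (simp add: form.add_left form.scale_left)
    moreover have "W + c *\<^sub>R \<alpha> \<in> \<aa>" using Wa \<alpha>a aa_subspace by (simp add: subspace_add subspace_scale)
    ultimately have "W + c *\<^sub>R \<alpha> = 0" using form.eq_0_iff by blast
    then show ?thesis by (simp add: eq_neg_iff_add_eq_0)
  qed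
  have YZ: "bracket G Y Z = (2 * c) *\<^sub>R \<alpha>"
  proof -
    have "bracket G Y Z = - 2 *\<^sub>R W"
      using bracket_antisym[of "\<theta> X" X] bracket_self[of X] bracket_self[of "\<theta> X"]
      by (simp add: Y_def Z_def W_def bracket_add_left bracket_diff_right scaleR_2)
    then show ?thesis by (simp add: W)
  qed
  \<comment> \<open>The angular frequency: -ad Y sends \<alpha> to q Z and Z to -2c \<alpha>, so its
    square is -2cq on their plane.\<close>
  define \<omega> where "\<omega> = sqrt (2 * c * q)"
  have \<omega>: "\<omega> > 0" "\<omega> * \<omega> = 2 * c * q" using c q by (auto simp: \<omega>_def)
  let ?E = "\<lambda>t. Ad G (Exp (t *\<^sub>R (- Y)))"
  \<comment> \<open>F(t) is E(t) applied to the trigonometric formula for E(-t) \<alpha>, where E(t)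
    = Ad(exp(-tY)). That F is constant proves the formula without uniqueness of solutions.\<close>
  define F where "F = (\<lambda>t. cos (\<omega> * t) *\<^sub>R ?E t \<alpha> - ((q / \<omega>) * sin (\<omega> * t)) *\<^sub>R ?E t Z)"
  have "(F has_vector_derivative 0) (at t within UNIV)" for t
  proof -
    have 1: "((\<lambda>t. cos (\<omega> * t)) has_real_derivative - \<omega> * sin (\<omega> * t)) (at t)"
      by (auto intro!: derivative_eq_intros)
    have 2: "((\<lambda>t. (q / \<omega>) * sin (\<omega> * t)) has_real_derivative q * cos (\<omega> * t)) (at t)"
      using \<omega> by (auto intro!: derivative_eq_intros)
    have 3: "((\<lambda>t. ?E t \<alpha>) has_vector_derivative q *\<^sub>R ?E t Z) (at t)"
      using Ad_Exp_derivative'[of "- Y" \<alpha> t] YH[OF \<alpha>a]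
      by (simp add: bracket_neg_left q_def linear_scale[OF Ad_linear])
    have 4: "((\<lambda>t. ?E t Z) has_vector_derivative (- (2 * c)) *\<^sub>R ?E t \<alpha>) (at t)"
      using Ad_Exp_derivative'[of "- Y" Z t] YZ
      by (simp add: bracket_neg_left linear_scale[OF Ad_linear] linear_neg[OF Ad_linear])
    have "(F has_vector_derivative
        (cos (\<omega> * t) *\<^sub>R (q *\<^sub>R ?E t Z) + (- \<omega> * sin (\<omega> * t)) *\<^sub>R ?E t \<alpha>)
        - (((q / \<omega>) * sin (\<omega> * t)) *\<^sub>R ((- (2 * c)) *\<^sub>R ?E t \<alpha>) + (q * cos (\<omega> * t)) *\<^sub>R ?E t Z)) (at t)"
      unfolding F_def
      by (intro has_vector_derivative_diff has_vector_derivative_scaleR 1 2 3 4)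
    moreover have "(q / \<omega>) * sin (\<omega> * t) * (2 * c) = \<omega> * sin (\<omega> * t)"
    proof -
      have "(q / \<omega>) * (2 * c) = \<omega>" using \<omega> by (simp add: field_simps)
      then show ?thesis by (metis mult.assoc mult.commute)
    qed
    ultimately show ?thesis by (simp add: mult.commute)
  qed
  then obtain C where "\<And>t. F t = C"
    using has_vector_derivative_zero_constant[of UNIV F] by auto
  then have "F (pi / \<omega>) = F 0" by metis
  then have E\<alpha>: "?E (pi / \<omega>) \<alpha> = - \<alpha>"
    using \<omega> by (simp add: F_def Ad_one minus_equation_iff)
  define s where "s = Exp ((- (pi / \<omega>)) *\<^sub>R Y)"
  have sE: "Ad G s = ?E (pi / \<omega>)" by (simp add: s_def)
  have sK: "s \<in> K"
    unfolding s_def by (rule Exp_in_K) (simp add: Y_def linear_add[OF theta_linear] add.commute)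
  have refl: "Ad G s H = H - (2 * form \<alpha> H / form \<alpha> \<alpha>) *\<^sub>R \<alpha>" if H: "H \<in> \<aa>" for H
  proof -
    define r where "r = form \<alpha> H / q"
    define H' where "H' = H - r *\<^sub>R \<alpha>"
    have H'a: "H' \<in> \<aa>" using H \<alpha>a aa_subspace by (simp add: H'_def subspace_diff subspace_scale)
    have "form \<alpha> H' = 0" using q by (simp add: H'_def r_def q_def form.diff_right form.scale_right)
    then have "bracket G ((- (pi / \<omega>)) *\<^sub>R Y) H' = 0"
      using YH[OF H'a] by (simp add: bracket_scale_left bracket_neg_left)
    then have sH': "Ad G s H' = H'" unfolding s_def by (rule Ad_Exp_fixed)
    have s\<alpha>: "Ad G s \<alpha> = - \<alpha>" using E\<alpha> sE by simp
    have lin: "linear (Ad G s)" by (rule Ad_linear[OF K_carrier[OF sK]])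
    have "Ad G s (H' + r *\<^sub>R \<alpha>) = H' - r *\<^sub>R \<alpha>"
      by (simp add: linear_add[OF lin] linear_scale[OF lin] sH' s\<alpha>)
    moreover have "H' + r *\<^sub>R \<alpha> = H" by (simp add: H'_def)
    ultimately have "Ad G s H = H' - r *\<^sub>R \<alpha>" by simp
    also have "\<dots> = H - (2 * r) *\<^sub>R \<alpha>"
    proof -
      have "(2 * r) *\<^sub>R \<alpha> = r *\<^sub>R \<alpha> + r *\<^sub>R \<alpha>" by (simp only: mult_2 scaleR_left_distrib)
      then show ?thesis by (simp add: H'_def)
    qed
    finally show ?thesis by (simp add: r_def q_def)
  qed
  have "s \<in> T"
    unfolding T_iff using sK refl \<alpha>a aa_subspace by (simp add: subspace_diff subspace_scale)
  then show ?thesis using that refl by blast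
qed

text \<open>A vector fixed by the reflection in a root is orthogonal to this root, and the roots
  span \<aa>.\<close>

lemma T_fixed_zero:
  assumes u: "u \<in> \<aa>" and fixed: "\<And>t. t \<in> T \<Longrightarrow> Ad G t u = u"
  shows "u = 0"
proof (rule orthogonal_roots_zero[OF u])
  fix \<alpha> assume \<alpha>: "\<alpha> \<in> \<Delta>"
  obtain s where "s \<in> T" "Ad G s u = u - (2 * form \<alpha> u / form \<alpha> \<alpha>) *\<^sub>R \<alpha>"
    using weyl_reflection[OF \<alpha>] u by metis
  then have "(2 * form \<alpha> u / form \<alpha> \<alpha>) *\<^sub>R \<alpha> = 0" using fixed by (metis diff_eq_eq add_cancel_right_right)
  then show "form \<alpha> u = 0" using root_form_pos[OF \<alpha>] \<alpha> by (auto simp: \<Delta>_def)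
qed

text \<open>\<open>T\<close> permutes the finitely many roots. Since they span \<aa> and
  \<open>T\<close> acts by isometries, \<open>Ad G t u\<close> depends only on the permutation
  \<open>p t\<close>.\<close>

lemma finite_T_orbit:
  assumes u: "u \<in> \<aa>"
  shows "finite ((\<lambda>t. Ad G t u) ` T)"
proof -
  define p where "p = (\<lambda>t. restrict (Ad G t) \<Delta>)"
  have "p ` T \<subseteq> \<Delta> \<rightarrow>\<^sub>E \<Delta>" using \<Delta>_Ad by (auto simp: p_def)
  then have fin: "finite (p ` T)" using finite_PiE[OF finite_\<Delta>, of "\<lambda>_. \<Delta>"] finite_\<Delta> finite_subset by blast
  have eq: "Ad G s u = Ad G t u" if s: "s \<in> T" and t: "t \<in> T" and st: "p s = p t" for s t
  proof -
    have "Ad G s u - Ad G t u = 0"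
    proof (rule orthogonal_roots_zero)
      show "Ad G s u - Ad G t u \<in> \<aa>" using T_aa s t u aa_subspace by (simp add: subspace_diff)
      fix h assume h: "h \<in> \<Delta>"
      define h' where "h' = Ad G (inv s) h"
      have h': "h' \<in> \<Delta>" unfolding h'_def by (rule \<Delta>_Ad[OF T_inv[OF s] h])
      have hs: "h = Ad G s h'" by (simp add: h'_def Ad_inv T_carrier s)
      also have ht: "\<dots> = Ad G t h'" using st h' unfolding p_def by (metis restrict_apply')
      finally have "h = Ad G t h'" .
      then show "form h (Ad G s u - Ad G t u) = 0"
        using Ad_K_form[OF T_K[OF s], of h' u] Ad_K_form[OF T_K[OF t], of h' u] hs
        by (simp add: form.diff_right)
    qed
    then show ?thesis by simp
  qed
  define pick where "pick = (\<lambda>r. SOME t. t \<in> T \<and> p t = r)"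
  have "Ad G t u \<in> (\<lambda>r. Ad G (pick r) u) ` p ` T" if t: "t \<in> T" for t
  proof -
    have "pick (p t) \<in> T \<and> p (pick (p t)) = p t"
      unfolding pick_def by (rule someI[where x = t]) (use t in simp)
    then have "Ad G (pick (p t)) u = Ad G t u" using eq t by blast
    then show ?thesis using t by (metis (no_types, lifting) image_eqI)
  qed
  then have "(\<lambda>t. Ad G t u) ` T \<subseteq> (\<lambda>r. Ad G (pick r) u) ` p ` T" by blast
  then show ?thesis using fin finite_subset by blast
qed

text \<open>Take the point of the finite orbit with the largest pairing with \<open>H0\<close>. If a
  positive root were negative on it, the reflection in this root would increase the pairing.\<close>

lemma dominant_translate:
  assumes u: "u \<in> \<aa>"
  obtains t where "t \<in> T" "\<And>\<alpha>. \<alpha> \<in> pos_roots \<Longrightarrow> form \<alpha> (Ad G t u) \<ge> 0"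
proof -
  let ?V = "(\<lambda>v. form v H0) ` (\<lambda>t. Ad G t u) ` T"
  have fin: "finite ?V" by (intro finite_imageI finite_T_orbit u)
  moreover have "?V \<noteq> {}" using T_one by blast
  ultimately have "Max ?V \<in> ?V" by (rule Max_in)
  then obtain t where t: "t \<in> T" "form (Ad G t u) H0 = Max ?V" by auto
  have max: "form (Ad G s u) H0 \<le> form (Ad G t u) H0" if "s \<in> T" for s
    unfolding t(2) using that by (intro Max_ge fin) blast
  have "form \<alpha> (Ad G t u) \<ge> 0" if \<alpha>: "\<alpha> \<in> pos_roots" for \<alpha>
  proof -
    let ?v = "Ad G t u"
    have \<alpha>\<Delta>: "\<alpha> \<in> \<Delta>" and pos: "form \<alpha> H0 > 0" using \<alpha> by (auto simp: pos_roots_def)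
    obtain s where s: "s \<in> T" "\<And>H. H \<in> \<aa> \<Longrightarrow> Ad G s H = H - (2 * form \<alpha> H / form \<alpha> \<alpha>) *\<^sub>R \<alpha>"
      using weyl_reflection[OF \<alpha>\<Delta>] by blast
    have "form (Ad G (s \<otimes> t) u) H0 \<le> form ?v H0" by (rule max[OF T_mult[OF s(1) t(1)]])
    then have "0 \<le> (2 * form \<alpha> ?v / form \<alpha> \<alpha>) * form \<alpha> H0"
      using s(2)[OF T_aa[OF t(1) u]]
      by (simp add: Ad_mult T_carrier s(1) t(1) form.diff_left form.scale_left)
    then show ?thesis
      using pos root_form_pos[OF \<alpha>\<Delta>] by (simp add: zero_le_divide_iff zero_le_mult_iff)
  qed
  then show ?thesis using that t(1) by blast
qed

text \<open>The condition makes every positive root space centralize the space of \<beta>. A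
  reducible root system can have several such roots, hence a set.\<close>

definition highest_roots :: "'e set" where
  "highest_roots = {\<beta> \<in> pos_roots. \<forall>\<alpha>\<in>pos_roots. \<beta> + \<alpha> \<notin> \<Delta>}"

text \<open>Among the positive roots whose value at \<open>v\<close> is at least that of \<alpha>,
  take one with the largest value at \<open>H0\<close>. Adding a positive root keeps the first
  property, as \<open>v\<close> is dominant, and would increase the value at
  \<open>H0\<close>.\<close>

lemma highest_root_above:
  assumes \<alpha>: "\<alpha> \<in> pos_roots" and dom: "\<And>\<alpha>. \<alpha> \<in> pos_roots \<Longrightarrow> form \<alpha> v \<ge> 0"
  obtains \<beta> where "\<beta> \<in> highest_roots" "form \<beta> v \<ge> form \<alpha> v"
proof -
  let ?C = "{\<gamma> \<in> pos_roots. form \<gamma> v \<ge> form \<alpha> v}"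
  have fin: "finite ?C" using finite_\<Delta> by (auto simp: pos_roots_def)
  moreover have "?C \<noteq> {}" using \<alpha> by blast
  ultimately have "Max ((\<lambda>\<gamma>. form \<gamma> H0) ` ?C) \<in> (\<lambda>\<gamma>. form \<gamma> H0) ` ?C"
    by (intro Max_in) auto
  then obtain \<beta> where \<beta>: "\<beta> \<in> ?C" and max: "Max ((\<lambda>\<gamma>. form \<gamma> H0) ` ?C) = form \<beta> H0"
    by (rule imageE)
  have \<beta>max: "form \<gamma> H0 \<le> form \<beta> H0" if "\<gamma> \<in> ?C" for \<gamma>
    unfolding max[symmetric] using that fin by (intro Max_ge) auto
  have "\<beta> + \<gamma> \<notin> \<Delta>" if \<gamma>: "\<gamma> \<in> pos_roots" for \<gamma>
  proof
    assume "\<beta> + \<gamma> \<in> \<Delta>"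
    then have "\<beta> + \<gamma> \<in> ?C"
      using \<beta> \<gamma> dom[OF \<gamma>] by (simp add: pos_roots_def form.add_left)
    then show False using \<beta>max[of "\<beta> + \<gamma>"] \<gamma> by (simp add: pos_roots_def form.add_left)
  qed
  then have "\<beta> \<in> highest_roots" using \<beta> by (auto simp: highest_roots_def)
  then show ?thesis using that \<beta> by blast
qed

text \<open>The pair records \<beta>, on which the character of \<open>P\<close> depends; the same
  \<gamma> may occur with several \<beta>.\<close>

definition weights :: "('e \<times> 'e) set" where
  "weights = {(Ad G t \<beta>, \<beta>) | t \<beta>. t \<in> T \<and> \<beta> \<in> highest_roots}"

lemma highest_\<Delta>: "\<beta> \<in> highest_roots \<Longrightarrow> \<beta> \<in> \<Delta>"
  by (simp add: highest_roots_def pos_roots_def)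

lemma weights_\<Delta>: "weights \<subseteq> \<Delta> \<times> \<Delta>"
  using \<Delta>_Ad highest_\<Delta> by (auto simp: weights_def)

lemma finite_weights: "finite weights"
  using weights_\<Delta> finite_\<Delta> finite_subset by blast

lemma weights_Ad:
  assumes "t \<in> T" "(\<gamma>, \<beta>) \<in> weights"
  shows "(Ad G t \<gamma>, \<beta>) \<in> weights"
proof -
  obtain s where s: "s \<in> T" "\<gamma> = Ad G s \<beta>" "\<beta> \<in> highest_roots"
    using assms(2) by (auto simp: weights_def)
  then have "Ad G t \<gamma> = Ad G (t \<otimes> s) \<beta>" using assms(1) by (simp add: Ad_mult T_carrier)
  then show ?thesis using T_mult[OF assms(1) s(1)] s(3) by (auto simp: weights_def)
qed

lemma weights_Ad_bij:
  assumes t: "t \<in> T"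
  shows "bij_betw (\<lambda>(\<gamma>, \<beta>). (Ad G t \<gamma>, \<beta>)) weights weights"
proof (rule bij_betw_byWitness[where f' = "\<lambda>(\<gamma>, \<beta>). (Ad G (inv t) \<gamma>, \<beta>)"])
  show "(\<lambda>(\<gamma>, \<beta>). (Ad G t \<gamma>, \<beta>)) ` weights \<subseteq> weights" using weights_Ad[OF t] by auto
  show "(\<lambda>(\<gamma>, \<beta>). (Ad G (inv t) \<gamma>, \<beta>)) ` weights \<subseteq> weights" using weights_Ad[OF T_inv[OF t]] by auto
qed (auto simp: Ad_inv T_carrier t)

text \<open>Move \<open>u\<close> to a dominant vector. The highest roots vanish on it and bound the
  other positive roots from above, so these vanish as well; reflections take care of the negative
  roots.\<close>

lemma weights_separate:
  assumes u: "u \<in> \<aa>" and orth: "\<And>\<gamma> \<beta>. (\<gamma>, \<beta>) \<in> weights \<Longrightarrow> form \<gamma> u = 0"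
  shows "u = 0"
proof -
  obtain t where t: "t \<in> T" and dom: "\<And>\<alpha>. \<alpha> \<in> pos_roots \<Longrightarrow> form \<alpha> (Ad G t u) \<ge> 0"
    using dominant_translate[OF u] by blast
  have zero: "form \<beta> (Ad G t u) = 0" if \<beta>: "\<beta> \<in> highest_roots" for \<beta>
  proof -
    have "(Ad G (inv t) \<beta>, \<beta>) \<in> weights" using T_inv[OF t] \<beta> by (auto simp: weights_def)
    from orth[OF this] show ?thesis
      using Ad_K_form_left[OF T_K[OF T_inv[OF t]], of \<beta> u] by (simp add: T_carrier t)
  qed
  have pos0: "form \<alpha> (Ad G t u) = 0" if \<alpha>: "\<alpha> \<in> pos_roots" for \<alpha>
    using highest_root_above[OF \<alpha> dom] zero dom[OF \<alpha>] by (metis order_antisym)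
  have "Ad G t u = 0"
  proof (rule orthogonal_roots_zero[OF T_aa[OF t u]])
    fix h assume h: "h \<in> \<Delta>"
    show "form h (Ad G t u) = 0"
    proof (cases "form h H0 > 0")
      case True
      then show ?thesis using pos0 h by (simp add: pos_roots_def)
    next
      case False
      obtain s where "s \<in> T" "\<And>H. H \<in> \<aa> \<Longrightarrow> Ad G s H = H - (2 * form h H / form h h) *\<^sub>R h"
        using weyl_reflection[OF h] by blast
      then have "Ad G s h = - h" using root_form_pos[OF h] \<Delta>_aa[OF h] by (simp add: scaleR_2)
      then have "- h \<in> \<Delta>" using \<Delta>_Ad[OF \<open>s \<in> T\<close> h] by simp
      moreover have "form (- h) H0 > 0" using False root_regular[OF h] by (simp add: form.neg_left)
      ultimately show ?thesis using pos0[of "- h"] by (simp add: pos_roots_def form.neg_left)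
    qed
  qed
  then show ?thesis using Ad_zero_iff[OF T_carrier[OF t]] by simp
qed

section \<open>Inverting the weight operator\<close>

definition frame_op :: "'e \<Rightarrow> 'e" where
  "frame_op u = (\<Sum>(\<gamma>, \<beta>)\<in>weights. form \<gamma> u *\<^sub>R \<gamma>)"

lemma frame_op_linear: "linear frame_op"
  unfolding frame_op_def
  by (rule linearI)
    (simp_all add: case_prod_beta form.add_right form.scale_right scaleR_add_left sum.distrib scaleR_sum_right)

lemma sum_weights_aa: "(\<Sum>(\<gamma>, \<beta>)\<in>weights. c \<gamma> \<beta> *\<^sub>R \<gamma>) \<in> \<aa>"
  using weights_\<Delta> \<Delta>_aa aa_subspace by (auto intro!: subspace_sum subspace_scale)

lemma frame_op_aa: "frame_op u \<in> \<aa>"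
  unfolding frame_op_def by (rule sum_weights_aa)

text \<open>The pairing of \<open>frame_op w\<close> with \<open>w\<close> is the sum of the squares
  of the numbers form \<gamma> w, so the kernel in \<aa> is orthogonal to all weights.\<close>

lemma frame_op_inj: "inj_on frame_op \<aa>"
proof (rule inj_onI)
  fix u v assume u: "u \<in> \<aa>" and v: "v \<in> \<aa>" and eq: "frame_op u = frame_op v"
  let ?w = "u - v"
  have "frame_op ?w = 0" using eq by (simp add: linear_diff[OF frame_op_linear])
  then have "form (frame_op ?w) ?w = 0" by (simp add: form.zero_left)
  then have "(\<Sum>p\<in>weights. form (fst p) ?w * form (fst p) ?w) = 0"
    by (simp add: frame_op_def case_prod_beta form.sum_left form.scale_left)
  then have "\<And>p. p \<in> weights \<Longrightarrow> form (fst p) ?w = 0"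
    using finite_weights by (simp add: sum_nonneg_eq_0_iff)
  then have "?w = 0"
    using u v aa_subspace by (intro weights_separate) (auto simp: subspace_diff)
  then show "u = v" by simp
qed

lemma frame_op_image: "frame_op ` \<aa> = \<aa>"
proof (rule subspace_dim_equal)
  show "subspace (frame_op ` \<aa>)" by (rule linear_subspace_image[OF frame_op_linear aa_subspace])
  have "dim (frame_op ` \<aa>) = dim \<aa>"
    by (rule dim_image_eq[OF frame_op_linear]) (use frame_op_inj aa_subspace in \<open>simp add: span_eq_iff[THEN iffD2]\<close>)
  then show "dim \<aa> \<le> dim (frame_op ` \<aa>)" by simp
qed (use frame_op_aa aa_subspace in auto)

lemma sum_weights_Ad:
  assumes t: "t \<in> T"
  shows "Ad G t (\<Sum>(\<gamma>, \<beta>)\<in>weights. c \<gamma> \<beta> *\<^sub>R \<gamma>) = (\<Sum>(\<gamma>, \<beta>)\<in>weights. c (Ad G (inv t) \<gamma>) \<beta> *\<^sub>R \<gamma>)"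
proof -
  have lin: "linear (Ad G t)" by (rule Ad_linear[OF T_carrier[OF t]])
  have "Ad G t (\<Sum>(\<gamma>, \<beta>)\<in>weights. c \<gamma> \<beta> *\<^sub>R \<gamma>) = (\<Sum>(\<gamma>, \<beta>)\<in>weights. c \<gamma> \<beta> *\<^sub>R Ad G t \<gamma>)"
    by (simp add: linear_sum[OF lin] linear_scale[OF lin] case_prod_beta)
  also have "\<dots> = (\<Sum>(\<gamma>, \<beta>)\<in>weights. c (Ad G (inv t) \<gamma>) \<beta> *\<^sub>R \<gamma>)"
    using sum.reindex_bij_betw[OF weights_Ad_bij[OF t], of "\<lambda>(\<gamma>, \<beta>). c (Ad G (inv t) \<gamma>) \<beta> *\<^sub>R \<gamma>"]
    by (simp add: case_prod_beta Ad_inv T_carrier t)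
  finally show ?thesis .
qed

lemma frame_op_Ad:
  assumes t: "t \<in> T"
  shows "frame_op (Ad G t u) = Ad G t (frame_op u)"
  using sum_weights_Ad[OF t, of "\<lambda>\<gamma> \<beta>. form \<gamma> u"] Ad_K_form_left[OF T_K[OF T_inv[OF t]], of _ u]
  by (simp add: frame_op_def T_carrier t)

text \<open>The left inverse is taken linear on the whole space, which makes it continuous there; it
  inverts \<open>frame_op\<close> on \<aa>.\<close>

definition frame_inv :: "'e \<Rightarrow> 'e" where
  "frame_inv = (SOME R. linear R \<and> (\<forall>u\<in>\<aa>. R (frame_op u) = u))"

lemma frame_inv_linear: "linear frame_inv" and frame_inv_op: "u \<in> \<aa> \<Longrightarrow> frame_inv (frame_op u) = u"
proof -
  have "\<exists>R. linear R \<and> (\<forall>u\<in>\<aa>. R (frame_op u) = u)"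
    using linear_exists_left_inverse_on[OF frame_op_linear aa_subspace frame_op_inj] by blast
  from someI_ex[OF this] show "linear frame_inv" "u \<in> \<aa> \<Longrightarrow> frame_inv (frame_op u) = u"
    unfolding frame_inv_def by blast+
qed

lemma frame_inv_aa:
  assumes "v \<in> \<aa>"
  shows "frame_inv v \<in> \<aa>"
proof -
  obtain u where "u \<in> \<aa>" "v = frame_op u" using assms frame_op_image by blast
  then show ?thesis by (simp add: frame_inv_op)
qed

lemma frame_inv_Ad:
  assumes t: "t \<in> T" and v: "v \<in> \<aa>"
  shows "frame_inv (Ad G t v) = Ad G t (frame_inv v)"
proof -
  obtain u where u: "u \<in> \<aa>" "v = frame_op u" using v frame_op_image by blast
  then show ?thesis by (simp add: frame_op_Ad[OF t, symmetric] frame_inv_op T_aa[OF t])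
qed

text \<open>Coefficients that depend on \<beta> alone make the sum invariant under \<open>T\<close>,
  and only 0 is invariant. This is what cancels the character by which \<open>P\<close> acts from
  the right.\<close>

lemma sum_weights_const:
  "(\<Sum>(\<gamma>, \<beta>)\<in>weights. c \<beta> *\<^sub>R \<gamma>) = 0"
  by (rule T_fixed_zero[OF sum_weights_aa]) (simp add: sum_weights_Ad)

end

section \<open>Matrix coefficients of the adjoint representation\<close>

text \<open>The minimum of B(x, x) on the Euclidean unit sphere is positive, which bounds the
  Euclidean norm on the unit sphere of \<open>B\<close>.\<close>

lemma (in inner_product) compact_unit_sphere:
  assumes "subspace V"
  shows "compact {x \<in> V. B x x = 1}"
proof -
  obtain b :: 'a where "b \<in> Basis" using nonempty_Basis by blast
  then have "sphere (0::'a) 1 \<noteq> {}" by (auto intro: exI[of _ b])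
  moreover have "continuous_on (sphere 0 1) (\<lambda>x. B x x)" by (intro continuous_intros)
  ultimately obtain z where z: "z \<in> sphere 0 1" "\<And>y. y \<in> sphere 0 1 \<Longrightarrow> B z z \<le> B y y"
    using continuous_attains_inf[OF compact_sphere, of 0 1 "\<lambda>x. B x x"] by auto
  have zpos: "B z z > 0" using z(1) by (intro pos) auto
  have le: "B z z * (norm x)\<^sup>2 \<le> B x x" for x
  proof (cases "x = 0")
    case False
    have "B z z \<le> B ((1 / norm x) *\<^sub>R x) ((1 / norm x) *\<^sub>R x)" by (rule z(2)) (use False in simp)
    then show ?thesis using False by (simp add: scale_left scale_right field_simps power2_eq_square)
  qed (simp add: zero_left)
  have "bounded {x \<in> V. B x x = 1}"
    unfolding bounded_iff
  proof (intro exI ballI)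
    fix x assume "x \<in> {x \<in> V. B x x = 1}"
    then have "(norm x)\<^sup>2 \<le> 1 / B z z" using le[of x] zpos by (simp add: field_simps)
    then show "norm x \<le> sqrt (1 / B z z)" by (simp add: real_le_rsqrt)
  qed
  moreover have "closed {x \<in> V. B x x = 1}"
  proof -
    have "closed {x. B x x = 1}" by (intro closed_Collect_eq continuous_intros)
    moreover have "{x \<in> V. B x x = 1} = V \<inter> {x. B x x = 1}" by blast
    ultimately show ?thesis using closed_subspace[OF assms] by (simp add: closed_Int)
  qed
  ultimately show ?thesis by (simp add: compact_eq_bounded_closed)
qed

context cartan_lie_group begin

definition usphere :: "'e \<Rightarrow> 'e set" where
  "usphere h = {X \<in> rs h. form X X = 1}"

text \<open>The operator norm with respect to \<open>form\<close> of a component of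
  \<open>Ad G g\<close>; written as a supremum over pairs of unit vectors it needs no projections.
  For roots \<gamma> and \<beta> the supremum is over a nonempty bounded set.\<close>

definition coeff :: "'e \<Rightarrow> 'e \<Rightarrow> 'g \<Rightarrow> real" where
  "coeff \<gamma> \<beta> g = Sup ((\<lambda>(X, Y). form (Ad G g X) Y) ` (usphere \<beta> \<times> usphere \<gamma>))"

lemma usphere_nonempty:
  assumes "h \<in> \<Delta>"
  shows "usphere h \<noteq> {}"
proof -
  obtain X where X: "X \<in> rs h" "X \<noteq> 0"
    using assms subspace_0[OF rs_subspace, of h] by (auto simp: \<Delta>_def)
  have "form X X > 0" by (rule form.pos[OF X(2)])
  then have "(1 / sqrt (form X X)) *\<^sub>R X \<in> usphere h"
    using X rs_subspace by (simp add: usphere_def subspace_scale form.scale_left form.scale_right)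
  then show ?thesis by blast
qed

lemma usphere_Ad:
  assumes t: "t \<in> T" and X: "X \<in> usphere h"
  shows "Ad G t X \<in> usphere (Ad G t h)"
  using rs_Ad[OF t] X by (simp add: usphere_def Ad_K_form[OF T_K[OF t]])

lemma compact_usphere: "compact (usphere h)"
  unfolding usphere_def by (rule form.compact_unit_sphere[OF rs_subspace])

lemma coeff_bdd:
  assumes g: "g \<in> carrier G"
  shows "bdd_above ((\<lambda>(X, Y). form (Ad G g X) Y) ` (usphere \<beta> \<times> usphere \<gamma>))"
proof -
  have "continuous_on (usphere \<beta> \<times> usphere \<gamma>) (\<lambda>p. form (Ad G g (fst p)) (snd p))"
    by (intro form.continuous_on_form bounded_linear.continuous_on[OF Ad_bounded_linear[OF g]] continuous_intros)
  then have "compact ((\<lambda>p. form (Ad G g (fst p)) (snd p)) ` (usphere \<beta> \<times> usphere \<gamma>))"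
    by (intro compact_continuous_image compact_Times compact_usphere)
  then show ?thesis
    by (simp add: case_prod_beta bounded_imp_bdd_above compact_imp_bounded)
qed

lemma coeff_upper:
  assumes "g \<in> carrier G" "X \<in> usphere \<beta>" "Y \<in> usphere \<gamma>"
  shows "form (Ad G g X) Y \<le> coeff \<gamma> \<beta> g"
  unfolding coeff_def by (rule cSup_upper[OF _ coeff_bdd[OF assms(1)]], rule image_eqI[of _ _ "(X, Y)"]) (use assms in simp_all)

lemma coeff_least:
  assumes "\<beta> \<in> \<Delta>" "\<gamma> \<in> \<Delta>" "\<And>X Y. X \<in> usphere \<beta> \<Longrightarrow> Y \<in> usphere \<gamma> \<Longrightarrow> form (Ad G g X) Y \<le> c"
  shows "coeff \<gamma> \<beta> g \<le> c"
proof -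
  have "(\<lambda>(X, Y). form (Ad G g X) Y) ` (usphere \<beta> \<times> usphere \<gamma>) \<noteq> {}"
    using usphere_nonempty[OF assms(1)] usphere_nonempty[OF assms(2)] by simp
  then show ?thesis
    unfolding coeff_def by (rule cSup_least) (use assms(3) in \<open>elim imageE, clarsimp\<close>)
qed

text \<open>Source of all transformation rules of \<open>coeff\<close>: each of them is an equality
  because this bound applies to a translation and to its inverse.\<close>

lemma coeff_compare:
  assumes "\<beta> \<in> \<Delta>" "\<gamma> \<in> \<Delta>" "h \<in> carrier G" "c > 0"
    and "\<And>X Y. X \<in> usphere \<beta> \<Longrightarrow> Y \<in> usphere \<gamma> \<Longrightarrow>
      \<exists>X'\<in>usphere \<beta>'. \<exists>Y'\<in>usphere \<gamma>'. form (Ad G g X) Y = c * form (Ad G h X') Y'"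
  shows "coeff \<gamma> \<beta> g \<le> c * coeff \<gamma>' \<beta>' h"
proof (rule coeff_least[OF assms(1,2)])
  fix X Y assume "X \<in> usphere \<beta>" "Y \<in> usphere \<gamma>"
  then obtain X' Y' where "X' \<in> usphere \<beta>'" "Y' \<in> usphere \<gamma>'" "form (Ad G g X) Y = c * form (Ad G h X') Y'"
    using assms(5) by blast
  then show "form (Ad G g X) Y \<le> c * coeff \<gamma>' \<beta>' h"
    using coeff_upper[OF assms(3)] assms(4) by simp
qed

lemma coeff_left_T_le:
  assumes "\<beta> \<in> \<Delta>" "\<gamma> \<in> \<Delta>" "t \<in> T" "g \<in> carrier G"
  shows "coeff (Ad G t \<gamma>) \<beta> (t \<otimes> g) \<le> coeff \<gamma> \<beta> g"
proof -
  have "coeff (Ad G t \<gamma>) \<beta> (t \<otimes> g) \<le> 1 * coeff \<gamma> \<beta> g"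
  proof (rule coeff_compare[OF assms(1) \<Delta>_Ad[OF assms(3,2)] assms(4)])
    fix X Y assume XY: "X \<in> usphere \<beta>" "Y \<in> usphere (Ad G t \<gamma>)"
    have "Ad G (inv t) Y \<in> usphere \<gamma>"
      using usphere_Ad[OF T_inv[OF assms(3)] XY(2)] by (simp add: Ad_inv T_carrier assms(3))
    moreover have "form (Ad G (t \<otimes> g) X) Y = 1 * form (Ad G g X) (Ad G (inv t) Y)"
      using assms by (simp add: Ad_mult T_carrier Ad_K_form_left T_K)
    ultimately show "\<exists>X'\<in>usphere \<beta>. \<exists>Y'\<in>usphere \<gamma>. form (Ad G (t \<otimes> g) X) Y = 1 * form (Ad G g X') Y'"
      using XY(1) by blast
  qed simp
  then show ?thesis by simp
qed

lemma coeff_left_T: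
  assumes "\<beta> \<in> \<Delta>" "\<gamma> \<in> \<Delta>" "t \<in> T" "g \<in> carrier G"
  shows "coeff (Ad G t \<gamma>) \<beta> (t \<otimes> g) = coeff \<gamma> \<beta> g"
proof (rule order_antisym[OF coeff_left_T_le[OF assms]])
  have tc: "t \<in> carrier G" by (rule T_carrier[OF assms(3)])
  have "inv t \<otimes> (t \<otimes> g) = g" using assms(4) tc by (simp add: m_assoc[symmetric])
  then show "coeff \<gamma> \<beta> g \<le> coeff (Ad G t \<gamma>) \<beta> (t \<otimes> g)"
    using coeff_left_T_le[OF assms(1) \<Delta>_Ad[OF assms(3,2)] T_inv[OF assms(3)], of "t \<otimes> g"] assms(4) tc
    by (simp add: Ad_inv)
qed

lemma coeff_left_A_le:
  assumes "\<beta> \<in> \<Delta>" "\<gamma> \<in> \<Delta>" "H \<in> \<aa>" "g \<in> carrier G"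
  shows "coeff \<gamma> \<beta> (Exp H \<otimes> g) \<le> exp (form \<gamma> H) * coeff \<gamma> \<beta> g"
proof (rule coeff_compare[OF assms(1,2,4)])
  fix X Y assume XY: "X \<in> usphere \<beta>" "Y \<in> usphere \<gamma>"
  have "Ad G (Exp H) Y = exp (form \<gamma> H) *\<^sub>R Y"
    using Ad_Exp_eigenvector[of H Y "form \<gamma> H" 1] rs_bracket[OF assms(3)] XY(2) by (simp add: usphere_def)
  then have "form (Ad G (Exp H \<otimes> g) X) Y = exp (form \<gamma> H) * form (Ad G g X) Y"
    using assms by (simp add: Ad_mult Ad_Exp_symmetric[OF aa_pp[OF assms(3)]] form.scale_right)
  then show "\<exists>X'\<in>usphere \<beta>. \<exists>Y'\<in>usphere \<gamma>. form (Ad G (Exp H \<otimes> g) X) Y = exp (form \<gamma> H) * form (Ad G g X') Y'"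
    using XY by blast
qed simp

lemma coeff_left_A:
  assumes "\<beta> \<in> \<Delta>" "\<gamma> \<in> \<Delta>" "H \<in> \<aa>" "g \<in> carrier G"
  shows "coeff \<gamma> \<beta> (Exp H \<otimes> g) = exp (form \<gamma> H) * coeff \<gamma> \<beta> g"
proof (rule order_antisym[OF coeff_left_A_le[OF assms]])
  have mH: "- H \<in> \<aa>" using assms(3) aa_subspace subspace_neg by blast
  have "Exp (- H) \<otimes> (Exp H \<otimes> g) = g" using assms(4) by (simp add: Exp_neg m_assoc[symmetric])
  then have "coeff \<gamma> \<beta> g \<le> exp (form \<gamma> (- H)) * coeff \<gamma> \<beta> (Exp H \<otimes> g)"
    using coeff_left_A_le[OF assms(1,2) mH, of "Exp H \<otimes> g"] assms(4) by simp
  then show "exp (form \<gamma> H) * coeff \<gamma> \<beta> g \<le> coeff \<gamma> \<beta> (Exp H \<otimes> g)"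
    by (simp add: form.neg_right exp_minus field_simps)
qed

section \<open>Matrix coefficients and the parabolic subgroup\<close>

definition nil :: "'e set" where
  "nil = span (\<Union>h\<in>pos_roots. rs h)"

definition para :: "'g set" where
  "para = {m \<otimes> Exp H \<otimes> Exp Z | m H Z. m \<in> M \<and> H \<in> \<aa> \<and> Z \<in> nil}"

text \<open>Brackets land in the space of \<alpha> + \<beta>, which is zero: this vector is positive
  at \<open>H0\<close>, hence nonzero, but it is no root.\<close>

lemma nil_centralizes_highest:
  assumes \<beta>: "\<beta> \<in> highest_roots" and X: "X \<in> rs \<beta>" and Z: "Z \<in> nil"
  shows "bracket G Z X = 0"
proof (rule linear_eq_0_on_span[OF bracket_linear_left _ Z[unfolded nil_def]])
  fix Y assume "Y \<in> (\<Union>h\<in>pos_roots. rs h)"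
  then obtain \<alpha> where \<alpha>: "\<alpha> \<in> pos_roots" "Y \<in> rs \<alpha>" by blast
  have "\<beta> + \<alpha> \<notin> \<Delta>" using \<alpha> \<beta> by (simp add: highest_roots_def)
  moreover have "form (\<beta> + \<alpha>) H0 > 0"
    using \<alpha> \<beta> by (simp add: highest_roots_def pos_roots_def form.add_left)
  then have "\<beta> + \<alpha> \<noteq> 0" by (auto simp: form.zero_left)
  moreover have "\<beta> + \<alpha> \<in> \<aa>"
    using \<alpha> \<beta> aa_subspace by (simp add: highest_roots_def pos_roots_def \<Delta>_def subspace_add)
  ultimately have "rs (\<beta> + \<alpha>) = {0}" by (simp add: \<Delta>_def)
  then show "bracket G Y X = 0" using rs_add[OF \<alpha>(2) X] by (simp add: add.commute)
qed

text \<open>On the root space of \<beta>, Exp Z acts trivially, Exp H by a scalar and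
  \<open>m\<close> by an isometry.\<close>

lemma Ad_para_highest:
  assumes \<beta>: "\<beta> \<in> highest_roots" and m: "m \<in> M" and H: "H \<in> \<aa>" and Z: "Z \<in> nil" and X: "X \<in> usphere \<beta>"
  shows "Ad G (m \<otimes> Exp H \<otimes> Exp Z) X = exp (form \<beta> H) *\<^sub>R Ad G m X" "Ad G m X \<in> usphere \<beta>"
proof -
  have Xr: "X \<in> rs \<beta>" using X by (simp add: usphere_def)
  have mc: "m \<in> carrier G" by (rule T_carrier[OF M_T[OF m]])
  have 1: "Ad G (Exp Z) X = X" by (rule Ad_Exp_fixed[OF nil_centralizes_highest[OF \<beta> Xr Z]])
  have 2: "Ad G (Exp H) X = exp (form \<beta> H) *\<^sub>R X"
    using Ad_Exp_eigenvector[of H X "form \<beta> H" 1] rs_bracket[OF H Xr] by simp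
  show "Ad G (m \<otimes> Exp H \<otimes> Exp Z) X = exp (form \<beta> H) *\<^sub>R Ad G m X"
    using mc by (simp add: Ad_mult 1 2 linear_scale[OF Ad_linear])
  show "Ad G m X \<in> usphere \<beta>"
    using usphere_Ad[OF M_T[OF m] X] M_fixes[OF m \<Delta>_aa[OF highest_\<Delta>[OF \<beta>]]] by simp
qed

lemma M_inv: "m \<in> M \<Longrightarrow> inv m \<in> M"
proof -
  assume m: "m \<in> M"
  have mc: "m \<in> carrier G" by (rule T_carrier[OF M_T[OF m]])
  have "inv m \<otimes> a = a \<otimes> inv m" if a: "a \<in> A" for a
  proof -
    have ac: "a \<in> carrier G" by (rule A_carrier[OF a])
    have "m \<otimes> a = a \<otimes> m" using m a by (simp add: centralizer_in_def)
    then have "inv m \<otimes> (m \<otimes> a) \<otimes> inv m = inv m \<otimes> (a \<otimes> m) \<otimes> inv m" by simp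
    moreover have "inv m \<otimes> (m \<otimes> a) \<otimes> inv m = a \<otimes> inv m" using mc ac by (simp add: m_assoc[symmetric])
    moreover have "inv m \<otimes> (a \<otimes> m) \<otimes> inv m = inv m \<otimes> a" using mc ac by (simp add: m_assoc)
    ultimately show ?thesis by simp
  qed
  then show ?thesis using m K_inv by (auto simp: centralizer_in_def)
qed

lemma coeff_right_para:
  assumes \<beta>: "\<beta> \<in> highest_roots" and \<gamma>: "\<gamma> \<in> \<Delta>" and g: "g \<in> carrier G"
    and m: "m \<in> M" and H: "H \<in> \<aa>" and Z: "Z \<in> nil"
  shows "coeff \<gamma> \<beta> (g \<otimes> (m \<otimes> Exp H \<otimes> Exp Z)) = exp (form \<beta> H) * coeff \<gamma> \<beta> g"
proof -
  have \<beta>\<Delta>: "\<beta> \<in> \<Delta>" by (rule highest_\<Delta>[OF \<beta>])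
  have mc: "m \<in> carrier G" by (rule T_carrier[OF M_T[OF m]])
  let ?p = "m \<otimes> Exp H \<otimes> Exp Z"
  have pc: "?p \<in> carrier G" using mc by simp
  have key: "form (Ad G (g \<otimes> ?p) X) Y = exp (form \<beta> H) * form (Ad G g (Ad G m X)) Y"
    if "X \<in> usphere \<beta>" for X Y
    by (simp add: Ad_mult[OF g pc] Ad_para_highest(1)[OF \<beta> m H Z that] linear_scale[OF Ad_linear[OF g]] form.scale_left)
  have "coeff \<gamma> \<beta> (g \<otimes> ?p) \<le> exp (form \<beta> H) * coeff \<gamma> \<beta> g"
    by (rule coeff_compare[OF \<beta>\<Delta> \<gamma> g]) (use key Ad_para_highest(2)[OF \<beta> m H Z] in auto)
  moreover have "coeff \<gamma> \<beta> g \<le> exp (- form \<beta> H) * coeff \<gamma> \<beta> (g \<otimes> ?p)"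
  proof (rule coeff_compare[OF \<beta>\<Delta> \<gamma>])
    fix X Y assume XY: "X \<in> usphere \<beta>" "Y \<in> usphere \<gamma>"
    \<comment> \<open>Undoing \<open>m\<close> beforehand lets \<open>key\<close> be read from right
      to left.\<close>
    have X': "Ad G (inv m) X \<in> usphere \<beta>" by (rule Ad_para_highest(2)[OF \<beta> M_inv[OF m] H Z XY(1)])
    have "form (Ad G g X) Y = exp (- form \<beta> H) * form (Ad G (g \<otimes> ?p) (Ad G (inv m) X)) Y"
      unfolding key[OF X'] by (simp add: Ad_inv mc exp_minus)
    then show "\<exists>X'\<in>usphere \<beta>. \<exists>Y'\<in>usphere \<gamma>. form (Ad G g X) Y = exp (- form \<beta> H) * form (Ad G (g \<otimes> ?p) X') Y'"
      using X' XY(2) by blast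
  qed (use g pc in auto)
  then have "exp (form \<beta> H) * coeff \<gamma> \<beta> g \<le> coeff \<gamma> \<beta> (g \<otimes> ?p)"
    by (simp add: exp_minus field_simps)
  ultimately show ?thesis by simp
qed

text \<open>The flow of \<open>- H0\<close> contracts \<open>nil\<close> to \<open>0\<close> while it does not change the coefficient.\<close>

lemma nil_diagonal_coeff:
  assumes Z: "Z \<in> nil" and h: "h \<in> \<aa>" and X: "X \<in> rs h"
  shows "form (Ad G (Exp Z) X) X = form X X"
proof -
  define a where "a = (\<lambda>s::real. Exp (s *\<^sub>R (- H0)))"
  have ac: "a s \<in> carrier G" for s by (simp add: a_def)
  have mH: "- H0 \<in> \<aa>" using H0 aa_subspace subspace_neg by blast
  have eig: "Ad G (a s) Y = exp (- form k H0 * s) *\<^sub>R Y" if "Y \<in> rs k" for s Y k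
    unfolding a_def using Ad_Exp_eigenvector[OF rs_bracket[OF mH that]] by (simp add: form.neg_right)
  \<comment> \<open>\<open>X\<close> is an eigenvector of the symmetric operator
    \<open>Ad G (a s)\<close>, so the factors arising in the two arguments are inverse to each
    other.\<close>
  have const: "form (Ad G (Exp (Ad G (a s) Z)) X) X = form (Ad G (Exp Z) X) X" for s
  proof -
    have "a s \<otimes> Exp Z \<otimes> inv a s = Exp (Ad G (a s) Z)" by (rule Exp_conj[OF ac])
    then have "Ad G (Exp (Ad G (a s) Z)) X = Ad G (a s) (Ad G (Exp Z) (Ad G (inv a s) X))"
      using ac[of s] by (metis Ad_mult Exp_carrier inv_closed m_closed)
    moreover have "inv a s = a (- s)" by (simp add: a_def Exp_neg[symmetric])
    moreover have "form (Ad G (a s) V) X = form V (Ad G (a s) X)" for V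
      unfolding a_def by (rule Ad_Exp_symmetric[OF pp_scale[OF aa_pp[OF mH]]])
    ultimately show ?thesis
      by (simp add: eig[OF X] linear_scale[OF Ad_linear] form.scale_left form.scale_right exp_add[symmetric])
  qed
  \<comment> \<open>On the space of a positive root \<alpha> the flow is multiplication by
    exp(-\<alpha>(H0) s); sums follow by linearity.\<close>
  have "((\<lambda>s. Ad G (a s) Z) \<longlongrightarrow> 0) at_top"
    using Z[unfolded nil_def]
  proof (induction rule: span_induct_alt)
    case base
    then show ?case by (simp add: linear_0[OF Ad_linear[OF ac]])
  next
    case (step c x y)
    then obtain \<alpha> where \<alpha>: "\<alpha> \<in> pos_roots" "x \<in> rs \<alpha>" by blast
    then have pos: "form \<alpha> H0 > 0" by (simp add: pos_roots_def)
    have "((\<lambda>s. exp (- form \<alpha> H0 * s)) \<longlongrightarrow> 0) at_top"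
      using pos by (intro filterlim_compose[OF exp_at_bot] filterlim_tendsto_neg_mult_at_bot[OF tendsto_const] filterlim_ident) auto
    then have "((\<lambda>s. c *\<^sub>R (exp (- form \<alpha> H0 * s) *\<^sub>R x) + Ad G (a s) y) \<longlongrightarrow> c *\<^sub>R (0 *\<^sub>R x) + 0) at_top"
      by (intro tendsto_intros step)
    then show ?case by (simp add: linear_add[OF Ad_linear[OF ac]] linear_scale[OF Ad_linear[OF ac]] eig[OF \<alpha>(2)])
  qed
  from Ad_Exp_tendsto[OF this, of X]
  have "((\<lambda>s. form (Ad G (Exp (Ad G (a s) Z)) X) X) \<longlongrightarrow> form X X) at_top"
    by (intro bounded_bilinear.tendsto[OF form_bounded_bilinear] tendsto_const)
  then have "((\<lambda>s::real. form (Ad G (Exp Z) X) X) \<longlongrightarrow> form X X) at_top"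
    unfolding const .
  then show ?thesis using tendsto_const tendsto_unique trivial_limit_at_top_linorder by blast
qed

text \<open>The factors \<open>q\<close>, \<open>w\<close> and the inverse of the
  \<open>M\<close>-part of \<open>p\<close> carry the unit vector \<open>X\<close> to a positive
  multiple of the unit vector \<open>X3\<close>. The remaining parts of \<open>inv p\<close> in
  \<open>A\<close> and \<open>N\<close> change the pairing with \<open>X3\<close> only by a positive
  factor, by \<open>nil_diagonal_coeff\<close>.\<close>

lemma coeff_bruhat_pos:
  assumes \<beta>: "\<beta> \<in> highest_roots" and p: "p \<in> para" and q: "q \<in> para" and w: "w \<in> T"
  shows "coeff (Ad G w \<beta>) \<beta> (inv p \<otimes> w \<otimes> q) > 0"
proof -
  obtain m1 H1 Z1 where 1: "p = m1 \<otimes> Exp H1 \<otimes> Exp Z1" "m1 \<in> M" "H1 \<in> \<aa>" "Z1 \<in> nil"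
    using p by (auto simp: para_def)
  obtain m2 H2 Z2 where 2: "q = m2 \<otimes> Exp H2 \<otimes> Exp Z2" "m2 \<in> M" "H2 \<in> \<aa>" "Z2 \<in> nil"
    using q by (auto simp: para_def)
  have mc: "m1 \<in> carrier G" "m2 \<in> carrier G" and wc: "w \<in> carrier G"
    using T_carrier M_T 1 2 w by auto
  have \<beta>\<Delta>: "\<beta> \<in> \<Delta>" by (rule highest_\<Delta>[OF \<beta>])
  define \<gamma> where "\<gamma> = Ad G w \<beta>"
  have \<gamma>: "\<gamma> \<in> \<Delta>" unfolding \<gamma>_def by (rule \<Delta>_Ad[OF w \<beta>\<Delta>])
  obtain X where X: "X \<in> usphere \<beta>" using usphere_nonempty[OF \<beta>\<Delta>] by blast
  define X1 where "X1 = Ad G m2 X"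
  have X1: "X1 \<in> usphere \<beta>" "Ad G q X = exp (form \<beta> H2) *\<^sub>R X1"
    unfolding X1_def 2(1) using Ad_para_highest[OF \<beta> 2(2-4) X] by auto
  define X2 where "X2 = Ad G w X1"
  have X2: "X2 \<in> usphere \<gamma>" unfolding X2_def \<gamma>_def by (rule usphere_Ad[OF w X1(1)])
  define X3 where "X3 = Ad G (inv m1) X2"
  have X3: "X3 \<in> usphere \<gamma>"
    unfolding X3_def using usphere_Ad[OF M_T[OF M_inv[OF 1(2)]] X2] M_fixes[OF M_inv[OF 1(2)] \<Delta>_aa[OF \<gamma>]] by simp
  have X3r: "X3 \<in> rs \<gamma>" "form X3 X3 = 1" using X3 by (auto simp: usphere_def)
  have mH: "- H1 \<in> \<aa>" and mZ: "- Z1 \<in> nil"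
    using 1 aa_subspace subspace_neg subspace_span unfolding nil_def by blast+
  have inv_p: "inv p = Exp (- Z1) \<otimes> Exp (- H1) \<otimes> inv m1"
    using mc by (simp add: 1(1) inv_mult_group Exp_neg m_assoc)
  have E: "Ad G (Exp (- H1)) X3 = exp (form \<gamma> (- H1)) *\<^sub>R X3"
    using Ad_Exp_eigenvector[OF rs_bracket[OF mH X3r(1)], of 1] by simp
  have pc: "p \<in> carrier G" "q \<in> carrier G" using mc by (auto simp: 1(1) 2(1))
  have "Ad G (inv p \<otimes> w \<otimes> q) X = Ad G (inv p) (Ad G w (Ad G q X))"
    using pc wc by (simp add: Ad_mult)
  also have "\<dots> = exp (form \<beta> H2) *\<^sub>R Ad G (inv p) X2"
    using pc wc by (simp add: X1(2) X2_def linear_scale[OF Ad_linear])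
  also have "Ad G (inv p) X2 = exp (form \<gamma> (- H1)) *\<^sub>R Ad G (Exp (- Z1)) X3"
    using mc by (simp add: inv_p Ad_mult X3_def[symmetric] E linear_scale[OF Ad_linear])
  finally have "form (Ad G (inv p \<otimes> w \<otimes> q) X) X3 =
      exp (form \<beta> H2) * (exp (form \<gamma> (- H1)) * form (Ad G (Exp (- Z1)) X3) X3)"
    by (simp add: form.scale_left)
  also have "\<dots> = exp (form \<beta> H2) * exp (form \<gamma> (- H1))"
    using nil_diagonal_coeff[OF mZ \<Delta>_aa[OF \<gamma>] X3r(1)] X3r(2) by simp
  finally have "0 < form (Ad G (inv p \<otimes> w \<otimes> q) X) X3" by simp
  also have "\<dots> \<le> coeff \<gamma> \<beta> (inv p \<otimes> w \<otimes> q)"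
    by (rule coeff_upper[OF _ X X3]) (use pc wc in simp)
  finally show ?thesis by (simp add: \<gamma>_def)
qed

text \<open>A supremum of uniformly Lipschitz functions of the operator \<open>Ad G g\<close> is
  Lipschitz in it. The distance of operators is measured on basis vectors because
  \<open>continuous_Ad\<close> treats one vector at a time.\<close>

lemma coeff_diff_le:
  assumes "\<beta> \<in> \<Delta>" "\<gamma> \<in> \<Delta>"
  obtains C where "\<And>g h. g \<in> carrier G \<Longrightarrow> h \<in> carrier G \<Longrightarrow>
    \<bar>coeff \<gamma> \<beta> g - coeff \<gamma> \<beta> h\<bar> \<le> C * (\<Sum>b\<in>Basis. norm (Ad G g b - Ad G h b))"
proof -
  obtain K where K: "K \<ge> 0" "\<And>X Y. norm (form X Y) \<le> norm X * norm Y * K"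
    using bounded_bilinear.nonneg_bounded[OF form_bounded_bilinear] by blast
  obtain R where R: "R > 0" "\<And>X. X \<in> usphere \<beta> \<Longrightarrow> norm X \<le> R"
    using compact_imp_bounded[OF compact_usphere] bounded_pos by blast
  obtain R' where R': "R' > 0" "\<And>X. X \<in> usphere \<gamma> \<Longrightarrow> norm X \<le> R'"
    using compact_imp_bounded[OF compact_usphere] bounded_pos by blast
  define C where "C = R * R' * K"
  have le: "coeff \<gamma> \<beta> g \<le> coeff \<gamma> \<beta> h + C * (\<Sum>b\<in>Basis. norm (Ad G g b - Ad G h b))"
    if g: "g \<in> carrier G" and h: "h \<in> carrier G" for g h
  proof (rule coeff_least[OF assms])
    fix X Y assume XY: "X \<in> usphere \<beta>" "Y \<in> usphere \<gamma>"
    let ?S = "\<Sum>b\<in>Basis. norm (Ad G g b - Ad G h b)"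
    have S0: "?S \<ge> 0" by (intro sum_nonneg) auto
    have "linear (\<lambda>X. Ad G g X - Ad G h X)"
      by (intro linear_compose_sub Ad_linear g h)
    from linear_norm_le_sum_Basis[OF this, of X]
    have 1: "norm (Ad G g X - Ad G h X) \<le> ?S * R"
      using mult_left_mono[OF R(2)[OF XY(1)] S0] by linarith
    have "form (Ad G g X - Ad G h X) Y \<le> norm (Ad G g X - Ad G h X) * norm Y * K"
      using K(2)[of "Ad G g X - Ad G h X" Y] by simp
    also have "\<dots> \<le> (?S * R) * R' * K"
      using 1 R'(2)[OF XY(2)] K(1) S0 R(1) by (intro mult_right_mono mult_mono) auto
    finally have "form (Ad G g X) Y \<le> form (Ad G h X) Y + C * ?S"
      by (simp add: form.diff_left C_def ac_simps)
    then show "form (Ad G g X) Y \<le> coeff \<gamma> \<beta> h + C * ?S"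
      using coeff_upper[OF h XY] by linarith
  qed
  have "\<bar>coeff \<gamma> \<beta> g - coeff \<gamma> \<beta> h\<bar> \<le> C * (\<Sum>b\<in>Basis. norm (Ad G g b - Ad G h b))"
    if g: "g \<in> carrier G" and h: "h \<in> carrier G" for g h
    using le[OF g h] le[OF h g] by (simp add: norm_minus_commute abs_le_iff)
  then show ?thesis using that by blast
qed

lemma continuous_coeff:
  assumes "\<beta> \<in> \<Delta>" "\<gamma> \<in> \<Delta>"
  shows "continuous_map (topo G) euclideanreal (coeff \<gamma> \<beta>)"
proof -
  obtain C where C: "\<And>g h. g \<in> carrier G \<Longrightarrow> h \<in> carrier G \<Longrightarrow>
    \<bar>coeff \<gamma> \<beta> g - coeff \<gamma> \<beta> h\<bar> \<le> C * (\<Sum>b\<in>Basis. norm (Ad G g b - Ad G h b))"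
    using coeff_diff_le[OF assms] by blast
  show ?thesis
    unfolding continuous_map_atin
  proof
    fix h assume h: "h \<in> topspace (topo G)"
    have "((\<lambda>g. Ad G g b) \<longlongrightarrow> Ad G h b) (atin (topo G) h)" for b
      using continuous_Ad[of b] h unfolding continuous_map_atin by simp
    then have "((\<lambda>g. C * (\<Sum>b\<in>Basis. norm (Ad G g b - Ad G h b))) \<longlongrightarrow> C * (\<Sum>b\<in>Basis. norm (Ad G h b - Ad G h b)))
        (atin (topo G) h)"
      by (intro tendsto_intros)
    then have 0: "((\<lambda>g. C * (\<Sum>b\<in>Basis. norm (Ad G g b - Ad G h b))) \<longlongrightarrow> 0) (atin (topo G) h)" by simp
    have "eventually (\<lambda>g. g \<in> carrier G) (atin (topo G) h)"
      unfolding eventually_atin using topspace_topo by (intro disjI2 exI[of _ "carrier G"]) (metis DiffD1 openin_topspace h)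
    then have "eventually (\<lambda>g. norm (coeff \<gamma> \<beta> g - coeff \<gamma> \<beta> h) \<le> C * (\<Sum>b\<in>Basis. norm (Ad G g b - Ad G h b)))
        (atin (topo G) h)"
      by (rule eventually_mono) (use C h topspace_topo in simp)
    then have "((\<lambda>g. coeff \<gamma> \<beta> g - coeff \<gamma> \<beta> h) \<longlongrightarrow> 0) (atin (topo G) h)"
      by (rule Lim_null_comparison[OF _ 0])
    then show "limitin euclideanreal (coeff \<gamma> \<beta>) (coeff \<gamma> \<beta> h) (atin (topo G) h)"
      by (simp add: LIM_zero_iff)
  qed
qed

section \<open>The equivariant map to \<open>\<aa>\<close>\<close>

text \<open>On this set every logarithm in \<open>proj_aa\<close> has a positive argument;
  \<open>opposite_pairs_generic\<close> places the opposite pairs in it.\<close>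

definition generic :: "'g set" where
  "generic = {g \<in> carrier G. \<forall>(\<gamma>, \<beta>)\<in>weights. coeff \<gamma> \<beta> g > 0}"

definition proj_aa :: "'g \<Rightarrow> 'e" where
  "proj_aa g = frame_inv (\<Sum>(\<gamma>, \<beta>)\<in>weights. ln (coeff \<gamma> \<beta> g) *\<^sub>R \<gamma>)"

lemma proj_aa_mem: "proj_aa g \<in> \<aa>"
  unfolding proj_aa_def by (rule frame_inv_aa[OF sum_weights_aa])

lemma weights_D: "(\<gamma>, \<beta>) \<in> weights \<Longrightarrow> \<gamma> \<in> \<Delta>" "(\<gamma>, \<beta>) \<in> weights \<Longrightarrow> \<beta> \<in> \<Delta>"
  "(\<gamma>, \<beta>) \<in> weights \<Longrightarrow> \<beta> \<in> highest_roots"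
  using weights_\<Delta> by (auto simp: weights_def)

lemma generic_pos: "g \<in> generic \<Longrightarrow> (\<gamma>, \<beta>) \<in> weights \<Longrightarrow> coeff \<gamma> \<beta> g > 0"
  by (auto simp: generic_def)

lemma generic_carrier: "g \<in> generic \<Longrightarrow> g \<in> carrier G"
  by (simp add: generic_def)

lemma proj_aa_left_A:
  assumes g: "g \<in> generic" and H: "H \<in> \<aa>"
  shows "proj_aa (Exp H \<otimes> g) = H + proj_aa g"
proof -
  have "ln (coeff \<gamma> \<beta> (Exp H \<otimes> g)) *\<^sub>R \<gamma> = form \<gamma> H *\<^sub>R \<gamma> + ln (coeff \<gamma> \<beta> g) *\<^sub>R \<gamma>"
    if "(\<gamma>, \<beta>) \<in> weights" for \<gamma> \<beta>
    using coeff_left_A[OF weights_D(2)[OF that] weights_D(1)[OF that] H generic_carrier[OF g]] generic_pos[OF g that]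
    by (simp add: ln_mult scaleR_add_left)
  then have "(\<Sum>(\<gamma>, \<beta>)\<in>weights. ln (coeff \<gamma> \<beta> (Exp H \<otimes> g)) *\<^sub>R \<gamma>)
      = frame_op H + (\<Sum>(\<gamma>, \<beta>)\<in>weights. ln (coeff \<gamma> \<beta> g) *\<^sub>R \<gamma>)"
    unfolding frame_op_def sum.distrib[symmetric] by (intro sum.cong) auto
  then show ?thesis
    by (simp add: proj_aa_def linear_add[OF frame_inv_linear] frame_inv_op[OF H])
qed

lemma proj_aa_left_T:
  assumes g: "g \<in> carrier G" and t: "t \<in> T"
  shows "proj_aa (t \<otimes> g) = Ad G t (proj_aa g)"
proof -
  have "coeff (Ad G (inv t) \<gamma>) \<beta> g = coeff \<gamma> \<beta> (t \<otimes> g)" if "(\<gamma>, \<beta>) \<in> weights" for \<gamma> \<beta>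
    using coeff_left_T[OF weights_D(2)[OF that] \<Delta>_Ad[OF T_inv[OF t] weights_D(1)[OF that]] t g]
    by (simp add: Ad_inv T_carrier t)
  then have "Ad G t (\<Sum>(\<gamma>, \<beta>)\<in>weights. ln (coeff \<gamma> \<beta> g) *\<^sub>R \<gamma>)
      = (\<Sum>(\<gamma>, \<beta>)\<in>weights. ln (coeff \<gamma> \<beta> (t \<otimes> g)) *\<^sub>R \<gamma>)"
    unfolding sum_weights_Ad[OF t] by (intro sum.cong) auto
  then show ?thesis
    unfolding proj_aa_def frame_inv_Ad[OF t sum_weights_aa, symmetric] by simp
qed

lemma proj_aa_right_para:
  assumes g: "g \<in> generic" and p: "p \<in> para"
  shows "proj_aa (g \<otimes> p) = proj_aa g"
proof -
  obtain m H Z where p: "p = m \<otimes> Exp H \<otimes> Exp Z" "m \<in> M" "H \<in> \<aa>" "Z \<in> nil"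
    using p by (auto simp: para_def)
  have "ln (coeff \<gamma> \<beta> (g \<otimes> p)) *\<^sub>R \<gamma> = form \<beta> H *\<^sub>R \<gamma> + ln (coeff \<gamma> \<beta> g) *\<^sub>R \<gamma>"
    if "(\<gamma>, \<beta>) \<in> weights" for \<gamma> \<beta>
    using coeff_right_para[OF weights_D(3)[OF that] weights_D(1)[OF that] generic_carrier[OF g] p(2-4)]
      generic_pos[OF g that]
    by (simp add: p(1) ln_mult scaleR_add_left)
  then have "(\<Sum>(\<gamma>, \<beta>)\<in>weights. ln (coeff \<gamma> \<beta> (g \<otimes> p)) *\<^sub>R \<gamma>)
      = (\<Sum>(\<gamma>, \<beta>)\<in>weights. form \<beta> H *\<^sub>R \<gamma>) + (\<Sum>(\<gamma>, \<beta>)\<in>weights. ln (coeff \<gamma> \<beta> g) *\<^sub>R \<gamma>)"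
    unfolding sum.distrib[symmetric] by (intro sum.cong) auto
  then show ?thesis by (simp add: proj_aa_def sum_weights_const)
qed

lemma continuous_proj_aa: "continuous_map (subtopology (topo G) generic) (top_of_set \<aa>) proj_aa"
proof -
  let ?X = "subtopology (topo G) generic"
  have "continuous_map ?X euclidean (\<lambda>g. \<Sum>p\<in>weights. ln (coeff (fst p) (snd p) g) *\<^sub>R fst p)"
  proof (rule continuous_map_sum[OF finite_weights])
    fix p assume p: "p \<in> weights"
    obtain \<gamma> \<beta> where \<gamma>\<beta>: "p = (\<gamma>, \<beta>)" by (cases p)
    have "continuous_map ?X euclideanreal (coeff \<gamma> \<beta>)"
      using continuous_coeff weights_D p \<gamma>\<beta> by (intro continuous_map_from_subtopology) blast
    then have "continuous_map ?X (top_of_set {0<..}) (coeff \<gamma> \<beta>)"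
      by (rule continuous_map_into_subtopology) (use generic_pos p \<gamma>\<beta> in auto)
    moreover have "continuous_map (top_of_set {0<..}) euclidean (\<lambda>r::real. ln r *\<^sub>R \<gamma>)"
      by (auto intro!: continuous_intros)
    ultimately have "continuous_map ?X euclidean ((\<lambda>r. ln r *\<^sub>R \<gamma>) \<circ> coeff \<gamma> \<beta>)"
      by (rule continuous_map_compose)
    then show "continuous_map ?X euclidean (\<lambda>g. ln (coeff (fst p) (snd p) g) *\<^sub>R fst p)"
      by (simp add: \<gamma>\<beta> o_def)
  qed
  moreover have "continuous_map euclidean euclidean frame_inv"
    using frame_inv_linear linear_continuous_on linear_conv_bounded_linear by auto
  ultimately have "continuous_map ?X euclidean (frame_inv \<circ> (\<lambda>g. \<Sum>p\<in>weights. ln (coeff (fst p) (snd p) g) *\<^sub>R fst p))"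
    by (rule continuous_map_compose)
  then have "continuous_map ?X euclidean proj_aa"
    by (simp add: o_def proj_aa_def[abs_def] case_prod_beta)
  then show ?thesis by (rule continuous_map_into_subtopology) (use proj_aa_mem in auto)
qed

text \<open>Every weight is covered by a double coset of its own: translation by a suitable t turns
  the positive component from \<beta> to Ad(w) \<beta> into the one from \<beta> to
  \<gamma>.\<close>

lemma generic_translates:
  assumes g: "g \<in> carrier G" and w: "w \<in> T"
    and bruhat: "\<And>t. t \<in> T \<Longrightarrow> \<exists>p\<in>para. \<exists>q\<in>para. inv t \<otimes> g = inv p \<otimes> w \<otimes> q"
  shows "g \<in> generic"
proof -
  have "coeff \<gamma> \<beta> g > 0" if \<gamma>\<beta>: "(\<gamma>, \<beta>) \<in> weights" for \<gamma> \<beta>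
  proof -
    obtain s where s: "s \<in> T" "\<gamma> = Ad G s \<beta>" "\<beta> \<in> highest_roots"
      using \<gamma>\<beta> by (auto simp: weights_def)
    \<comment> \<open>Then t w = s, so t sends Ad(w) \<beta> to Ad(s) \<beta> = \<gamma>.\<close>
    define t where "t = s \<otimes> inv w"
    have t: "t \<in> T" unfolding t_def by (intro T_mult T_inv s w)
    have tc: "t \<in> carrier G" by (rule T_carrier[OF t])
    obtain p q where pq: "p \<in> para" "q \<in> para" "inv t \<otimes> g = inv p \<otimes> w \<otimes> q" using bruhat[OF t] by blast
    have "coeff (Ad G w \<beta>) \<beta> (inv t \<otimes> g) > 0"
      unfolding pq(3) by (rule coeff_bruhat_pos[OF s(3) pq(1,2) w])
    moreover have "Ad G t (Ad G w \<beta>) = \<gamma>"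
      using s w by (simp add: t_def s(2) Ad_mult Ad_inv T_carrier)
    moreover have "t \<otimes> (inv t \<otimes> g) = g" using tc g by (simp add: m_assoc[symmetric])
    ultimately show ?thesis
      using coeff_left_T[OF highest_\<Delta>[OF s(3)] \<Delta>_Ad[OF w highest_\<Delta>[OF s(3)]] t, of "inv t \<otimes> g"] tc g by simp
  qed
  then show ?thesis using g by (auto simp: generic_def)
qed

end

section \<open>Orbit maps are open\<close>

text \<open>A product of quotient maps need not be a quotient map, whereas openness passes to
  products.\<close>

lemma open_map_prod_mapping:
  assumes "open_map X X' f" "open_map Y Y' g"
  shows "open_map (prod_topology X Y) (prod_topology X' Y') (\<lambda>(x, y). (f x, g y))"
  unfolding open_map_def
proof (intro allI impI)
  fix W assume W: "openin (prod_topology X Y) W"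
  show "openin (prod_topology X' Y') ((\<lambda>(x, y). (f x, g y)) ` W)"
    unfolding openin_prod_topology_alt
  proof (intro allI impI)
    fix a b assume "(a, b) \<in> (\<lambda>(x, y). (f x, g y)) ` W"
    then obtain x y where xy: "(x, y) \<in> W" "a = f x" "b = g y" by auto
    obtain U V where UV: "openin X U" "openin Y V" "x \<in> U" "y \<in> V" "U \<times> V \<subseteq> W"
      using W xy(1) unfolding openin_prod_topology_alt by metis
    have "openin X' (f ` U)" "openin Y' (g ` V)" using assms UV by (auto simp: open_map_def)
    moreover have "f ` U \<times> g ` V \<subseteq> (\<lambda>(x, y). (f x, g y)) ` W" using UV(5) by force
    ultimately show "\<exists>U V. openin X' U \<and> openin Y' V \<and> a \<in> U \<and> b \<in> V \<and> U \<times> V \<subseteq> (\<lambda>(x, y). (f x, g y)) ` W"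
      using UV(3,4) xy(2,3) by blast
  qed
qed

context lie_group begin

text \<open>The saturation of an open set is the union of its right translates by the stabilizer.
  Any \<open>q\<close> compatible with left translation is allowed, so that cosets and flats are
  treated alike without determining a stabilizer.\<close>

lemma orbit_map_open:
  assumes inv: "\<And>k g h. k \<in> carrier G \<Longrightarrow> g \<in> carrier G \<Longrightarrow> h \<in> carrier G \<Longrightarrow> q g = q h \<Longrightarrow> q (k \<otimes> g) = q (k \<otimes> h)"
  shows "open_map (topo G) (quotient_topology (topo G) q) q"
  unfolding open_map_def openin_quotient_topology
proof (intro allI impI conjI)
  fix U assume U: "openin (topo G) U"
  have Uc: "U \<subseteq> carrier G" using openin_subset[OF U] topspace_topo by simp
  then show "q ` U \<subseteq> q ` topspace (topo G)" using topspace_topo by blast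
  define S where "S = {s \<in> carrier G. q s = q \<one>}"
  have "{x \<in> topspace (topo G). q x \<in> q ` U} = (\<Union>s\<in>S. {x \<in> topspace (topo G). x \<otimes> inv s \<in> U})"
  proof (intro subset_antisym subsetI)
    fix x assume "x \<in> {x \<in> topspace (topo G). q x \<in> q ` U}"
    then obtain u where x: "x \<in> carrier G" and u: "u \<in> U" "q x = q u" using topspace_topo by auto
    have uc: "u \<in> carrier G" using u Uc by blast
    have "q (inv u \<otimes> x) = q (inv u \<otimes> u)" by (rule inv) (use x u uc in auto)
    then have "inv u \<otimes> x \<in> S" using x uc by (simp add: S_def)
    moreover have "x \<otimes> inv (inv u \<otimes> x) = u"
      using x uc by (simp add: inv_mult_group m_assoc[symmetric])
    ultimately show "x \<in> (\<Union>s\<in>S. {x \<in> topspace (topo G). x \<otimes> inv s \<in> U})"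
      using x u(1) topspace_topo by force
  next
    fix x assume "x \<in> (\<Union>s\<in>S. {x \<in> topspace (topo G). x \<otimes> inv s \<in> U})"
    then obtain s where s: "s \<in> carrier G" "q s = q \<one>" and x: "x \<in> carrier G" "x \<otimes> inv s \<in> U"
      using topspace_topo by (auto simp: S_def)
    have "q ((x \<otimes> inv s) \<otimes> s) = q ((x \<otimes> inv s) \<otimes> \<one>)" by (rule inv) (use s x in auto)
    then have "q x = q (x \<otimes> inv s)" using s x by (simp add: m_assoc)
    then show "x \<in> {x \<in> topspace (topo G). q x \<in> q ` U}" using x topspace_topo by simp
  qed
  moreover have "openin (topo G) {x \<in> topspace (topo G). x \<otimes> inv s \<in> U}" if "s \<in> S" for s
  proof (rule openin_continuous_map_preimage[OF _ U])
    show "continuous_map (topo G) (topo G) (\<lambda>x. x \<otimes> inv s)"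
      using that by (intro continuous_map_mult) (auto simp: topspace_topo S_def)
  qed
  ultimately show "openin (topo G) {x \<in> topspace (topo G). q x \<in> q ` U}" by auto
qed

lemma homogeneous_space_open:
  assumes "H \<subseteq> carrier G"
  shows "open_map (topo G) (homogeneous_space G H) (\<lambda>g. g <# H)"
  unfolding homogeneous_space_def
  by (rule orbit_map_open) (simp add: lcos_m_assoc[OF assms, symmetric])

lemma continuous_homogeneous_space: "continuous_map (topo G) (homogeneous_space G H) (\<lambda>g. g <# H)"
  unfolding homogeneous_space_def by (rule quotient_imp_continuous_map[OF quotient_map_quotient_topology])

lemma topspace_homogeneous_space: "topspace (homogeneous_space G H) = (\<lambda>g. g <# H) ` carrier G"
  by (simp add: homogeneous_space_def topspace_quotient_topology topspace_topo)

lemma translate_flat_mult: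
  assumes "g \<in> carrier G" "h \<in> carrier G" "\<And>C. C \<in> F \<Longrightarrow> C \<subseteq> carrier G"
  shows "translate_flat G (g \<otimes> h) F = translate_flat G g (translate_flat G h F)"
  unfolding translate_flat_def image_image
  by (rule image_cong[OF refl]) (simp add: lcos_m_assoc assms)

end

section \<open>Flats and opposition\<close>

context cartan_lie_group begin

abbreviation "F0 \<equiv> canonical_flat G K \<aa>"

lemma K_subset: "K \<subseteq> carrier G"
  using K_carrier by blast

lemma para_carrier: "p \<in> para \<Longrightarrow> p \<in> carrier G"
  using T_carrier M_T by (auto simp: para_def)

lemma para_one: "\<one> \<in> para"
proof -
  have "\<one> \<in> M" using subgroup.one_closed[OF subgroup_K] A_carrier by (simp add: centralizer_in_def)
  moreover have "0 \<in> \<aa>" "0 \<in> nil"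
    using aa_subspace subspace_0 unfolding nil_def by (auto simp: span_zero)
  ultimately show ?thesis
    unfolding para_def using r_one[OF one_closed] by (force simp: intro!: exI[of _ \<one>] exI[of _ 0])
qed

lemma para_eq:
  "para = minimal_parabolic G K \<aa> {\<alpha> \<in> restricted_roots G \<aa>. \<alpha> H0 > 0}"
  unfolding minimal_parabolic_def unipotent_radical_def nilradical_space nil_def[symmetric]
  by (auto simp: para_def set_mult_def split_torus_def)

lemma coset_mult_K: "g \<in> carrier G \<Longrightarrow> k \<in> K \<Longrightarrow> (g \<otimes> k) <# K = g <# K"
  using lcos_m_assoc[OF K_subset, of g k] coset_join3[OF K_carrier subgroup_K] K_carrier by simp

lemma coset_K_eqD:
  assumes "g \<in> carrier G" "h <# K = g <# K" "h \<in> carrier G"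
  obtains k where "k \<in> K" "h = g \<otimes> k"
proof -
  have "h \<in> h <# K"
    using subgroup.one_closed[OF subgroup_K] assms(3) by (force simp: l_coset_def)
  then have "h \<in> g <# K" using assms(2) by simp
  then show ?thesis using that by (auto simp: l_coset_def)
qed

lemma F0_carrier: "C \<in> F0 \<Longrightarrow> C \<subseteq> carrier G"
  using l_coset_subset_G[OF K_subset] A_carrier by (auto simp: canonical_flat_def)

lemma translate_F0: "g \<in> carrier G \<Longrightarrow> translate_flat G g F0 = (\<lambda>a. (g \<otimes> a) <# K) ` A"
  unfolding translate_flat_def canonical_flat_def image_image
  by (rule image_cong[OF refl]) (simp add: lcos_m_assoc[OF K_subset] A_carrier)

lemma Exp_in_A: "H \<in> \<aa> \<Longrightarrow> Exp H \<in> A"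
  by (simp add: split_torus_def)

text \<open>The base point of the second flat lies on the first, so g' = g exp(H) k with k in
  \<open>K\<close>. The other points show that exp(Ad(k) H') equals an element of \<open>A\<close>
  times one of \<open>K\<close>, and \<open>Exp_polar_unique\<close> puts Ad(k) H' into
  \<aa>.\<close>

lemma flat_stabilizer:
  assumes g: "g \<in> carrier G" and g': "g' \<in> carrier G"
    and eq: "translate_flat G g F0 = translate_flat G g' F0"
  obtains H k where "H \<in> \<aa>" "k \<in> T" "g' = g \<otimes> Exp H \<otimes> k"
proof -
  have reach: "\<exists>H\<in>\<aa>. \<exists>k\<in>K. g' \<otimes> Exp H' = g \<otimes> Exp H \<otimes> k" if H': "H' \<in> \<aa>" for H'
  proof -
    have "(g' \<otimes> Exp H') <# K \<in> translate_flat G g F0"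
      unfolding eq translate_F0[OF g'] using Exp_in_A[OF H'] by blast
    then obtain H where H: "H \<in> \<aa>" "(g' \<otimes> Exp H') <# K = (g \<otimes> Exp H) <# K"
      unfolding translate_F0[OF g] split_torus_def by blast
    then obtain k where "k \<in> K" "g' \<otimes> Exp H' = g \<otimes> Exp H \<otimes> k"
      using coset_K_eqD[of "g \<otimes> Exp H" "g' \<otimes> Exp H'"] g g' by (metis Exp_carrier m_closed)
    then show ?thesis using H(1) by blast
  qed
  have 0: "0 \<in> \<aa>" using aa_subspace subspace_0 by blast
  obtain H k where Hk: "H \<in> \<aa>" "k \<in> K" "g' = g \<otimes> Exp H \<otimes> k"
    using reach[OF 0] g' by auto
  have kc: "k \<in> carrier G" by (rule K_carrier[OF Hk(2)])
  have "Ad G k H' \<in> \<aa>" if H': "H' \<in> \<aa>" for H'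
  proof -
    obtain H'' k' where 2: "H'' \<in> \<aa>" "k' \<in> K" "g' \<otimes> Exp H' = g \<otimes> Exp H'' \<otimes> k'"
      using reach[OF H'] by blast
    have k'c: "k' \<in> carrier G" by (rule K_carrier[OF 2(2)])
    have mH: "- H \<in> \<aa>" using Hk(1) aa_subspace subspace_neg by blast
    have "g \<otimes> (Exp H \<otimes> k \<otimes> Exp H') = g \<otimes> (Exp H'' \<otimes> k')"
      using 2(3) g kc k'c by (simp add: Hk(3) m_assoc)
    then have e: "Exp H \<otimes> k \<otimes> Exp H' = Exp H'' \<otimes> k'" using g kc k'c by simp
    have "Exp (Ad G k H') = k \<otimes> Exp H' \<otimes> inv k" by (rule Exp_conj[OF kc, symmetric])
    also have "\<dots> = Exp (- H) \<otimes> (Exp H \<otimes> k \<otimes> Exp H') \<otimes> inv k"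
      using kc by (simp add: Exp_neg m_assoc[symmetric])
    also have "\<dots> = (Exp (- H) \<otimes> Exp H'') \<otimes> (k' \<otimes> inv k)"
      unfolding e using kc k'c by (simp add: m_assoc)
    also have "\<dots> = Exp (- H + H'') \<otimes> (k' \<otimes> inv k)" by (simp only: Exp_aa_add[OF mH 2(1)])
    finally have pol: "Exp (Ad G k H') = Exp (- H + H'') \<otimes> (k' \<otimes> inv k)" .
    have sum: "- H + H'' \<in> \<aa>" using mH 2(1) aa_subspace subspace_add by blast
    have "Ad G k H' = - H + H''"
      by (rule Exp_polar_unique[OF Ad_K_pp[OF Hk(2) aa_pp[OF H']] aa_pp[OF sum] K_mult[OF 2(2) K_inv[OF Hk(2)]] pol])
    then show ?thesis using sum by simp
  qed
  then have "k \<in> T" using Hk(2) by (simp add: T_iff)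
  then show ?thesis using that Hk by blast
qed

definition base_point :: "'g \<Rightarrow> 'g \<Rightarrow> 'g set" where
  "base_point g h = (g \<otimes> Exp (proj_aa (inv g \<otimes> h))) <# K"

lemma generic_right_para:
  assumes g: "g \<in> generic" and p: "p \<in> para"
  shows "g \<otimes> p \<in> generic"
proof -
  obtain m H Z where p': "p = m \<otimes> Exp H \<otimes> Exp Z" "m \<in> M" "H \<in> \<aa>" "Z \<in> nil"
    using p by (auto simp: para_def)
  have "coeff \<gamma> \<beta> (g \<otimes> p) > 0" if w: "(\<gamma>, \<beta>) \<in> weights" for \<gamma> \<beta>
    unfolding p'(1)
    using coeff_right_para[OF weights_D(3)[OF w] weights_D(1)[OF w] generic_carrier[OF g] p'(2-4)] generic_pos[OF g w]
    by simp
  then show ?thesis using generic_carrier[OF g] para_carrier[OF p] by (auto simp: generic_def)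
qed

text \<open>Replacing g by g exp(H) k and h by h p turns a value v of \<open>proj_aa\<close> into
  Ad(inv k)(-H + v); then exp(H) cancels and k is absorbed by \<open>K\<close>.\<close>

lemma base_point_well_defined:
  assumes g: "g \<in> carrier G" "g' \<in> carrier G" and h: "h \<in> carrier G" "h' \<in> carrier G"
    and flat: "translate_flat G g F0 = translate_flat G g' F0" and pt: "h <# para = h' <# para"
    and gen: "inv g \<otimes> h \<in> generic"
  shows "base_point g' h' = base_point g h"
proof -
  obtain H k where Hk: "H \<in> \<aa>" "k \<in> T" "g' = g \<otimes> Exp H \<otimes> k"
    using flat_stabilizer[OF g flat] by blast
  have kc: "k \<in> carrier G" by (rule T_carrier[OF Hk(2)])
  have "h' \<otimes> \<one> \<in> h' <# para" using para_one by (auto simp: l_coset_def)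
  then have "h' \<in> h <# para" using h pt by simp
  then obtain p where p: "p \<in> para" "h' = h \<otimes> p" by (auto simp: l_coset_def)
  have pc: "p \<in> carrier G" by (rule para_carrier[OF p(1)])
  let ?y = "inv g \<otimes> h"
  have gen': "?y \<otimes> p \<in> generic" by (rule generic_right_para[OF gen p(1)])
  have mH: "- H \<in> \<aa>" using Hk(1) aa_subspace subspace_neg by blast
  have "inv g' \<otimes> h' = inv k \<otimes> (Exp (- H) \<otimes> (?y \<otimes> p))"
    using g h kc pc by (simp add: Hk(3) p(2) inv_mult_group Exp_neg m_assoc)
  then have "proj_aa (inv g' \<otimes> h') = Ad G (inv k) (- H + proj_aa ?y)"
    using proj_aa_left_T[OF _ T_inv[OF Hk(2)], of "Exp (- H) \<otimes> (?y \<otimes> p)"] generic_carrier[OF gen']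
      proj_aa_left_A[OF gen' mH] proj_aa_right_para[OF gen p(1)] by simp
  then have "Exp (proj_aa (inv g' \<otimes> h')) = inv k \<otimes> Exp (- H + proj_aa ?y) \<otimes> k"
    using Exp_conj[of "inv k" "- H + proj_aa ?y"] kc by simp
  then have "k \<otimes> Exp (proj_aa (inv g' \<otimes> h')) = Exp (- H + proj_aa ?y) \<otimes> k"
    using kc by (simp add: m_assoc[symmetric])
  also have "Exp (- H + proj_aa ?y) = Exp (- H) \<otimes> Exp (proj_aa ?y)"
    by (rule Exp_aa_add[OF mH proj_aa_mem])
  finally have "g' \<otimes> Exp (proj_aa (inv g' \<otimes> h')) = g \<otimes> Exp H \<otimes> (Exp (- H) \<otimes> Exp (proj_aa ?y) \<otimes> k)"
    using g kc by (simp add: Hk(3) m_assoc)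
  also have "\<dots> = g \<otimes> (Exp H \<otimes> Exp (- H)) \<otimes> Exp (proj_aa ?y) \<otimes> k"
    using g kc by (simp only: m_assoc m_closed Exp_carrier)
  also have "\<dots> = g \<otimes> Exp (proj_aa ?y) \<otimes> k" using g by (simp add: Exp_neg)
  finally show ?thesis
    unfolding base_point_def using coset_mult_K[OF _ T_K[OF Hk(2)]] g by simp
qed

lemma base_point_in_flat: "g \<in> carrier G \<Longrightarrow> base_point g h \<in> translate_flat G g F0"
  unfolding base_point_def by (simp add: translate_F0 Exp_in_A proj_aa_mem)

lemma base_point_equivariant:
  assumes "k \<in> carrier G" "g \<in> carrier G" "h \<in> carrier G"
  shows "base_point (k \<otimes> g) (k \<otimes> h) = k <# base_point g h"
proof -
  have "inv (k \<otimes> g) \<otimes> (k \<otimes> h) = inv g \<otimes> (inv k \<otimes> k) \<otimes> h"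
    using assms by (simp only: inv_mult_group m_assoc m_closed inv_closed)
  also have "\<dots> = inv g \<otimes> h" using assms by simp
  finally show ?thesis
    using assms by (simp add: base_point_def lcos_m_assoc[OF K_subset] m_assoc)
qed

abbreviation "orbit_pair \<equiv> (\<lambda>(g, h). (translate_flat G g F0, h <# para))"

text \<open>If h P = q P and g t P = q w0 P, then inv(t) inv(g) h lies in P inv(w0) P. The inverse
  of \<open>w0\<close> appears because the given point, not the one on the boundary, takes the place
  of \<open>P\<close> in the model pair.\<close>

lemma opposite_pairs_generic:
  assumes w0: "w0 \<in> T" and Pos: "para = minimal_parabolic G K \<aa> Pos"
    and g: "g \<in> carrier G" and h: "h \<in> carrier G"
    and opp: "(translate_flat G g F0, h <# para) \<in> opposite_pairs G K \<aa> Pos w0"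
  shows "inv g \<otimes> h \<in> generic"
proof (rule generic_translates[OF _ T_inv[OF w0]])
  fix t assume t: "t \<in> T"
  have tc: "t \<in> carrier G" by (rule T_carrier[OF t])
  have wc: "w0 \<in> carrier G" by (rule T_carrier[OF w0])
  have "g <# (t <# para) \<in> flat_boundary G K \<aa> Pos (translate_flat G g F0)"
    unfolding flat_boundary_def Pos[symmetric] using g t by blast
  then have "opposite G para w0 (h <# para) (g <# (t <# para))"
    using opp by (auto simp: opposite_pairs_def Pos[symmetric])
  then obtain q where q: "q \<in> carrier G" "h <# para = q <# para" "g <# (t <# para) = q <# (w0 <# para)"
    by (auto simp: opposite_def)
  have "h \<otimes> \<one> \<in> h <# para" using para_one by (auto simp: l_coset_def)
  then have "h \<in> q <# para" using h q(2) by simp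
  then obtain p2 where p2: "p2 \<in> para" "h = q \<otimes> p2" by (auto simp: l_coset_def)
  have "g \<otimes> (t \<otimes> \<one>) \<in> g <# (t <# para)" using para_one by (auto simp: l_coset_def)
  then have "g \<otimes> t \<in> q <# (w0 <# para)" using tc q(3) by simp
  then obtain p1 where p1: "p1 \<in> para" "g \<otimes> t = q \<otimes> (w0 \<otimes> p1)" by (auto simp: l_coset_def)
  have pc: "p1 \<in> carrier G" "p2 \<in> carrier G" using p1 p2 para_carrier by auto
  have "inv t \<otimes> (inv g \<otimes> h) = inv (g \<otimes> t) \<otimes> h" using g tc h by (simp add: inv_mult_group m_assoc)
  also have "\<dots> = inv p1 \<otimes> inv w0 \<otimes> (inv q \<otimes> q) \<otimes> p2"
    unfolding p1(2) p2(2) using pc wc q(1)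
    by (simp only: inv_mult_group m_assoc m_closed inv_closed)
  also have "\<dots> = inv p1 \<otimes> inv w0 \<otimes> p2" using pc wc q(1) by simp
  finally show "\<exists>p\<in>para. \<exists>q\<in>para. inv t \<otimes> (inv g \<otimes> h) = inv p \<otimes> inv w0 \<otimes> q"
    using p1(1) p2(1) by blast
qed (use g h in simp)

lemma flat_space_open: "open_map (topo G) (flat_space G K \<aa>) (\<lambda>g. translate_flat G g F0)"
  unfolding flat_space_def
  by (rule orbit_map_open) (simp add: translate_flat_mult[OF _ _ F0_carrier])

lemma continuous_flat_space: "continuous_map (topo G) (flat_space G K \<aa>) (\<lambda>g. translate_flat G g F0)"
  unfolding flat_space_def by (rule quotient_imp_continuous_map[OF quotient_map_quotient_topology])

text \<open>An open map stays open when restricted to a full preimage. Hence continuity on the space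
  of opposite pairs can be tested on pairs of group elements.\<close>

lemma orbit_pair_quotient:
  fixes Q :: "('g set set \<times> 'g set) set"
  assumes Q: "Q \<subseteq> orbit_pair ` (carrier G \<times> carrier G)"
  shows "quotient_map
    (subtopology (prod_topology (topo G) (topo G)) {p \<in> carrier G \<times> carrier G. orbit_pair p \<in> Q})
    (subtopology (prod_topology (flat_space G K \<aa>) (homogeneous_space G para)) Q) orbit_pair"
proof (rule continuous_open_imp_quotient_map)
  let ?X = "prod_topology (topo G) (topo G)" and ?Y = "prod_topology (flat_space G K \<aa>) (homogeneous_space G para)"
  let ?R = "{p \<in> carrier G \<times> carrier G. orbit_pair p \<in> Q}"
  have paras: "para \<subseteq> carrier G" using para_carrier by blast
  have op: "open_map ?X ?Y orbit_pair"
    using open_map_prod_mapping[OF flat_space_open homogeneous_space_open[OF paras]] .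
  have "continuous_map ?X ?Y orbit_pair"
    unfolding case_prod_beta
    by (intro continuous_map_pairedI continuous_map_compose[OF continuous_map_fst continuous_flat_space, unfolded o_def]
        continuous_map_compose[OF continuous_map_snd continuous_homogeneous_space, unfolded o_def])
  then show "continuous_map (subtopology ?X ?R) (subtopology ?Y Q) orbit_pair"
    by (intro continuous_map_into_subtopology continuous_map_from_subtopology) auto
  show "open_map (subtopology ?X ?R) (subtopology ?Y Q) orbit_pair"
    by (rule open_map_restriction[OF op]) (simp add: topspace_topo)
  have "topspace ?Y = orbit_pair ` (carrier G \<times> carrier G)"
    by (force simp: topspace_homogeneous_space flat_space_def topspace_quotient_topology topspace_topo)
  then show "orbit_pair ` topspace (subtopology ?X ?R) = topspace (subtopology ?Y Q)"
    using Q by (auto simp: topspace_topo)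
qed

lemma continuous_base_point:
  assumes R: "\<And>g h. (g, h) \<in> R \<Longrightarrow> g \<in> carrier G \<and> h \<in> carrier G \<and> inv g \<otimes> h \<in> generic"
  shows "continuous_map (subtopology (prod_topology (topo G) (topo G)) R) (homogeneous_space G K) (\<lambda>(g, h). base_point g h)"
proof -
  let ?X = "subtopology (prod_topology (topo G) (topo G)) R"
  have f: "continuous_map ?X (topo G) fst" and s: "continuous_map ?X (topo G) snd"
    by (auto intro: continuous_map_from_subtopology continuous_map_fst continuous_map_snd)
  have "continuous_map ?X (topo G) (\<lambda>p. inv (fst p) \<otimes> snd p)"
    by (intro continuous_map_mult continuous_map_inverse f s)
  then have "continuous_map ?X (subtopology (topo G) generic) (\<lambda>p. inv (fst p) \<otimes> snd p)"
    by (rule continuous_map_into_subtopology) (use R in auto)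
  from continuous_map_compose[OF continuous_map_compose[OF this continuous_proj_aa] continuous_Exp_abelian[OF aa_abelian]]
  have "continuous_map ?X (topo G) (\<lambda>p. Exp (proj_aa (inv (fst p) \<otimes> snd p)))" by (simp add: o_def)
  from continuous_map_compose[OF continuous_map_mult[OF f this] continuous_homogeneous_space[of K]]
  show ?thesis by (simp add: o_def base_point_def case_prod_unfold)
qed

theorem equivariant_projection:
  assumes w0: "w0 \<in> T" and Pos: "para = minimal_parabolic G K \<aa> Pos"
  shows "\<exists>\<Phi> :: 'g set set \<times> 'g set \<Rightarrow> 'g set.
    continuous_map
      (subtopology (prod_topology (flat_space G K \<aa>) (homogeneous_space G para)) (opposite_pairs G K \<aa> Pos w0))
      (homogeneous_space G K) \<Phi> \<and>
    (\<forall>g\<in>carrier G. \<forall>(F, x)\<in>opposite_pairs G K \<aa> Pos w0.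
      \<Phi> (translate_flat G g F, g <# x) = g <# \<Phi> (F, x)) \<and>
    (\<forall>(F, x)\<in>opposite_pairs G K \<aa> Pos w0. \<Phi> (F, x) \<in> F)"
proof -
  let ?Q = "opposite_pairs G K \<aa> Pos w0"
  \<comment> \<open>An arbitrary choice: \<open>base_point_well_defined\<close> makes the value of
    \<Phi> independent of it, and continuity is tested on all pairs of group elements at
    once.\<close>
  define rep where "rep = (\<lambda>p. SOME r. r \<in> carrier G \<times> carrier G \<and> orbit_pair r = p)"
  define \<Phi> where "\<Phi> = (\<lambda>p. base_point (fst (rep p)) (snd (rep p)))"
  have \<Phi>: "\<Phi> (translate_flat G g F0, h <# para) = base_point g h"
    if g: "g \<in> carrier G" and h: "h \<in> carrier G" and gen: "inv g \<otimes> h \<in> generic" for g h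
  proof -
    let ?p = "(translate_flat G g F0, h <# para)"
    have "rep ?p \<in> carrier G \<times> carrier G \<and> orbit_pair (rep ?p) = ?p"
      unfolding rep_def by (rule someI[where x = "(g, h)"]) (use g h in simp)
    then obtain g' h' where r: "rep ?p = (g', h')" "g' \<in> carrier G" "h' \<in> carrier G"
      "translate_flat G g' F0 = translate_flat G g F0" "h' <# para = h <# para"
      by (cases "rep ?p") auto
    have "base_point g' h' = base_point g h"
      by (rule base_point_well_defined[OF g r(2) h r(3) r(4)[symmetric] r(5)[symmetric] gen])
    then show ?thesis by (simp add: \<Phi>_def r(1))
  qed
  have paras: "para \<subseteq> carrier G" using para_carrier by blast
  have rep_ex: "\<exists>g\<in>carrier G. \<exists>h\<in>carrier G. p = (translate_flat G g F0, h <# para) \<and> inv g \<otimes> h \<in> generic"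
    if p: "p \<in> ?Q" for p
  proof -
    obtain g h where gh: "g \<in> carrier G" "h \<in> carrier G" "p = (translate_flat G g F0, h <# para)"
      using p by (auto simp: opposite_pairs_def maximal_flats_def topspace_homogeneous_space Pos[symmetric])
    then show ?thesis using opposite_pairs_generic[OF w0 Pos gh(1,2)] p by blast
  qed
  let ?R = "{p \<in> carrier G \<times> carrier G. orbit_pair p \<in> ?Q}"
  have R: "g \<in> carrier G \<and> h \<in> carrier G \<and> inv g \<otimes> h \<in> generic" if "(g, h) \<in> ?R" for g h
    using that opposite_pairs_generic[OF w0 Pos] by auto
  have "continuous_map (subtopology (prod_topology (topo G) (topo G)) ?R) (homogeneous_space G K) (\<Phi> \<circ> orbit_pair)"
  proof (rule continuous_map_eq[OF continuous_base_point[OF R]])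
    fix p assume "p \<in> topspace (subtopology (prod_topology (topo G) (topo G)) ?R)"
    then have "p \<in> ?R" by simp
    then show "(\<lambda>(g, h). base_point g h) p = (\<Phi> \<circ> orbit_pair) p"
      using R[of "fst p" "snd p"] \<Phi>[of "fst p" "snd p"] by (simp add: case_prod_beta)
  qed
  moreover have "?Q \<subseteq> orbit_pair ` (carrier G \<times> carrier G)"
  proof
    fix p assume p: "p \<in> ?Q"
    obtain g h where gh: "g \<in> carrier G" "h \<in> carrier G" "p = (translate_flat G g F0, h <# para)"
      using rep_ex[OF p] by blast
    show "p \<in> orbit_pair ` (carrier G \<times> carrier G)"
      by (rule image_eqI[of _ _ "(g, h)"]) (use gh in simp_all)
  qed
  ultimately have 1: "continuous_map
      (subtopology (prod_topology (flat_space G K \<aa>) (homogeneous_space G para)) ?Q) (homogeneous_space G K) \<Phi>"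
    using continuous_compose_quotient_map[OF orbit_pair_quotient] by blast
  have 2: "\<Phi> (translate_flat G k F, k <# x) = k <# \<Phi> (F, x)" if k: "k \<in> carrier G" and p: "(F, x) \<in> ?Q" for k F x
  proof -
    obtain g h where gh: "g \<in> carrier G" "h \<in> carrier G" "F = translate_flat G g F0" "x = h <# para"
      "inv g \<otimes> h \<in> generic"
      using rep_ex[OF p] by auto
    have kF: "translate_flat G k F = translate_flat G (k \<otimes> g) F0"
      unfolding gh(3) by (rule translate_flat_mult[OF k gh(1) F0_carrier, symmetric])
    have kx: "k <# x = (k \<otimes> h) <# para"
      unfolding gh(4) by (rule lcos_m_assoc[OF paras k gh(2)])
    have "inv (k \<otimes> g) \<otimes> (k \<otimes> h) = inv g \<otimes> (inv k \<otimes> k) \<otimes> h"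
      using k gh(1,2) by (simp only: inv_mult_group m_assoc m_closed inv_closed)
    then have "inv (k \<otimes> g) \<otimes> (k \<otimes> h) \<in> generic" using k gh by simp
    then show ?thesis
      unfolding kF kx using \<Phi>[of "k \<otimes> g" "k \<otimes> h"] \<Phi>[OF gh(1,2,5)] k gh base_point_equivariant[OF k gh(1,2)] by simp
  qed
  have 3: "\<Phi> (F, x) \<in> F" if p: "(F, x) \<in> ?Q" for F x
  proof -
    obtain g h where gh: "g \<in> carrier G" "h \<in> carrier G" "F = translate_flat G g F0" "x = h <# para"
      "inv g \<otimes> h \<in> generic"
      using rep_ex[OF p] by auto
    then show ?thesis using \<Phi>[OF gh(1,2,5)] base_point_in_flat[OF gh(1)] by simp
  qed
  show ?thesis using 1 2 3 by blast
qed

end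

theorem theorem1:
  fixes G :: "('g, 'e::euclidean_space) lie_struct" (structure)
    and K P :: "'g set" and \<pp> \<aa> :: "'e set" and Pos :: "('e \<Rightarrow> real) set" and w0 :: 'g
  assumes "lie_group G"
    and "connected_space (topo G)"
    and "semisimple G"
    and "noncompact_type G"
    and "finite (group_center G)"
    and "maximal_compact_subgroup G K"
    and "cartan_decomposition G (lie_subalgebra G K) \<pp>"
    and "maximal_abelian_subspace G \<pp> \<aa>"
    and "positive_system G \<aa> Pos"
    and "P = minimal_parabolic G K \<aa> Pos"
    and "represents_longest G K \<aa> Pos w0"
  shows "\<exists>\<Phi> :: 'g set set \<times> 'g set \<Rightarrow> 'g set.
    continuous_map
      (subtopology (prod_topology (flat_space G K \<aa>) (homogeneous_space G P))
        (opposite_pairs G K \<aa> Pos w0))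
      (homogeneous_space G K) \<Phi> \<and>
    (\<forall>g\<in>carrier G. \<forall>(F, x)\<in>opposite_pairs G K \<aa> Pos w0.
      \<Phi> (translate_flat G g F, g <# x) = g <# \<Phi> (F, x)) \<and>
    (\<forall>(F, x)\<in>opposite_pairs G K \<aa> Pos w0. \<Phi> (F, x) \<in> F)"
proof -
  obtain \<theta> where \<theta>: "cartan_involution G \<theta>" "lie_subalgebra G K = {X. \<theta> X = X}" "\<pp> = {X. \<theta> X = - X}"
    using assms(7) unfolding cartan_decomposition_def by blast
  obtain H0 where pos: "H0 \<in> \<aa>" "\<forall>\<alpha>\<in>restricted_roots G \<aa>. \<alpha> H0 \<noteq> 0"
    "Pos = {\<alpha> \<in> restricted_roots G \<aa>. \<alpha> H0 > 0}"
    using assms(9) unfolding positive_system_def by blast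
  interpret lie_group G by (rule assms(1))
  have "subgroup K G" using assms(6) by (simp add: maximal_compact_subgroup_def)
  moreover have "\<alpha> H0 \<noteq> 0" if "\<alpha> \<in> restricted_roots G \<aa>" for \<alpha>
    using pos(2) that by blast
  ultimately interpret cartan_lie_group G K \<theta> \<pp> \<aa> H0
    by (intro cartan_lie_group.intro cartan_lie_group_axioms.intro assms(1,8) \<theta> pos(1))
  have P_eq: "para = minimal_parabolic G K \<aa> Pos" unfolding pos(3) by (rule para_eq)
  have "w0 \<in> normalizer_in G K (split_torus G \<aa>)"
    using assms(11) by (simp add: represents_longest_def)
  from equivariant_projection[OF this P_eq] show ?thesis
    unfolding assms(10) P_eq .
qed

end
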